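(* Let $k$ be a perfect field of characteristic $p>0$. Let $N$ be a lattice of rank $n$, $M=\operatorname{Hom}_{\mathbb{Z}}(N,\mathbb{Z})$, and let $\sigma\subset N_{\mathbb{R}}=N\otimes_{\mathbb{Z}}\mathbb{R}$ be a strongly convex rational polyhedral cone with primitive generators $\vec v_1,\dots,\vec v_r\in N$. Let $S=\sigma^{\vee}\cap M$, $R=k[S]$ and $X=\operatorname{Spec}R$. (1) If $\sigma$ is full-dimensional (i.e. $X$ has no torus factors), then $s(R)=\operatorname{Vol}(P_\sigma)$, where $P_\sigma=\{\vec w\in M_{\mathbb{R}}: 0\le \vec w\cdot\vec v_i<1 \text{ for all } i\}$ and the volume is measured with respect to $M$. (2) In general, let $N'_{\mathbb{R}}\subset N_{\mathbb{R}}$ be the subspace spanned by $\sigma$, $N'=N'_{\mathbb{R}}\cap N$, $M'=\operatorname{Hom}(N',\mathbb{Z})$, and let $\sigma'$ be $\sigma$ regarded as a (full-dimensional) cone in $N'_{\mathbb{R}}$, with associated affine toric variety $X'=\operatorname{Spec}k[(\sigma')^{\vee}\cap M']$, so that $X\cong X'\times T$ for an algebraic torus $T$. Then $s(k[X])=s(k[X'])=\operatorname{Vol}(P_{\sigma'})$, where $P_{\sigma'}=\{\vec w\in M'_{\mathbb{R}}: 0\le\vec w\cdot\vec v_i<1\ \forall i\}$ and volume is measured with respect to $M'$.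
   Context: $\sigma^\vee=\{\vec u\in M_{\mathbb{R}}:\vec u\cdot\vec v\ge0\ \forall \vec v\in\sigma\}$; $k[S]$ is the $k$-span of the monomials $\chi^{\vec u}$, $\vec u\in S$, inside $k[M]$. Primitive generators are the shortest lattice vectors on the rays of $\sigma$. For a ring $R$ of this kind, $R^{1/p^e}$ (equivalently $F^e_*R$) is the $R$-module of $p^e$-th roots of elements of $R$; it is naturally $\frac1{p^e}M$-graded. The free rank $a_e$ of $R^{1/p^e}$ is the number of copies of $R$ (up to degree shift) in a decomposition of $R^{1/p^e}$ into graded indecomposable $R$-modules, and the $F$-signature is $s(R)=\lim_{e\to\infty}a_e/p^{ed}$, $d=\dim R$. Volume relative to a lattice $L$ in $L\otimes\mathbb{R}$ is Lebesgue measure normalized so that a fundamental parallelepiped of $L$ has volume $1$. *)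

theory Defs
  imports "HOL-Analysis.Analysis" "HOL-Algebra.Ideal"
begin

definition rvec :: "int list \<Rightarrow> real list" where
  "rvec u = map real_of_int u"

definition rdot :: "real list \<Rightarrow> real list \<Rightarrow> real" where
  "rdot x y = sum_list (map2 (*) x y)"

definition vadd :: "int list \<Rightarrow> int list \<Rightarrow> int list" where
  "vadd u v = map2 (+) u v"

definition iscale :: "nat \<Rightarrow> int list \<Rightarrow> int list" where
  "iscale q w = map (\<lambda>x. int q * x) w"

definition rcomb :: "nat \<Rightarrow> (nat \<Rightarrow> real) \<Rightarrow> int list list \<Rightarrow> real list" where
  "rcomb m c vs = map (\<lambda>j. \<Sum>i<length vs. c i * real_of_int (vs!i!j)) [0..<m]"

definition icomb :: "nat \<Rightarrow> (nat \<Rightarrow> int) \<Rightarrow> int list list \<Rightarrow> int list" where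
  "icomb m c vs = map (\<lambda>j. \<Sum>i<length vs. c i * vs!i!j) [0..<m]"

definition cone_of :: "nat \<Rightarrow> int list list \<Rightarrow> real list set" where
  "cone_of m vs = {rcomb m c vs | c. \<forall>i. 0 \<le> c i}"

definition rspan :: "nat \<Rightarrow> int list list \<Rightarrow> real list set" where
  "rspan m vs = {rcomb m c vs | c. True}"

definition strongly_convex :: "nat \<Rightarrow> real list set \<Rightarrow> bool" where
  "strongly_convex m \<sigma> \<longleftrightarrow> \<sigma> \<inter> {map uminus x | x. x \<in> \<sigma>} = {replicate m 0}"

definition is_face :: "nat \<Rightarrow> real list set \<Rightarrow> real list set \<Rightarrow> bool" where
  "is_face m F \<sigma> \<longleftrightarrow> (\<exists>u. length u = m \<and> (\<forall>x\<in>\<sigma>. 0 \<le> rdot u x) \<and> F = {x\<in>\<sigma>. rdot u x = 0})"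

definition half_line :: "real list \<Rightarrow> real list set" where
  "half_line w = {map ((*) t) w | t. 0 \<le> t}"

definition is_ray :: "nat \<Rightarrow> real list set \<Rightarrow> real list set \<Rightarrow> bool" where
  "is_ray m F \<sigma> \<longleftrightarrow> is_face m F \<sigma> \<and> (\<exists>w. length w = m \<and> w \<noteq> replicate m 0 \<and> F = half_line w)"

definition primitive :: "nat \<Rightarrow> int list \<Rightarrow> bool" where
  "primitive m v \<longleftrightarrow> length v = m \<and> v \<noteq> replicate m 0 \<and>
     (\<forall>u t. length u = m \<and> 0 < t \<and> t < 1 \<longrightarrow> rvec u \<noteq> map ((*) t) (rvec v))"

definition primitive_ray_generators :: "nat \<Rightarrow> int list list \<Rightarrow> bool" where
  "primitive_ray_generators m vs \<longleftrightarrow>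
     distinct vs \<and> (\<forall>v\<in>set vs. primitive m v) \<and>
     strongly_convex m (cone_of m vs) \<and>
     (\<forall>v\<in>set vs. is_ray m (half_line (rvec v)) (cone_of m vs)) \<and>
     (\<forall>F. is_ray m F (cone_of m vs) \<longrightarrow> (\<exists>v\<in>set vs. rvec v \<in> F))"

definition dual_semigroup :: "nat \<Rightarrow> int list list \<Rightarrow> int list set" where
  "dual_semigroup m vs = {u. length u = m \<and> (\<forall>x\<in>cone_of m vs. 0 \<le> rdot (rvec u) x)}"

definition sgring :: "nat \<Rightarrow> int list set \<Rightarrow> (int list \<Rightarrow> 'k::field) ring" where
  "sgring m S = \<lparr>carrier = {f. finite {u. f u \<noteq> 0} \<and> {u. f u \<noteq> 0} \<subseteq> S},
     mult = (\<lambda>f g w. \<Sum>(u,v)\<in>{(u,v). f u \<noteq> 0 \<and> g v \<noteq> 0 \<and> vadd u v = w}. f u * g v),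
     one = (\<lambda>u. if u = replicate m 0 then 1 else 0),
     zero = (\<lambda>_. 0),
     add = (\<lambda>f g u. f u + g u)\<rparr>"

definition homog :: "(int list \<Rightarrow> 'k::zero) \<Rightarrow> int list \<Rightarrow> bool" where
  "homog f d \<longleftrightarrow> (\<forall>u. f u \<noteq> 0 \<longrightarrow> u = d)"

text \<open>Free rank of F^q_* R (q = p^e): the largest a such that R^a (with degree shifts)
  is a graded direct summand of F^q_* R.  F^q_* R has the same underlying group as R,
  R acts by r . y = r^q y, and the (1/q)M-grading is rescaled by q, so a monomial
  chi^d of F^q_* R has degree d/q.  A graded split copy of R is given by a nonzero
  homogeneous x (of degree dx) and a graded R-linear psi : F^q_* R \<rightarrow> R with
  psi(x_i) = delta_ij.\<close>
definition free_rank :: "(int list \<Rightarrow> 'k::field) ring \<Rightarrow> nat \<Rightarrow> nat" where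
  "free_rank R q = Sup {a. \<exists>x \<psi> dx. \<forall>j<a.
      x j \<in> carrier R \<and> x j \<noteq> \<zero>\<^bsub>R\<^esub> \<and> homog (x j) (dx j) \<and>
      \<psi> j \<in> carrier R \<rightarrow> carrier R \<and>
      (\<forall>y\<in>carrier R. \<forall>z\<in>carrier R. \<psi> j (y \<oplus>\<^bsub>R\<^esub> z) = \<psi> j y \<oplus>\<^bsub>R\<^esub> \<psi> j z) \<and>
      (\<forall>r\<in>carrier R. \<forall>y\<in>carrier R. \<psi> j ((r [^]\<^bsub>R\<^esub> q) \<otimes>\<^bsub>R\<^esub> y) = r \<otimes>\<^bsub>R\<^esub> \<psi> j y) \<and>
      (\<forall>y\<in>carrier R. \<forall>d. homog y d \<longrightarrow>
          (\<forall>w. \<psi> j y w \<noteq> 0 \<longrightarrow> vadd (iscale q w) (dx j) = d)) \<and>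
      (\<forall>i<a. \<psi> j (x i) = (if i = j then \<one>\<^bsub>R\<^esub> else \<zero>\<^bsub>R\<^esub>))}"

definition krull_dim :: "('a, 'b) ring_scheme \<Rightarrow> nat" where
  "krull_dim R = Sup {n. \<exists>P. (\<forall>i\<le>n. primeideal (P i) R) \<and> (\<forall>i<n. P i \<subset> P (Suc i))}"

definition has_F_signature :: "(int list \<Rightarrow> 'k::field) ring \<Rightarrow> nat \<Rightarrow> real \<Rightarrow> bool" where
  "has_F_signature R p v \<longleftrightarrow>
     (\<lambda>e. real (free_rank R (p ^ e)) / real p ^ (e * krull_dim R)) \<longlonglongrightarrow> v"

section \<open>Volume of P_sigma in coordinates: M_R = R^m, volume normalized by Z^m\<close>

definition P_vol :: "nat \<Rightarrow> int list list \<Rightarrow> real" where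
  "P_vol m vs = measure (Pi\<^sub>M {..<m} (\<lambda>_. lborel))
     {w \<in> {..<m} \<rightarrow>\<^sub>E UNIV. \<forall>v\<in>set vs.
        0 \<le> (\<Sum>j<m. w j * real_of_int (v!j)) \<and> (\<Sum>j<m. w j * real_of_int (v!j)) < 1}"

end

theory Submission
  imports Defs "HOL-Library.Poly_Mapping" "HOL-Computational_Algebra.Primes"
begin

text \<open>Writing \<open>q = p\<^sup>e\<close>, a monomial of degree \<open>d\<close> generates a free graded summand of \<open>F\<^sup>e\<^sub>*R\<close> iff
  every element of \<open>S\<close> congruent to \<open>d\<close> modulo \<open>qM\<close> lies in \<open>d + qS\<close>; as each \<open>v\<^sub>i\<close> is primitive
  and spans a face, this means \<open>0 \<le> d\<cdot>v\<^sub>i < q\<close> for all \<open>i\<close>. Two such monomials span independent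
  summands iff their degrees are incongruent modulo \<open>qM\<close>, so the free rank counts residue classes.
  Since \<open>N'\<close> is saturated, \<open>M \<rightarrow> M'\<close> is onto, and the count is \<open>q\<^sup>n\<^sup>-\<^sup>m\<close> times the number of lattice
  points of \<open>qP\<^bsub>\<sigma>'\<^esub>\<close>, where \<open>m\<close> is the rank of \<open>N'\<close>. The Krull dimension is \<open>n\<close>, so
  \<open>s(R)\<close> is the limit of these lattice point counts divided by \<open>q\<^sup>m\<close>, that is, the volume.\<close>

section \<open>The semigroup ring\<close>

text \<open>Both \<open>krull_dim\<close> and \<open>free_rank\<close> are suprema of sets of
  naturals, which carry information only if the sets are bounded; each is computed as an attained
  maximum, from a construction and a matching upper bound. Perfectness of k enters both bounds of
  the free rank: a splitting takes q-th roots of coefficients, and two monomials in one residue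
  class can be exchanged by a factor r^q only if the ratio of their coefficients has a q-th root.
  The geometry is compressed into two integral functionals for each generator v: one with value -1
  on v (primitivity and Bezout) and one vanishing on v and positive on the other generators (v spans
  a face). The first plus a large multiple of the second is a vector w outside S that is negative on
  v alone, and it refutes every degree d with d\<cdot>v \<ge> q. The ring is given by convolution of
  plain functions, so its axioms, its Frobenius powers and its prime ideals are handled through maps
  to Laurent polynomials, which form a domain.\<close>

lemma length_vadd [simp]: "length (vadd u v) = min (length u) (length v)"
  by (simp add: vadd_def)

lemma nth_vadd [simp]: "i < length u \<Longrightarrow> i < length v \<Longrightarrow> vadd u v ! i = u ! i + v ! i"
  by (simp add: vadd_def)

lemma length_iscale [simp]: "length (iscale q u) = length u"
  by (simp add: iscale_def)

lemma nth_iscale [simp]: "i < length u \<Longrightarrow> iscale q u ! i = int q * u ! i"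
  by (simp add: iscale_def)

lemma vadd_zero_left: "length u = n \<Longrightarrow> vadd (replicate n 0) u = u"
  by (rule nth_equalityI) auto

type_synonym 'k laurent = "(nat \<Rightarrow>\<^sub>0 int) \<Rightarrow>\<^sub>0 'k"

text \<open>The image of an element of \<open>k[M]\<close> under the map of group rings induced by \<open>\<rho>\<close>;
  its target is an integral domain by the type class instances for \<open>\<Rightarrow>\<^sub>0\<close>.\<close>

definition pushforward :: "(int list \<Rightarrow> nat \<Rightarrow>\<^sub>0 int) \<Rightarrow> (int list \<Rightarrow> 'k::field) \<Rightarrow> 'k laurent" where
  "pushforward \<rho> f = (\<Sum>u | f u \<noteq> 0. Poly_Mapping.single (\<rho> u) (f u))"

lemma pushforward_superset:
  "finite A \<Longrightarrow> {u. f u \<noteq> 0} \<subseteq> A \<Longrightarrow>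
     pushforward \<rho> f = (\<Sum>u\<in>A. Poly_Mapping.single (\<rho> u) (f u))"
  unfolding pushforward_def by (rule sum.mono_neutral_left) auto

lemma pushforward_zero [simp]: "pushforward \<rho> (\<lambda>_. 0) = 0"
  by (simp add: pushforward_def)

lemma lookup_pushforward:
  assumes "finite {u. f u \<noteq> 0}"
  shows "Poly_Mapping.lookup (pushforward \<rho> f) k = (\<Sum>u | f u \<noteq> 0 \<and> \<rho> u = k. f u)"
proof -
  have "Poly_Mapping.lookup (pushforward \<rho> f) k = (\<Sum>u | f u \<noteq> 0. if \<rho> u = k then f u else 0)"
    by (auto simp: pushforward_def lookup_sum lookup_single when_def intro!: sum.cong)
  also have "\<dots> = (\<Sum>u | f u \<noteq> 0 \<and> \<rho> u = k. f u)"
    using assms by (subst sum.inter_filter[symmetric]) auto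
  finally show ?thesis .
qed

definition monomial :: "int list \<Rightarrow> 'k \<Rightarrow> int list \<Rightarrow> 'k::field" where
  "monomial u c = (\<lambda>w. if w = u then c else 0)"

lemma supp_monomial: "{w. monomial u c w \<noteq> 0} = (if c = 0 then {} else {u})"
  by (auto simp: monomial_def)

lemma pushforward_monomial [simp]:
  "pushforward \<rho> (monomial u c) = Poly_Mapping.single (\<rho> u) c"
proof (cases "c = 0")
  case True
  then show ?thesis by (simp add: pushforward_def supp_monomial)
next
  case False
  then have "pushforward \<rho> (monomial u c) = (\<Sum>w\<in>{u}. Poly_Mapping.single (\<rho> w) (monomial u c w))"
    by (intro pushforward_superset) (auto simp: supp_monomial)
  then show ?thesis by (simp add: monomial_def)
qed

text \<open>Everything about the ring that does not involve the cone is proved for an arbitrary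
  submonoid of Z^n, whose elements are lists of one fixed length.\<close>

locale exponent_monoid =
  fixes n :: nat and S :: "int list set"
  assumes length_S: "u \<in> S \<Longrightarrow> length u = n"
    and zero_S: "replicate n 0 \<in> S"
    and add_S: "u \<in> S \<Longrightarrow> v \<in> S \<Longrightarrow> vadd u v \<in> S"
begin

lemma sgring_simps:
  "\<zero>\<^bsub>sgring n S\<^esub> = (\<lambda>_. 0)"
  "\<one>\<^bsub>sgring n S\<^esub> = monomial (replicate n 0) 1"
  "f \<oplus>\<^bsub>sgring n S\<^esub> g = (\<lambda>u. f u + g u)"
  by (auto simp: sgring_def monomial_def)

lemma carrier_iff:
  "f \<in> carrier (sgring n S) \<longleftrightarrow> finite {u. f u \<noteq> 0} \<and> (\<forall>u. f u \<noteq> 0 \<longrightarrow> u \<in> S)"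
  by (auto simp: sgring_def)

lemma mult_superset:
  assumes "finite A" "{u. f u \<noteq> 0} \<subseteq> A" "finite B" "{u. g u \<noteq> 0} \<subseteq> B"
  shows "(f \<otimes>\<^bsub>sgring n S\<^esub> g) w = (\<Sum>(u,v)\<in>{p\<in>A \<times> B. vadd (fst p) (snd p) = w}. f u * g v)"
proof -
  have "(f \<otimes>\<^bsub>sgring n S\<^esub> g) w = (\<Sum>(u,v) | f u \<noteq> 0 \<and> g v \<noteq> 0 \<and> vadd u v = w. f u * g v)"
    by (simp add: sgring_def)
  also have "\<dots> = (\<Sum>(u,v)\<in>{p\<in>A \<times> B. vadd (fst p) (snd p) = w}. f u * g v)"
    using assms by (intro sum.mono_neutral_left) auto
  finally show ?thesis .
qed

lemma monomial_closed [simp]: "u \<in> S \<Longrightarrow> monomial u c \<in> carrier (sgring n S)"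
  by (auto simp: carrier_iff monomial_def intro: finite_subset[of _ "{u}"])

lemma mult_closed:
  assumes f: "f \<in> carrier (sgring n S)" and g: "g \<in> carrier (sgring n S)"
  shows "f \<otimes>\<^bsub>sgring n S\<^esub> g \<in> carrier (sgring n S)"
proof -
  let ?A = "{u. f u \<noteq> 0}" and ?B = "{u. g u \<noteq> 0}"
  have fin: "finite ?A" "finite ?B" using f g by (auto simp: carrier_iff)
  have "w \<in> (\<lambda>(u,v). vadd u v) ` (?A \<times> ?B)" if "(f \<otimes>\<^bsub>sgring n S\<^esub> g) w \<noteq> 0" for w
  proof -
    from that have "{p\<in>?A \<times> ?B. vadd (fst p) (snd p) = w} \<noteq> {}"
      by (subst (asm) mult_superset[OF fin(1) order.refl fin(2) order.refl]) (metis sum.empty)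
    then show ?thesis by force
  qed
  then have sub: "{w. (f \<otimes>\<^bsub>sgring n S\<^esub> g) w \<noteq> 0} \<subseteq> (\<lambda>(u,v). vadd u v) ` (?A \<times> ?B)"
    by auto
  moreover have "(\<lambda>(u,v). vadd u v) ` (?A \<times> ?B) \<subseteq> S"
    using f g by (auto simp: carrier_iff intro!: add_S)
  ultimately show ?thesis
    unfolding carrier_iff using fin by (blast intro: finite_subset finite_imageI)
qed

lemma pushforward_add:
  assumes "f \<in> carrier (sgring n S)" "g \<in> carrier (sgring n S)"
  shows "pushforward \<rho> (f \<oplus>\<^bsub>sgring n S\<^esub> g) = pushforward \<rho> f + pushforward \<rho> g"
proof -
  let ?A = "{u. f u \<noteq> 0} \<union> {u. g u \<noteq> 0}"
  have fin: "finite ?A" using assms by (auto simp: carrier_iff)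
  have "pushforward \<rho> (f \<oplus>\<^bsub>sgring n S\<^esub> g)
      = (\<Sum>u\<in>?A. Poly_Mapping.single (\<rho> u) ((f \<oplus>\<^bsub>sgring n S\<^esub> g) u))"
    by (rule pushforward_superset[OF fin]) (auto simp: sgring_simps)
  also have "\<dots> = (\<Sum>u\<in>?A. Poly_Mapping.single (\<rho> u) (f u)) + (\<Sum>u\<in>?A. Poly_Mapping.single (\<rho> u) (g u))"
    by (simp add: sgring_simps single_add sum.distrib)
  also have "(\<Sum>u\<in>?A. Poly_Mapping.single (\<rho> u) (f u)) = pushforward \<rho> f"
    by (rule pushforward_superset[OF fin, symmetric]) auto
  also have "(\<Sum>u\<in>?A. Poly_Mapping.single (\<rho> u) (g u)) = pushforward \<rho> g"
    by (rule pushforward_superset[OF fin, symmetric]) auto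
  finally show ?thesis .
qed

text \<open>The pairs of exponents are grouped by their sum. Only additivity of
  \<open>\<rho>\<close> on S is required, not injectivity, so the result covers the embedding of
  k[S] as well as the non-injective maps that define the torus ideals.\<close>

lemma pushforward_mult:
  assumes f: "f \<in> carrier (sgring n S)" and g: "g \<in> carrier (sgring n S)"
    and \<rho>: "\<And>u v. u \<in> S \<Longrightarrow> v \<in> S \<Longrightarrow> \<rho> (vadd u v) = \<rho> u + \<rho> v"
  shows "pushforward \<rho> (f \<otimes>\<^bsub>sgring n S\<^esub> g) = pushforward \<rho> f * pushforward \<rho> g"
proof -
  let ?A = "{u. f u \<noteq> 0}" and ?B = "{u. g u \<noteq> 0}" and ?a = "\<lambda>p. vadd (fst p) (snd p)"
  have fin: "finite ?A" "finite ?B" using f g by (auto simp: carrier_iff)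
  have mult: "(f \<otimes>\<^bsub>sgring n S\<^esub> g) w = (\<Sum>p\<in>{p\<in>?A \<times> ?B. ?a p = w}. f (fst p) * g (snd p))" for w
    by (subst mult_superset[OF fin(1) order.refl fin(2) order.refl]) (simp add: case_prod_unfold)
  have "{w. (f \<otimes>\<^bsub>sgring n S\<^esub> g) w \<noteq> 0} \<subseteq> ?a ` (?A \<times> ?B)"
  proof
    fix w assume "w \<in> {w. (f \<otimes>\<^bsub>sgring n S\<^esub> g) w \<noteq> 0}"
    then have "(\<Sum>p\<in>{p\<in>?A \<times> ?B. ?a p = w}. f (fst p) * g (snd p)) \<noteq> 0"
      by (simp only: mult mem_Collect_eq not_False_eq_True)
    then obtain p where "p \<in> {p\<in>?A \<times> ?B. ?a p = w}"
      by (rule sum.not_neutral_contains_not_neutral)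
    then show "w \<in> ?a ` (?A \<times> ?B)" by blast
  qed
  then have "pushforward \<rho> (f \<otimes>\<^bsub>sgring n S\<^esub> g)
      = (\<Sum>w\<in>?a ` (?A \<times> ?B). Poly_Mapping.single (\<rho> w) (\<Sum>p\<in>{p\<in>?A \<times> ?B. ?a p = w}. f (fst p) * g (snd p)))"
    using fin by (subst pushforward_superset[of "?a ` (?A \<times> ?B)"]) (auto simp: mult)
  also have "\<dots> = (\<Sum>w\<in>?a ` (?A \<times> ?B). \<Sum>p\<in>{p\<in>?A \<times> ?B. ?a p = w}.
      Poly_Mapping.single (\<rho> w) (f (fst p) * g (snd p)))"
  proof (intro sum.cong refl)
    show "Poly_Mapping.single k (sum h P) = (\<Sum>p\<in>P. Poly_Mapping.single k (h p))"
      for k :: "nat \<Rightarrow>\<^sub>0 int" and h :: "int list \<times> int list \<Rightarrow> 'a" and P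
      by (induction P rule: infinite_finite_induct) (auto simp: single_add)
  qed
  also have "\<dots> = (\<Sum>w\<in>?a ` (?A \<times> ?B). \<Sum>p\<in>{p\<in>?A \<times> ?B. ?a p = w}.
      Poly_Mapping.single (\<rho> (fst p)) (f (fst p)) * Poly_Mapping.single (\<rho> (snd p)) (g (snd p)))"
    using f g by (intro sum.cong refl) (auto simp: carrier_iff mult_single \<rho>)
  also have "\<dots> = (\<Sum>p\<in>?A \<times> ?B. Poly_Mapping.single (\<rho> (fst p)) (f (fst p)) * Poly_Mapping.single (\<rho> (snd p)) (g (snd p)))"
    using fin by (intro sum.group) auto
  also have "\<dots> = pushforward \<rho> f * pushforward \<rho> g"
    by (simp add: pushforward_def sum_product sum.cartesian_product case_prod_unfold)
  finally show ?thesis .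
qed

text \<open>\<open>Poly_Mapping.nth\<close> pads a list with zeros to a finitely supported function,
  so this is the inclusion of k[S] into the Laurent polynomials. Padding forgets the length of a
  list; injectivity therefore rests on all exponents in S having length n.\<close>

abbreviation embed :: "(int list \<Rightarrow> 'k::field) \<Rightarrow> 'k laurent" where
  "embed \<equiv> pushforward Poly_Mapping.nth"

lemma nth_vadd_hom:
  "length u = n \<Longrightarrow> length v = n \<Longrightarrow> Poly_Mapping.nth (vadd u v) = Poly_Mapping.nth u + Poly_Mapping.nth v"
  by (rule poly_mapping_eqI) (auto simp: lookup_add nth_default_def)

lemma nth_inject:
  "length u = length v \<Longrightarrow> Poly_Mapping.nth u = Poly_Mapping.nth v \<longleftrightarrow> (u :: int list) = v"
proof
  assume *: "length u = length v" "Poly_Mapping.nth u = Poly_Mapping.nth v"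
  show "u = v"
  proof (rule nth_equalityI)
    fix i assume "i < length u"
    have "nth_default 0 u i = nth_default 0 v i"
      using arg_cong[OF *(2), of "\<lambda>x. Poly_Mapping.lookup x i"] by simp
    with \<open>i < length u\<close> *(1) show "u ! i = v ! i"
      by (simp add: nth_default_nth)
  qed (use * in auto)
qed auto

lemma embed_add:
  assumes "f \<in> carrier (sgring n S)" "g \<in> carrier (sgring n S)"
  shows "embed (f \<oplus>\<^bsub>sgring n S\<^esub> g) = embed f + embed g"
  using assms by (rule pushforward_add)

lemma embed_mult:
  assumes "f \<in> carrier (sgring n S)" "g \<in> carrier (sgring n S)"
  shows "embed (f \<otimes>\<^bsub>sgring n S\<^esub> g) = embed f * embed g"
  using assms by (rule pushforward_mult) (simp add: length_S nth_vadd_hom)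

lemma nth_zero: "Poly_Mapping.nth (replicate m 0) = 0"
  by (rule poly_mapping_eqI) (simp add: nth_default_def)

lemma embed_one: "embed \<one>\<^bsub>sgring n S\<^esub> = (1 :: 'k::field laurent)"
  by (simp add: sgring_simps nth_zero)

lemma lookup_embed:
  assumes "f \<in> carrier (sgring n S)" "length u = n"
  shows "Poly_Mapping.lookup (embed f) (Poly_Mapping.nth u) = f u"
proof -
  have "{w. f w \<noteq> 0 \<and> Poly_Mapping.nth w = Poly_Mapping.nth u} = (if f u = 0 then {} else {u})"
    using assms by (auto simp: carrier_iff length_S nth_inject)
  then show ?thesis
    using assms by (subst lookup_pushforward) (auto simp: carrier_iff)
qed

lemma embed_inject:
  assumes "f \<in> carrier (sgring n S)" "g \<in> carrier (sgring n S)"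
  shows "embed f = embed g \<longleftrightarrow> f = g"
proof
  assume "embed f = embed g"
  show "f = g"
  proof
    fix u show "f u = g u"
    proof (cases "length u = n")
      case True
      then show ?thesis using lookup_embed assms \<open>embed f = embed g\<close> by metis
    next
      case False
      then show ?thesis using assms length_S unfolding carrier_iff by metis
    qed
  qed
qed auto

text \<open>The multiplicative axioms and distributivity are pulled back along the injective map
  \<open>embed\<close>, which avoids rearranging iterated convolution sums.\<close>

lemma cring_sgring: "cring (sgring n S :: (int list \<Rightarrow> 'k::field) ring)"
proof -
  let ?R = "sgring n S :: (int list \<Rightarrow> 'k::field) ring"
  have add: "f \<oplus>\<^bsub>?R\<^esub> g \<in> carrier ?R" if "f \<in> carrier ?R" "g \<in> carrier ?R" for f g
  proof -
    have "{u. f u + g u \<noteq> 0} \<subseteq> {u. f u \<noteq> 0} \<union> {u. g u \<noteq> 0}" by auto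
    then show ?thesis using that unfolding carrier_iff sgring_simps
      by (metis (mono_tags, lifting) Un_iff add_cancel_right_right finite_UnI finite_subset)
  qed
  have one: "\<one>\<^bsub>?R\<^esub> \<in> carrier ?R" by (simp add: sgring_simps zero_S)
  have zero: "\<zero>\<^bsub>?R\<^esub> \<in> carrier ?R" by (simp add: sgring_simps carrier_iff)
  note closed = add one zero mult_closed
  show ?thesis
  proof (rule cringI)
    show "abelian_group ?R"
    proof (rule abelian_groupI)
      fix f assume f: "f \<in> carrier ?R"
      then have "(\<lambda>u. - f u) \<in> carrier ?R" by (simp add: carrier_iff)
      then show "\<exists>g\<in>carrier ?R. g \<oplus>\<^bsub>?R\<^esub> f = \<zero>\<^bsub>?R\<^esub>"
        by (intro bexI[of _ "\<lambda>u. - f u"]) (auto simp: sgring_simps)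
    qed (use closed in \<open>auto simp: sgring_simps algebra_simps\<close>)
    show "comm_monoid ?R"
    proof (rule comm_monoidI)
      fix x y z assume xyz: "x \<in> carrier ?R" "y \<in> carrier ?R" "z \<in> carrier ?R"
      show "x \<otimes>\<^bsub>?R\<^esub> y \<otimes>\<^bsub>?R\<^esub> z = x \<otimes>\<^bsub>?R\<^esub> (y \<otimes>\<^bsub>?R\<^esub> z)"
        using xyz by (subst embed_inject[symmetric]) (auto simp: closed embed_mult mult_ac)
    next
      fix x y assume xy: "x \<in> carrier ?R" "y \<in> carrier ?R"
      show "x \<otimes>\<^bsub>?R\<^esub> y = y \<otimes>\<^bsub>?R\<^esub> x"
        using xy by (subst embed_inject[symmetric]) (auto simp: closed embed_mult mult_ac)
    next
      fix x assume x: "x \<in> carrier ?R"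
      show "\<one>\<^bsub>?R\<^esub> \<otimes>\<^bsub>?R\<^esub> x = x"
        using x by (subst embed_inject[symmetric]) (auto simp: closed embed_mult embed_one)
    qed (use closed in auto)
    fix x y z assume xyz: "x \<in> carrier ?R" "y \<in> carrier ?R" "z \<in> carrier ?R"
    show "(x \<oplus>\<^bsub>?R\<^esub> y) \<otimes>\<^bsub>?R\<^esub> z = x \<otimes>\<^bsub>?R\<^esub> z \<oplus>\<^bsub>?R\<^esub> y \<otimes>\<^bsub>?R\<^esub> z"
      using xyz by (subst embed_inject[symmetric]) (auto simp: closed embed_mult embed_add algebra_simps)
  qed
qed

lemma embed_power:
  assumes "f \<in> carrier (sgring n S)"
  shows "embed (f [^]\<^bsub>sgring n S\<^esub> (q::nat)) = (embed f :: 'k::field laurent) ^ q"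
proof -
  interpret cring "sgring n S :: (int list \<Rightarrow> 'k) ring" by (rule cring_sgring)
  show ?thesis using assms
    by (induction q) (auto simp: embed_one embed_mult mult_ac)
qed

end

section \<open>Frobenius powers in the semigroup ring\<close>

lemma CHAR_laurent:
  "CHAR('k::field laurent) = CHAR('k)"
proof (rule CHAR_eqI)
  have *: "(of_nat m :: 'k laurent) = 0 \<longleftrightarrow> (of_nat m :: 'k) = 0" for m
  proof -
    have "Poly_Mapping.single (0 :: nat \<Rightarrow>\<^sub>0 int) (of_nat m :: 'k) = 0 \<longleftrightarrow> (of_nat m :: 'k) = 0"
      by (metis lookup_single_eq lookup_zero single_zero)
    then show ?thesis by (simp del: of_nat_eq_0_iff_char_dvd)
  qed
  show "(of_nat CHAR('k) :: 'k laurent) = 0" by (simp only: *) simp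
  show "CHAR('k) dvd x" if "(of_nat x :: 'k laurent) = 0" for x
    using that unfolding * by (simp add: of_nat_eq_0_iff_char_dvd)
qed

context exponent_monoid
begin

lemma iscale_S: "u \<in> S \<Longrightarrow> iscale q u \<in> S"
proof (induction q)
  case 0
  then have "iscale 0 u = replicate n 0"
    by (intro nth_equalityI) (auto simp: length_S)
  then show ?case using zero_S by simp
next
  case (Suc q)
  have "iscale (Suc q) u = vadd u (iscale q u)"
    by (intro nth_equalityI) (auto simp: algebra_simps)
  then show ?case using Suc add_S by simp
qed

lemma nth_iscale_power:
  "(Poly_Mapping.single (Poly_Mapping.nth u) c :: 'k::field laurent) ^ q
     = Poly_Mapping.single (Poly_Mapping.nth (iscale q u)) (c ^ q)"
proof (induction q)
  case 0
  have "Poly_Mapping.nth (iscale 0 u) = 0"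
    by (rule poly_mapping_eqI) (auto simp: nth_default_def)
  then show ?case by simp
next
  case (Suc q)
  have "Poly_Mapping.nth u + Poly_Mapping.nth (iscale q u) = Poly_Mapping.nth (iscale (Suc q) u)"
    by (rule poly_mapping_eqI) (auto simp: lookup_add nth_default_def algebra_simps)
  with Suc show ?case by (simp add: mult_single)
qed

lemma monomial_power:
  assumes "u \<in> S"
  shows "monomial u c [^]\<^bsub>sgring n S\<^esub> (q::nat) = monomial (iscale q u) (c ^ q :: 'k::field)"
proof -
  interpret cring "sgring n S :: (int list \<Rightarrow> 'k) ring" by (rule cring_sgring)
  show ?thesis using assms
    by (subst embed_inject[symmetric]) (auto simp: iscale_S embed_power nth_iscale_power)
qed

lemma monomial_mult:
  assumes "u \<in> S" "v \<in> S"
  shows "monomial u c \<otimes>\<^bsub>sgring n S\<^esub> monomial v d = monomial (vadd u v) (c * d :: 'k::field)"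
proof -
  have "embed (monomial u c \<otimes>\<^bsub>sgring n S\<^esub> monomial v d) = (embed (monomial (vadd u v) (c * d)) :: 'k laurent)"
    using assms by (simp add: embed_mult mult_single nth_vadd_hom length_S)
  moreover have "monomial u c \<otimes>\<^bsub>sgring n S\<^esub> monomial v d \<in> carrier (sgring n S)"
    using assms by (simp add: mult_closed)
  moreover have "monomial (vadd u v) (c * d) \<in> carrier (sgring n S)"
    using assms by (simp add: add_S)
  ultimately show ?thesis using embed_inject by blast
qed

text \<open>The freshman's dream, applied to \<open>embed r\<close> as a sum of monomials in the
  Laurent ring, which has the characteristic of k. The sum on the right has at most one term because
  \<open>iscale q\<close> is injective; this form yields the root coefficient or 0 without a case
  distinction on divisibility of d by q.\<close>

lemma frobenius_power:
  assumes r: "r \<in> carrier (sgring n S)" and p: "prime CHAR('k::field)" and q: "q = CHAR('k) ^ e"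
  shows "r [^]\<^bsub>sgring n S\<^esub> q = (\<lambda>d. \<Sum>s | r s \<noteq> 0 \<and> iscale q s = d. (r s :: 'k) ^ q)" (is "_ = ?F")
proof -
  interpret cring "sgring n S :: (int list \<Rightarrow> 'k) ring" by (rule cring_sgring)
  have q0: "q > 0" using p q by (simp add: prime_gt_0_nat)
  have inj: "iscale q s = iscale q t \<Longrightarrow> s = t" for s t
    using q0 by (auto simp: iscale_def inj_map_eq_map inj_on_def)
  have fin: "finite {s. r s \<noteq> 0}" using r by (simp add: carrier_iff)
  have supp: "d \<in> iscale q ` {s. r s \<noteq> 0}" if "?F d \<noteq> 0" for d
  proof -
    from that obtain s where "s \<in> {s. r s \<noteq> 0 \<and> iscale q s = d}"
      by (rule sum.not_neutral_contains_not_neutral)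
    then show ?thesis by blast
  qed
  have Fc: "?F \<in> carrier (sgring n S)"
    unfolding carrier_iff
  proof
    show "finite {u. ?F u \<noteq> 0}"
      by (rule finite_subset[OF _ finite_imageI[OF fin, of "iscale q"]]) (use supp in blast)
    show "\<forall>u. ?F u \<noteq> 0 \<longrightarrow> u \<in> S"
      using supp r iscale_S by (fastforce simp: carrier_iff)
  qed
  have Fs: "?F (iscale q s) = r s ^ q" if "r s \<noteq> 0" for s
  proof -
    have "{t. r t \<noteq> 0 \<and> iscale q t = iscale q s} = {s}" using that inj by auto
    then show ?thesis by simp
  qed
  have "embed ?F = (\<Sum>d\<in>iscale q ` {s. r s \<noteq> 0}. Poly_Mapping.single (Poly_Mapping.nth d) (?F d))"
    using fin supp by (intro pushforward_superset) auto
  also have "\<dots> = (\<Sum>s | r s \<noteq> 0. Poly_Mapping.single (Poly_Mapping.nth (iscale q s)) (r s ^ q))"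
    by (subst sum.reindex) (auto simp: inj_on_def inj Fs)
  also have "\<dots> = (\<Sum>s | r s \<noteq> 0. (Poly_Mapping.single (Poly_Mapping.nth s) (r s)) ^ q)"
    by (simp add: nth_iscale_power)
  also have "\<dots> = embed r ^ q"
    unfolding pushforward_def
    by (rule freshmans_dream_sum'[symmetric, of _ e]) (simp_all add: CHAR_laurent p q)
  also have "\<dots> = embed (r [^]\<^bsub>sgring n S\<^esub> q)"
    using r by (simp add: embed_power)
  finally show ?thesis
    using Fc r by (subst embed_inject[symmetric]) auto
qed

end

section \<open>Krull dimension\<close>

text \<open>Gaussian elimination by induction on the set J of equations: an equation j that involves
  some unknown \<open>i0\<close> is solved for it, which leaves one equation and one unknown
  less.\<close>

lemma homogeneous_system_nontrivial:
  fixes f :: "'i \<Rightarrow> 'j \<Rightarrow> 'k::field"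
  assumes "finite J" "finite I" "card J < card I"
  shows "\<exists>c. (\<exists>i\<in>I. c i \<noteq> 0) \<and> (\<forall>j\<in>J. (\<Sum>i\<in>I. c i * f i j) = 0)"
  using assms
proof (induction J arbitrary: I f rule: finite_induct)
  case empty
  then have "I \<noteq> {}" by auto
  then show ?case by (intro exI[of _ "\<lambda>_. 1"]) auto
next
  case (insert j J)
  show ?case
  proof (cases "\<forall>i\<in>I. f i j = 0")
    case True
    have "card J < card I" using insert by simp
    then obtain c where "\<exists>i\<in>I. c i \<noteq> 0" "\<forall>j\<in>J. (\<Sum>i\<in>I. c i * f i j) = 0"
      using insert.IH[of I f] insert.prems by blast
    with True show ?thesis by (intro exI[of _ c]) auto
  next
    case False
    then obtain i0 where i0: "i0 \<in> I" "f i0 j \<noteq> 0" by auto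
    define f' where "f' i j' = f i j' - f i j / f i0 j * f i0 j'" for i j'
    have "card J < card (I - {i0})" using insert i0 by simp
    then obtain c where c: "\<exists>i\<in>I - {i0}. c i \<noteq> 0" "\<forall>j'\<in>J. (\<Sum>i\<in>I - {i0}. c i * f' i j') = 0"
      using insert.IH[of "I - {i0}" f'] insert.prems by blast
    \<comment> \<open>The value at \<open>i0\<close> is the one forced by equation j.\<close>
    define d where "d = c(i0 := - (\<Sum>i\<in>I - {i0}. c i * f i j) / f i0 j)"
    have sum_d: "(\<Sum>i\<in>I. d i * f i j') = (\<Sum>i\<in>I - {i0}. c i * f' i j')" for j'
    proof -
      have "(\<Sum>i\<in>I. d i * f i j') = d i0 * f i0 j' + (\<Sum>i\<in>I - {i0}. d i * f i j')"
        using i0 insert.prems by (simp add: sum.remove)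
      also have "(\<Sum>i\<in>I - {i0}. d i * f i j') = (\<Sum>i\<in>I - {i0}. c i * f i j')"
        by (intro sum.cong) (auto simp: d_def)
      also have "d i0 * f i0 j' = - (\<Sum>i\<in>I - {i0}. c i * (f i j / f i0 j * f i0 j'))"
        by (simp add: d_def sum_distrib_right sum_divide_distrib mult.assoc)
      finally show ?thesis by (simp add: f'_def algebra_simps sum_subtractf)
    qed
    have "(\<Sum>i\<in>I - {i0}. c i * f' i j) = 0" using i0 by (simp add: f'_def)
    then have "\<forall>j'\<in>insert j J. (\<Sum>i\<in>I. d i * f i j') = 0"
      using c(2) by (auto simp: sum_d)
    moreover have "\<exists>i\<in>I. d i \<noteq> 0" using c(1) by (auto simp: d_def)
    ultimately show ?thesis by blast
  qed
qed

text \<open>Dividing a relation among \<open>X\<^sub>0, \<dots>\<close> by the lowest power of \<open>X\<^sub>i \<in> P\<^sub>i\<^sub>+\<^sub>1 - P\<^sub>i\<close> and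
  reducing modulo \<open>P\<^sub>i\<^sub>+\<^sub>1\<close> eliminates \<open>X\<^sub>i\<close>; repeating this leaves a single
  coefficient.\<close>

lemma prime_chain_no_relation:
  fixes P :: "nat \<Rightarrow> 'a::comm_ring_1 set" and X :: "nat \<Rightarrow> 'a" and B :: "'a set"
  assumes B: "0 \<in> B" "1 \<in> B" "\<And>x y. x \<in> B \<Longrightarrow> y \<in> B \<Longrightarrow> x + y \<in> B" "\<And>x y. x \<in> B \<Longrightarrow> y \<in> B \<Longrightarrow> x * y \<in> B"
    and diff: "\<And>i x y. i \<le> N \<Longrightarrow> x \<in> P i \<Longrightarrow> y \<in> P i \<Longrightarrow> x - y \<in> P i"
    and ideal: "\<And>i x y. i \<le> N \<Longrightarrow> x \<in> B \<Longrightarrow> y \<in> P i \<Longrightarrow> x * y \<in> P i"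
    and prime: "\<And>i x y. i \<le> N \<Longrightarrow> x \<in> B \<Longrightarrow> y \<in> B \<Longrightarrow> x * y \<in> P i \<Longrightarrow> x \<in> P i \<or> y \<in> P i"
    and chain: "\<And>i. i < N \<Longrightarrow> P i \<subseteq> P (Suc i)"
    and X: "\<And>i. i < N \<Longrightarrow> X i \<in> B \<and> X i \<in> P (Suc i) \<and> X i \<notin> P i"
    and c: "\<And>a. c a \<in> B \<and> (c a \<in> P N \<longrightarrow> a \<notin> I)"
    and I: "finite I" "I \<noteq> {}" "\<And>a b. a \<in> I \<Longrightarrow> b \<in> I \<Longrightarrow> (\<And>j. j < N \<Longrightarrow> a j = b j) \<Longrightarrow> a = b"
  shows "(\<Sum>a\<in>I. c a * (\<Prod>j<N. X j ^ a j)) \<notin> P 0"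
proof -
  have B_sum: "sum h A \<in> B" if "\<And>a. a \<in> A \<Longrightarrow> h a \<in> B" for h and A :: "'c set"
    using that by (induction A rule: infinite_finite_induct) (auto intro: B)
  have B_prod: "prod h A \<in> B" if "\<And>a. a \<in> A \<Longrightarrow> h a \<in> B" for h and A :: "'c set"
    using that by (induction A rule: infinite_finite_induct) (auto intro: B)
  have B_pow: "x ^ k \<in> B" if "x \<in> B" for x k
    using that by (induction k) (auto intro: B)
  \<comment> \<open>The statement is generalised to relations in the variables from index i on.
    Separation of the exponent vectors by the coordinates from i on is inherited by those sharing
    the same i-th coordinate, and at i = N it leaves a single vector.\<close>
  have "(\<Sum>a\<in>J. c a * (\<Prod>j\<in>{i..<N}. X j ^ a j)) \<notin> P i"
    if "i \<le> N" "J \<subseteq> I" "J \<noteq> {}" "\<And>a b. a \<in> J \<Longrightarrow> b \<in> J \<Longrightarrow> (\<And>j. i \<le> j \<Longrightarrow> j < N \<Longrightarrow> a j = b j) \<Longrightarrow> a = b" for i J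
    using that
  proof (induction "N - i" arbitrary: i J)
    case 0
    then have "i = N" by simp
    obtain a where "a \<in> J" using 0 by auto
    moreover have "b = a" if "b \<in> J" for b
      using 0(5)[OF that \<open>a \<in> J\<close>] \<open>i = N\<close> by simp
    ultimately have "J = {a}" by blast
    then show ?case using c \<open>i = N\<close> 0 by auto
  next
    case (Suc k)
    then have i: "i < N" by simp
    have finJ: "finite J" using finite_subset[OF Suc.prems(2) I(1)] .
    define \<mu> where "\<mu> = Min ((\<lambda>a. a i) ` J)"
    define J' where "J' = {a\<in>J. a i = \<mu>}"
    define m where "m a = c a * (\<Prod>j\<in>{Suc i..<N}. X j ^ a j)" for a
    have \<mu>_le: "\<mu> \<le> a i" if "a \<in> J" for a
      using that finJ by (simp add: \<mu>_def)
    have "\<mu> \<in> (\<lambda>a. a i) ` J" unfolding \<mu>_def using finJ Suc by (intro Min_in) auto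
    then have J': "J' \<noteq> {}" "J' \<subseteq> J" by (auto simp: J'_def)
    have mB: "m a \<in> B" for a
      unfolding m_def using c X by (intro B(4) B_prod B_pow) auto
    \<comment> \<open>\<open>Z\<close> is the relation divided by the lowest power of X i;
      \<open>W\<close> collects the terms that still contain X i, divided by it once more.\<close>
    define Z where "Z = (\<Sum>a\<in>J. X i ^ (a i - \<mu>) * m a)"
    define W where "W = (\<Sum>a\<in>J - J'. X i ^ (a i - \<mu> - 1) * m a)"
    have XB: "X i \<in> B" using X i by auto
    have ZB: "Z \<in> B" and WB: "W \<in> B"
      unfolding Z_def W_def by (intro B_sum B(4) B_pow mB XB)+
    have "(\<Sum>a\<in>J. c a * (\<Prod>j\<in>{i..<N}. X j ^ a j)) = X i ^ \<mu> * Z"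
      unfolding Z_def sum_distrib_left
    proof (rule sum.cong)
      fix a assume "a \<in> J"
      then have "X i ^ a i = X i ^ \<mu> * X i ^ (a i - \<mu>)"
        using \<mu>_le by (simp flip: power_add)
      then show "c a * (\<Prod>j\<in>{i..<N}. X j ^ a j) = X i ^ \<mu> * (X i ^ (a i - \<mu>) * m a)"
        using i by (simp add: m_def prod.atLeast_Suc_lessThan mult_ac)
    qed simp
    moreover have Z: "Z = (\<Sum>a\<in>J'. m a) + X i * W"
    proof -
      have "Z = (\<Sum>a\<in>J'. X i ^ (a i - \<mu>) * m a) + (\<Sum>a\<in>J - J'. X i ^ (a i - \<mu>) * m a)"
        unfolding Z_def using J' finJ by (simp add: sum.subset_diff add.commute)
      also have "(\<Sum>a\<in>J'. X i ^ (a i - \<mu>) * m a) = (\<Sum>a\<in>J'. m a)"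
        by (intro sum.cong) (auto simp: J'_def)
      also have "(\<Sum>a\<in>J - J'. X i ^ (a i - \<mu>) * m a) = X i * W"
        unfolding W_def sum_distrib_left
      proof (rule sum.cong)
        fix a assume "a \<in> J - J'"
        then have "a i - \<mu> = Suc (a i - \<mu> - 1)"
          using \<mu>_le[of a] by (auto simp: J'_def)
        then have "X i ^ (a i - \<mu>) = X i * X i ^ (a i - \<mu> - 1)" by (metis power_Suc)
        then show "X i ^ (a i - \<mu>) * m a = X i * (X i ^ (a i - \<mu> - 1) * m a)"
          by (simp add: mult_ac)
      qed simp
      finally show ?thesis .
    qed
    moreover have "Z \<notin> P i"
    proof
      assume "Z \<in> P i"
      then have "Z \<in> P (Suc i)" using chain i by auto
      moreover have "W * X i \<in> P (Suc i)" using ideal[of "Suc i" W "X i"] i WB X by auto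
      ultimately have "Z - W * X i \<in> P (Suc i)" using diff i by auto
      then have "(\<Sum>a\<in>J'. m a) \<in> P (Suc i)" by (simp add: Z mult.commute)
      moreover have "(\<Sum>a\<in>J'. m a) \<notin> P (Suc i)"
        unfolding m_def
      proof (rule Suc.hyps(1))
        fix a b assume "a \<in> J'" "b \<in> J'" and eq: "\<And>j. Suc i \<le> j \<Longrightarrow> j < N \<Longrightarrow> a j = b j"
        then show "a = b"
          using Suc.prems(4)[of a b] by (auto simp: J'_def) (metis Suc_leI le_neq_implies_less)
      qed (use Suc J' in auto)
      ultimately show False by blast
    qed
    \<comment> \<open>Powers of X i can be cancelled from a membership in P i, since P i is prime
      and omits X i.\<close>
    moreover have "Z \<in> P i" if "X i ^ l * Z \<in> P i" for l
      using that
    proof (induction l)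
      case (Suc l)
      have "X i \<in> P i \<or> X i ^ l * Z \<in> P i"
        using Suc by (intro prime) (use i XB ZB B B_pow in \<open>auto simp: mult.assoc\<close>)
      then show ?case using Suc X i by auto
    qed simp
    ultimately show ?case by metis
  qed
  from this[of 0 I] show ?thesis
    using I by (auto simp: atLeast0LessThan)
qed

section \<open>Counting Laurent monomials in a box\<close>

definition exponent_box :: "nat \<Rightarrow> nat \<Rightarrow> (nat \<Rightarrow>\<^sub>0 int) set" where
  "exponent_box n D = {k. \<forall>j. \<bar>Poly_Mapping.lookup k j\<bar> \<le> (if j < n then int D else 0)}"

lemma exponent_boxD:
  "k \<in> exponent_box n D \<Longrightarrow> \<bar>Poly_Mapping.lookup k j\<bar> \<le> (if j < n then int D else 0)"
  by (simp add: exponent_box_def)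

text \<open>The exponent type has infinitely many variables, but in the box all coordinates from n
  on vanish, so restriction to the first n coordinates is injective.\<close>

lemma card_exponent_box: "finite (exponent_box n D)" "card (exponent_box n D) \<le> (2 * D + 1) ^ n"
proof -
  let ?Q = "{..<n} \<rightarrow>\<^sub>E {- int D..int D}" and ?r = "\<lambda>k. restrict (Poly_Mapping.lookup k) {..<n}"
  have inj: "inj_on ?r (exponent_box n D)"
  proof (intro inj_onI poly_mapping_eqI)
    fix x y j assume xy: "x \<in> exponent_box n D" "y \<in> exponent_box n D" "?r x = ?r y"
    show "Poly_Mapping.lookup x j = Poly_Mapping.lookup y j"
    proof (cases "j < n")
      case True
      then show ?thesis using fun_cong[OF xy(3), of j] by simp
    next
      case False
      then show ?thesis using exponent_boxD[OF xy(1), of j] exponent_boxD[OF xy(2), of j] by simp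
    qed
  qed
  have sub: "?r ` exponent_box n D \<subseteq> ?Q"
  proof (rule image_subsetI)
    fix k assume k: "k \<in> exponent_box n D"
    show "?r k \<in> ?Q"
    proof (rule PiE_I)
      fix j assume "j \<in> {..<n}"
      then show "?r k j \<in> {- int D..int D}" using exponent_boxD[OF k, of j] by auto
    qed auto
  qed
  have fin: "finite ?Q" by (intro finite_PiE) auto
  show "finite (exponent_box n D)"
    using finite_imageD[OF finite_subset[OF sub fin] inj] .
  have "card (exponent_box n D) \<le> card ?Q"
    using card_inj_on_le[OF inj sub fin] .
  also have "card ?Q = (2 * D + 1) ^ n"
  proof -
    have "nat (int D + 1 + int D) = 2 * D + 1" by simp
    then show ?thesis by (simp add: card_PiE)
  qed
  finally show "card (exponent_box n D) \<le> (2 * D + 1) ^ n" .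
qed

lemma exponent_box_add:
  assumes "x \<in> exponent_box n D" "y \<in> exponent_box n E"
  shows "x + y \<in> exponent_box n (D + E)"
  unfolding exponent_box_def mem_Collect_eq lookup_add
proof
  fix j
  show "\<bar>Poly_Mapping.lookup x j + Poly_Mapping.lookup y j\<bar> \<le> (if j < n then int (D + E) else 0)"
    using exponent_boxD[OF assms(1), of j] exponent_boxD[OF assms(2), of j] by (auto split: if_splits)
qed

lemma exponent_box_mono: "D \<le> E \<Longrightarrow> exponent_box n D \<subseteq> exponent_box n E"
  unfolding exponent_box_def by (auto intro: order_trans)

lemma keys_mult_box:
  "Poly_Mapping.keys f \<subseteq> exponent_box n D \<Longrightarrow> Poly_Mapping.keys g \<subseteq> exponent_box n E \<Longrightarrow>
     Poly_Mapping.keys (f * g :: 'k::field laurent) \<subseteq> exponent_box n (D + E)"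
  using keys_mult[of f g] exponent_box_add by fast

lemma keys_one_box: "Poly_Mapping.keys (1 :: 'k::field laurent) \<subseteq> exponent_box n D"
  by (simp add: exponent_box_def)

lemma keys_power_box:
  "Poly_Mapping.keys f \<subseteq> exponent_box n D \<Longrightarrow> Poly_Mapping.keys (f ^ a :: 'k::field laurent) \<subseteq> exponent_box n (a * D)"
proof (induction a)
  case (Suc a)
  then show ?case using keys_mult_box[of f n D "f ^ a" "a * D"] by simp
qed (use keys_one_box in simp)

lemma keys_prod_box:
  assumes "finite J" "\<And>j. j \<in> J \<Longrightarrow> Poly_Mapping.keys (f j) \<subseteq> exponent_box n D"
  shows "Poly_Mapping.keys (prod f J :: 'k::field laurent) \<subseteq> exponent_box n (card J * D)"
  using assms
proof (induction J)
  case (insert j J)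
  then show ?case using keys_mult_box[of "f j" n D "prod f J" "card J * D"] by simp
qed (use keys_one_box in simp)

lemma lookup_const_mult:
  "Poly_Mapping.lookup (Poly_Mapping.single 0 c * f :: 'k::field laurent) k = c * Poly_Mapping.lookup f k"
proof -
  have "Poly_Mapping.single 0 c * f = Poly_Mapping.map ((*) c) f"
    by (rule mult_map_scale_conv_mult[symmetric])
  then show ?thesis by (simp add: Poly_Mapping.map.rep_eq when_def)
qed

text \<open>The monomials of degree at most \<open>T\<close> in each of \<open>n + 1\<close> Laurent polynomials in
  \<open>n\<close> variables number \<open>(T + 1)\<^sup>n\<^sup>+\<^sup>1\<close>, but span a space of dimension \<open>O(T\<^sup>n)\<close>.\<close>

lemma laurent_algebraic_dependence:
  fixes X :: "nat \<Rightarrow> 'k::field laurent"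
  assumes X: "\<And>i. i \<le> n \<Longrightarrow> Poly_Mapping.keys (X i) \<subseteq> exponent_box n D"
  shows "\<exists>I c. finite I \<and> I \<noteq> {} \<and> I \<subseteq> extensional {..<Suc n} \<and> (\<forall>a\<in>I. c a \<noteq> 0) \<and>
     (\<Sum>a\<in>I. Poly_Mapping.single 0 (c a) * (\<Prod>j<Suc n. X j ^ a j)) = 0"
proof -
  \<comment> \<open>The constants make the count close: all the products lie in a box of at most ((T
    + 1) * L)^n exponents, and T = L^n turns this into (T + 1)^n * T, just below the number (T +
    1)^(n + 1) of products.\<close>
  define L where "L = 2 * (Suc n * D) + 1"
  define T where "T = L ^ n"
  let ?A = "{..<Suc n} \<rightarrow>\<^sub>E {..T}" and ?m = "\<lambda>a. \<Prod>j<Suc n. X j ^ a j"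
  let ?J = "exponent_box n (Suc n * (T * D))"
  have box: "Poly_Mapping.keys (?m a) \<subseteq> ?J" if "a \<in> ?A" for a
  proof -
    have "Poly_Mapping.keys (X j ^ a j) \<subseteq> exponent_box n (T * D)" if "j \<in> {..<Suc n}" for j
    proof -
      have "a j \<le> T" using that \<open>a \<in> ?A\<close> by (auto simp: PiE_iff)
      then have "exponent_box n (a j * D) \<subseteq> exponent_box n (T * D)"
        by (intro exponent_box_mono mult_right_mono) auto
      then show ?thesis using keys_power_box[OF X[of j], of "a j"] that by auto
    qed
    then show ?thesis using keys_prod_box[of "{..<Suc n}" "\<lambda>j. X j ^ a j" n "T * D"] by simp
  qed
  have "card ?J \<le> (2 * (Suc n * (T * D)) + 1) ^ n" by (rule card_exponent_box)
  also have "\<dots> \<le> ((T + 1) * L) ^ n"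
    by (intro power_mono) (auto simp: L_def algebra_simps)
  also have "\<dots> = (T + 1) ^ n * T"
    unfolding power_mult_distrib by (simp only: T_def)
  also have "\<dots> < (T + 1) ^ Suc n" by simp
  also have "\<dots> = card ?A" by (simp add: card_PiE)
  finally have less: "card ?J < card ?A" .
  have finA: "finite ?A" by (intro finite_PiE) auto
  obtain c where c: "\<exists>a\<in>?A. c a \<noteq> 0"
    "\<forall>k\<in>?J. (\<Sum>a\<in>?A. c a * Poly_Mapping.lookup (?m a) k) = 0"
    using homogeneous_system_nontrivial[OF card_exponent_box(1) finA less,
      of "\<lambda>a k. Poly_Mapping.lookup (?m a) k"] by blast
  define I where "I = {a\<in>?A. c a \<noteq> 0}"
  have "(\<Sum>a\<in>I. Poly_Mapping.single 0 (c a) * ?m a) = (\<Sum>a\<in>?A. Poly_Mapping.single 0 (c a) * ?m a)"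
    unfolding I_def using finA by (intro sum.mono_neutral_left) auto
  also have "\<dots> = 0"
  proof (rule poly_mapping_eqI)
    fix k
    show "Poly_Mapping.lookup (\<Sum>a\<in>?A. Poly_Mapping.single 0 (c a) * ?m a) k = Poly_Mapping.lookup 0 k"
    proof (cases "k \<in> ?J")
      case True
      then show ?thesis using c(2) by (simp add: lookup_sum lookup_const_mult)
    next
      case False
      then have "Poly_Mapping.lookup (?m a) k = 0" if "a \<in> ?A" for a
        using box[OF that] by (meson in_keys_iff subsetD)
      then show ?thesis by (simp add: lookup_sum lookup_const_mult)
    qed
  qed
  finally have "(\<Sum>a\<in>I. Poly_Mapping.single 0 (c a) * ?m a) = 0" .
  moreover have "finite I" unfolding I_def using finA by (rule finite_subset[rotated]) auto
  moreover have "I \<noteq> {}" "I \<subseteq> extensional {..<Suc n}" "\<forall>a\<in>I. c a \<noteq> 0"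
    using c(1) by (auto simp: I_def PiE_def)
  ultimately show ?thesis by blast
qed


context exponent_monoid
begin

lemma keys_embed_box:
  assumes "f \<in> carrier (sgring n S)"
  shows "\<exists>D. Poly_Mapping.keys (embed f :: 'k::field laurent) \<subseteq> exponent_box n D"
proof -
  have fin: "finite {u. f u \<noteq> 0}" using assms by (simp add: carrier_iff)
  define D where "D = (\<Sum>u | f u \<noteq> 0. \<Sum>j<n. nat \<bar>u ! j\<bar>)"
  have "k \<in> exponent_box n D" if k: "k \<in> Poly_Mapping.keys (embed f)" for k
  proof -
    from k have "(\<Sum>u | f u \<noteq> 0 \<and> Poly_Mapping.nth u = k. f u) \<noteq> 0"
      using lookup_pushforward[OF fin] by (metis in_keys_iff)
    then obtain u where "u \<in> {u. f u \<noteq> 0 \<and> Poly_Mapping.nth u = k}"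
      by (rule sum.not_neutral_contains_not_neutral)
    then have u: "f u \<noteq> 0" "k = Poly_Mapping.nth u" by auto
    have "length u = n" using u assms length_S by (auto simp: carrier_iff)
    have "(\<Sum>j<n. nat \<bar>u ! j\<bar>) \<le> D"
      unfolding D_def using u fin by (intro member_le_sum) auto
    moreover have "nat \<bar>u ! j\<bar> \<le> (\<Sum>j<n. nat \<bar>u ! j\<bar>)" if "j < n" for j
      using that by (intro member_le_sum) auto
    ultimately have "nat \<bar>u ! j\<bar> \<le> D" if "j < n" for j
      using that order_trans by blast
    then show ?thesis
      using \<open>length u = n\<close> by (auto simp: u exponent_box_def nth_default_def nat_le_iff)
  qed
  then show ?thesis by blast
qed

text \<open>In a chain with more than n steps, elements of P (i + 1) outside P i for i \<le> n
  satisfy no polynomial relation over k, whereas any n + 1 Laurent polynomials in n variables do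
  satisfy one.\<close>

lemma prime_chain_length_le:
  fixes P :: "nat \<Rightarrow> (int list \<Rightarrow> 'k::field) set"
  assumes P: "\<And>i. i \<le> N \<Longrightarrow> primeideal (P i) (sgring n S)" and chain: "\<And>i. i < N \<Longrightarrow> P i \<subset> P (Suc i)"
  shows "N \<le> n"
proof (rule ccontr)
  assume "\<not> N \<le> n"
  then have n: "Suc n \<le> N" by simp
  let ?R = "sgring n S :: (int list \<Rightarrow> 'k) ring"
  interpret R: cring ?R by (rule cring_sgring)
  have "\<forall>i. \<exists>x. i < Suc n \<longrightarrow> x \<in> P (Suc i) - P i"
    using chain n by (meson Suc_leI le_trans less_le_trans psubset_imp_ex_mem)
  then obtain x where x: "\<And>i. i < Suc n \<Longrightarrow> x i \<in> P (Suc i) - P i" by metis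
  have Pc: "P i \<subseteq> carrier ?R" if "i \<le> N" for i
    using P[OF that] by (meson additive_subgroup.a_subset ideal.axioms(1) primeideal.axioms(1))
  have xc: "x i \<in> carrier ?R" if "i < Suc n" for i
    using x[OF that] Pc[of "Suc i"] that n by auto
  have "\<forall>i. \<exists>D. i < Suc n \<longrightarrow> Poly_Mapping.keys (embed (x i)) \<subseteq> exponent_box n D"
    using keys_embed_box xc by blast
  then obtain d where d: "\<And>i. i < Suc n \<Longrightarrow> Poly_Mapping.keys (embed (x i)) \<subseteq> exponent_box n (d i)"
    by metis
  define D where "D = (\<Sum>i<Suc n. d i)"
  have "Poly_Mapping.keys (embed (x i)) \<subseteq> exponent_box n D" if "i \<le> n" for i
  proof -
    have "d i \<le> D" unfolding D_def using that by (intro member_le_sum) auto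
    then show ?thesis using d[of i] exponent_box_mono that by (meson le_imp_less_Suc subset_trans)
  qed
  from laurent_algebraic_dependence[of n "\<lambda>i. embed (x i)", OF this]
  obtain I c where I: "finite I" "I \<noteq> {}" "I \<subseteq> extensional {..<Suc n}" "\<forall>a\<in>I. c a \<noteq> 0"
    and rel: "(\<Sum>a\<in>I. Poly_Mapping.single 0 (c a) * (\<Prod>j<Suc n. embed (x j) ^ a j)) = 0"
    by blast
  let ?c = "\<lambda>a. monomial (replicate n 0) (c a) :: int list \<Rightarrow> 'k"
  have cc: "?c a \<in> carrier ?R" for a by (simp add: zero_S)
  \<comment> \<open>A nonzero constant is a unit and lies in no prime ideal.\<close>
  have cP: "?c a \<notin> P (Suc n)" if "a \<in> I" for a
  proof
    assume *: "?c a \<in> P (Suc n)"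
    interpret P: primeideal "P (Suc n)" ?R using P n by simp
    have "monomial (replicate n 0) (1 / c a) \<otimes>\<^bsub>?R\<^esub> ?c a \<in> P (Suc n)"
      using * by (intro P.I_l_closed) (auto simp: zero_S)
    also have "monomial (replicate n 0) (1 / c a) \<otimes>\<^bsub>?R\<^esub> ?c a = \<one>\<^bsub>?R\<^esub>"
      using I(4) that by (simp add: monomial_mult zero_S vadd_zero_left sgring_simps)
    finally show False using P.one_imp_carrier P.I_notcarr by simp
  qed
  \<comment> \<open>The elimination argument is stated for subsets of a commutative ring type, so
    ring and ideals are replaced by their images in the Laurent polynomials, with the image of R as
    the subring B.\<close>
  have "(\<Sum>a\<in>I. embed (?c a) * (\<Prod>j<Suc n. embed (x j) ^ a j)) \<notin> embed ` P 0"
  proof (rule prime_chain_no_relation[where P = "\<lambda>i. embed ` P i" and B = "embed ` carrier ?R"])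
    show "0 \<in> embed ` carrier ?R"
      by (rule image_eqI[of _ _ "\<zero>\<^bsub>?R\<^esub>"]) (auto simp: sgring_simps carrier_iff)
    show "1 \<in> embed ` carrier ?R"
      by (rule image_eqI[of _ embed "\<one>\<^bsub>?R\<^esub>"]) (simp_all add: embed_one)
    show "a + b \<in> embed ` carrier ?R" if "a \<in> embed ` carrier ?R" "b \<in> embed ` carrier ?R" for a b
      using that by (auto simp flip: embed_add)
    show "a * b \<in> embed ` carrier ?R" if "a \<in> embed ` carrier ?R" "b \<in> embed ` carrier ?R" for a b
      using that by (auto simp flip: embed_mult)
    show "embed (x i) \<in> embed ` carrier ?R \<and> embed (x i) \<in> embed ` P (Suc i) \<and> embed (x i) \<notin> embed ` P i"
      if "i < Suc n" for i
      using x[OF that] xc[OF that] Pc[of i] that n embed_inject by (auto simp: image_iff subset_iff)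
    show "embed ` P i \<subseteq> embed ` P (Suc i)" if "i < Suc n" for i
      using chain[of i] that n by auto
    show "embed (?c a) \<in> embed ` carrier ?R \<and> (embed (?c a) \<in> embed ` P (Suc n) \<longrightarrow> a \<notin> I)" for a
    proof (intro conjI impI notI imageI cc)
      assume "embed (?c a) \<in> embed ` P (Suc n)" "a \<in> I"
      then obtain y where y: "y \<in> P (Suc n)" "embed (?c a) = embed y" by blast
      then have "?c a = y" using embed_inject cc Pc n by blast
      then show False using cP[OF \<open>a \<in> I\<close>] y by blast
    qed
    show "a = b" if "a \<in> I" "b \<in> I" "\<And>j. j < Suc n \<Longrightarrow> a j = b j" for a b
      using that I(3) by (intro extensionalityI[of a "{..<Suc n}" b]) auto
  next
    fix i a b assume i: "i \<le> Suc n"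
    then interpret P: primeideal "P i" ?R using P n by simp
    have Pi: "P i \<subseteq> carrier ?R" using Pc i n by simp
    {
      assume "a \<in> embed ` P i" "b \<in> embed ` P i"
      then obtain f g where fg: "f \<in> P i" "g \<in> P i" "a = embed f" "b = embed g" by blast
      have "f \<ominus>\<^bsub>?R\<^esub> g \<in> P i" using fg by (simp add: P.a_inv_closed P.a_closed a_minus_def)
      moreover have "f = (f \<ominus>\<^bsub>?R\<^esub> g) \<oplus>\<^bsub>?R\<^esub> g"
        using fg Pi by (simp add: a_minus_def R.a_assoc R.l_neg subset_iff)
      then have "embed f = embed (f \<ominus>\<^bsub>?R\<^esub> g) + embed g"
        using fg Pi by (subst embed_add[symmetric]) auto
      ultimately show "a - b \<in> embed ` P i" using fg by (intro image_eqI) auto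
    next
      assume "a \<in> embed ` carrier ?R" "b \<in> embed ` P i"
      then obtain f g where fg: "f \<in> carrier ?R" "g \<in> P i" "a = embed f" "b = embed g" by blast
      then have "a * b = embed (f \<otimes>\<^bsub>?R\<^esub> g)" using Pi by (auto simp: embed_mult)
      then show "a * b \<in> embed ` P i" using fg P.I_l_closed by blast
    next
      assume "a \<in> embed ` carrier ?R" "b \<in> embed ` carrier ?R" and ab: "a * b \<in> embed ` P i"
      then obtain f g where fg: "f \<in> carrier ?R" "g \<in> carrier ?R" "a = embed f" "b = embed g" by blast
      obtain h where h: "h \<in> P i" "a * b = embed h" using ab by blast
      have "h = f \<otimes>\<^bsub>?R\<^esub> g"
        using fg h Pi by (subst embed_inject[symmetric]) (auto simp: embed_mult)
      then show "a \<in> embed ` P i \<or> b \<in> embed ` P i" using fg h P.I_prime by blast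
    }
  qed (use I in auto)
  moreover have "embed \<zero>\<^bsub>?R\<^esub> \<in> embed ` P 0"
    using P[of 0] by (intro imageI) (simp add: additive_subgroup.zero_closed ideal.axioms(1) primeideal.axioms(1))
  ultimately show False using rel by (simp add: nth_zero sgring_simps)
qed

end

text \<open>The condition says that S generates Z^n as a group: every u is a difference of two
  elements of S. It makes the Krull dimension reach n, and it allows arbitrary exponents to be moved
  into S when a splitting is tested.\<close>

locale full_exponent_monoid = exponent_monoid +
  assumes generates: "length u = n \<Longrightarrow> \<exists>s\<in>S. vadd s u \<in> S"
begin

text \<open>The ideal of the closure of the subtorus on which the first \<open>i\<close> coordinates are \<open>1\<close>.\<close>

definition torus_prime :: "nat \<Rightarrow> (int list \<Rightarrow> 'k::field) set" where
  "torus_prime i = {f \<in> carrier (sgring n S). pushforward (\<lambda>u. Poly_Mapping.nth (drop i u)) f = 0}"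

text \<open>The kernel of a ring homomorphism into a domain, and proper because 1 is mapped to
  1.\<close>

lemma primeideal_torus_prime: "primeideal (torus_prime i :: (int list \<Rightarrow> 'k::field) set) (sgring n S)"
proof -
  let ?R = "sgring n S :: (int list \<Rightarrow> 'k) ring"
  let ?\<rho> = "\<lambda>u. Poly_Mapping.nth (drop i u) :: nat \<Rightarrow>\<^sub>0 int"
  interpret R: cring ?R by (rule cring_sgring)
  have \<rho>: "?\<rho> (vadd u v) = ?\<rho> u + ?\<rho> v" if "u \<in> S" "v \<in> S" for u v
    using that by (intro poly_mapping_eqI) (auto simp: lookup_add nth_default_def length_S)
  have mult: "pushforward ?\<rho> (f \<otimes>\<^bsub>?R\<^esub> g) = pushforward ?\<rho> f * pushforward ?\<rho> g"
    if "f \<in> carrier ?R" "g \<in> carrier ?R" for f g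
    using that \<rho> by (rule pushforward_mult)
  show ?thesis
  proof (rule primeidealI2)
    show "additive_subgroup (torus_prime i) ?R"
    proof (intro additive_subgroup.intro subgroup.intro)
      fix f :: "int list \<Rightarrow> 'k" assume f: "f \<in> torus_prime i"
      have fc: "f \<in> carrier ?R" using f by (simp add: torus_prime_def)
      have "pushforward ?\<rho> (\<ominus>\<^bsub>?R\<^esub> f) + pushforward ?\<rho> f = pushforward ?\<rho> (\<ominus>\<^bsub>?R\<^esub> f \<oplus>\<^bsub>?R\<^esub> f)"
        using fc by (simp only: pushforward_add R.a_inv_closed)
      also have "\<dots> = 0" using fc by (simp only: R.l_neg) (simp add: sgring_simps)
      finally show "inv\<^bsub>add_monoid ?R\<^esub> f \<in> torus_prime i"
        using f fc R.a_inv_closed[OF fc] by (simp add: torus_prime_def a_inv_def)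
    next
      show "f \<otimes>\<^bsub>add_monoid ?R\<^esub> g \<in> torus_prime i" if "f \<in> torus_prime i" "g \<in> torus_prime i" for f g
        using that R.a_closed[of f g] pushforward_add[of f g] by (auto simp: torus_prime_def)
      show "\<one>\<^bsub>add_monoid ?R\<^esub> \<in> torus_prime i"
        using R.zero_closed by (simp add: torus_prime_def) (simp add: sgring_simps)
    qed (auto simp: torus_prime_def)
    have one: "\<one>\<^bsub>?R\<^esub> \<notin> torus_prime i"
    proof -
      have "pushforward ?\<rho> \<one>\<^bsub>?R\<^esub> = 1" by (simp add: sgring_simps nth_zero)
      then show ?thesis by (simp add: torus_prime_def)
    qed
    then show "carrier ?R \<noteq> torus_prime i" by (metis R.one_closed)
  qed (auto simp: torus_prime_def mult cring_sgring)
qed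

text \<open>Dropping i + 1 coordinates factors through dropping i, which gives the inclusion. A
  binomial whose two exponents differ only in coordinate i separates the two ideals.\<close>

lemma torus_prime_strict:
  assumes "i < n"
  shows "torus_prime i \<subset> (torus_prime (Suc i) :: (int list \<Rightarrow> 'k::field) set)"
proof
  let ?R = "sgring n S :: (int list \<Rightarrow> 'k) ring"
  let ?\<rho> = "\<lambda>i u. Poly_Mapping.nth (drop i u) :: nat \<Rightarrow>\<^sub>0 int"
  interpret R: cring ?R by (rule cring_sgring)
  show "torus_prime i \<subseteq> (torus_prime (Suc i) :: (int list \<Rightarrow> 'k) set)"
  proof
    fix f :: "int list \<Rightarrow> 'k" assume f: "f \<in> torus_prime i"
    then have fin: "finite {u. f u \<noteq> 0}" and fc: "f \<in> carrier ?R"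
      by (auto simp: torus_prime_def carrier_iff)
    have fib: "(\<Sum>u | f u \<noteq> 0 \<and> ?\<rho> i u = k. f u) = 0" for k
      using f lookup_pushforward[OF fin, of "?\<rho> i" k] by (simp add: torus_prime_def)
    have factor: "?\<rho> (Suc i) u = ?\<rho> (Suc i) v" if "?\<rho> i u = ?\<rho> i v" for u v
    proof (rule poly_mapping_eqI)
      fix j
      have "Poly_Mapping.lookup (?\<rho> (Suc i) w) j = Poly_Mapping.lookup (?\<rho> i w) (Suc j)" for w
        by (auto simp: nth_default_def)
      then show "Poly_Mapping.lookup (?\<rho> (Suc i) u) j = Poly_Mapping.lookup (?\<rho> (Suc i) v) j"
        using that by metis
    qed
    have "pushforward (?\<rho> (Suc i)) f = 0"
    proof (rule poly_mapping_eqI)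
      fix k
      let ?A = "{u. f u \<noteq> 0 \<and> ?\<rho> (Suc i) u = k}"
      have finA: "finite ?A" by (rule finite_subset[OF _ fin]) auto
      \<comment> \<open>A fibre of the coarser map is a union of fibres of the finer one, and over
        each of these the coefficients already sum to zero.\<close>
      have "(\<Sum>u\<in>?A. f u) = (\<Sum>l\<in>?\<rho> i ` ?A. \<Sum>u\<in>{u\<in>?A. ?\<rho> i u = l}. f u)"
        using finA by (intro sum.group[symmetric]) auto
      also have "\<dots> = (\<Sum>l\<in>?\<rho> i ` ?A. 0)"
      proof (rule sum.cong)
        fix l assume "l \<in> ?\<rho> i ` ?A"
        then have "{u\<in>?A. ?\<rho> i u = l} = {u. f u \<noteq> 0 \<and> ?\<rho> i u = l}"
          using factor by blast
        then show "(\<Sum>u\<in>{u\<in>?A. ?\<rho> i u = l}. f u) = 0" using fib by simp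
      qed simp
      finally show "Poly_Mapping.lookup (pushforward (?\<rho> (Suc i)) f) k = Poly_Mapping.lookup 0 k"
        by (simp add: lookup_pushforward fin)
    qed
    with fc show "f \<in> torus_prime (Suc i)" by (simp add: torus_prime_def)
  qed
  \<comment> \<open>The i-th unit vector need not lie in S; translating by s brings both exponents
    of the binomial \<chi>^(s+u) - \<chi>^s into S.\<close>
  define u where "u = (replicate n 0)[i := 1::int]"
  obtain s where s: "s \<in> S" "vadd s u \<in> S" using generates[of u] by (auto simp: u_def)
  define f where "f = monomial (vadd s u) 1 \<ominus>\<^bsub>?R\<^esub> monomial s 1"
  have fc: "f \<in> carrier ?R" using s by (simp add: f_def)
  have sum: "f \<oplus>\<^bsub>?R\<^esub> monomial s 1 = monomial (vadd s u) 1"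
    using s by (simp add: f_def a_minus_def R.a_assoc R.l_neg)
  have "pushforward \<rho> f + pushforward \<rho> (monomial s 1) = pushforward \<rho> (monomial (vadd s u) 1)" for \<rho>
    using s fc by (subst pushforward_add[symmetric]) (auto simp: sum)
  then have push: "pushforward \<rho> f = Poly_Mapping.single (\<rho> (vadd s u)) 1 - Poly_Mapping.single (\<rho> s) 1" for \<rho>
    by (simp add: eq_diff_eq)
  have drop: "drop (Suc i) (vadd s u) = drop (Suc i) s"
    using s by (intro nth_equalityI) (auto simp: u_def length_S)
  have "f \<in> torus_prime (Suc i)" using fc by (simp add: torus_prime_def push drop)
  moreover have "Poly_Mapping.lookup (?\<rho> i (vadd s u)) 0 \<noteq> Poly_Mapping.lookup (?\<rho> i s) 0"
    using s assms by (simp add: nth_default_def length_S u_def)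
  then have "?\<rho> i (vadd s u) \<noteq> ?\<rho> i s" by metis
  then have "Poly_Mapping.lookup (pushforward (?\<rho> i) f) (?\<rho> i s) \<noteq> 0"
    by (simp add: push lookup_minus lookup_single)
  then have "f \<notin> torus_prime i" by (auto simp: torus_prime_def)
  ultimately show "torus_prime i \<noteq> (torus_prime (Suc i) :: (int list \<Rightarrow> 'k) set)" by blast
qed

theorem krull_dim_sgring: "krull_dim (sgring n S :: (int list \<Rightarrow> 'k::field) ring) = n"
  unfolding krull_dim_def
proof (rule cSup_eq_maximum)
  show "n \<in> {m. \<exists>P. (\<forall>i\<le>m. primeideal (P i) (sgring n S :: (int list \<Rightarrow> 'k) ring)) \<and> (\<forall>i<m. P i \<subset> P (Suc i))}"
    using primeideal_torus_prime torus_prime_strict by blast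
  show "m \<le> n"
    if "m \<in> {m. \<exists>P. (\<forall>i\<le>m. primeideal (P i) (sgring n S :: (int list \<Rightarrow> 'k) ring)) \<and> (\<forall>i<m. P i \<subset> P (Suc i))}" for m
  proof -
    from that obtain P where "\<forall>i\<le>m. primeideal (P i) (sgring n S :: (int list \<Rightarrow> 'k) ring)" "\<forall>i<m. P i \<subset> P (Suc i)"
      by blast
    then show ?thesis by (intro prime_chain_length_le[of m P]) auto
  qed
qed

end

section \<open>Free rank\<close>

lemma vadd_commute: "vadd u v = vadd v u"
  by (rule nth_equalityI) auto

definition vsub :: "int list \<Rightarrow> int list \<Rightarrow> int list" where
  "vsub u v = map2 (-) u v"

lemma length_vsub [simp]: "length (vsub u v) = min (length u) (length v)"
  by (simp add: vsub_def)

lemma nth_vsub [simp]: "i < length u \<Longrightarrow> i < length v \<Longrightarrow> vsub u v ! i = u ! i - v ! i"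
  by (simp add: vsub_def)

definition residue :: "nat \<Rightarrow> int list \<Rightarrow> int list" where
  "residue q u = map (\<lambda>x. x mod int q) u"

lemma residue_eq_iff:
  assumes "length u = length v" "q > 0"
  shows "residue q u = residue q v \<longleftrightarrow> (\<exists>w. length w = length u \<and> vadd u (iscale q w) = v)"
proof
  assume eq: "residue q u = residue q v"
  define w where "w = map2 (\<lambda>a b. (b - a) div int q) u v"
  have "v ! i = u ! i + int q * ((v ! i - u ! i) div int q)" if "i < length u" for i
  proof -
    have "residue q u ! i = residue q v ! i" using eq by simp
    then have "int q dvd v ! i - u ! i"
      using that assms by (simp add: residue_def mod_eq_dvd_iff dvd_diff_commute)
    then show ?thesis by simp
  qed
  then have "vadd u (iscale q w) = v"
    using assms by (intro nth_equalityI) (auto simp: w_def)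
  then show "\<exists>w. length w = length u \<and> vadd u (iscale q w) = v"
    using assms by (intro exI[of _ w]) (simp add: w_def)
next
  assume "\<exists>w. length w = length u \<and> vadd u (iscale q w) = v"
  then show "residue q u = residue q v"
    by (auto simp: residue_def intro!: nth_equalityI)
qed

text \<open>For injectivity, the freshman's dream applied to x = y + (x - y) turns x^q = y^q into (x
  - y)^q = 0; surjectivity follows by iterating the case q = p.\<close>

lemma frobenius_bij:
  assumes p: "prime CHAR('k::field)" and surj: "surj (\<lambda>x::'k. x ^ CHAR('k))"
  shows "bij (\<lambda>x::'k. x ^ (CHAR('k) ^ e))"
proof -
  let ?F = "\<lambda>e x::'k. x ^ (CHAR('k) ^ e)"
  have "inj (?F e)"
  proof (rule injI)
    fix x y :: 'k assume eq: "?F e x = ?F e y"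
    have "?F e (y + (x - y)) = ?F e y + ?F e (x - y)"
      by (rule freshmans_dream'[OF p refl])
    then have "?F e (x - y) = 0" using eq by simp
    then show "x = y" by simp
  qed
  moreover have "surj (?F e)"
  proof (induction e)
    case (Suc e)
    have "?F (Suc e) = (\<lambda>x. x ^ CHAR('k)) \<circ> ?F e" by (rule ext) (simp add: mult.commute flip: power_mult)
    then show ?case using comp_surj[OF Suc surj] by (simp only:)
  qed simp
  ultimately show ?thesis by (simp add: bij_def)
qed

context exponent_monoid
begin

text \<open>Subtraction in Z^n determines the second exponent, so the convolution over pairs becomes
  a single sum over the exponents of the first factor. Terms with w - u outside S vanish by
  themselves.\<close>

lemma mult_coeff:
  assumes f: "finite A" "{u. f u \<noteq> 0} \<subseteq> A" "A \<subseteq> S" and g: "g \<in> carrier (sgring n S)" and w: "length w = n"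
  shows "(f \<otimes>\<^bsub>sgring n S\<^esub> g) w = (\<Sum>u\<in>A. f u * (g (vsub w u) :: 'k::field))"
proof -
  \<comment> \<open>Adding all differences w - u to the support of g gives every u in A a partner,
    so that the pairs with sum w biject with A.\<close>
  define B where "B = {v. g v \<noteq> 0} \<union> vsub w ` A"
  have B: "finite B" "{v. g v \<noteq> 0} \<subseteq> B" "\<And>v. v \<in> B \<Longrightarrow> length v = n"
    using f g w by (auto simp: B_def carrier_iff length_S subset_iff)
  have len: "u \<in> A \<Longrightarrow> length u = n" for u using f length_S by auto
  have "(f \<otimes>\<^bsub>sgring n S\<^esub> g) w = (\<Sum>(u,v)\<in>{p\<in>A \<times> B. vadd (fst p) (snd p) = w}. f u * g v)"
    by (rule mult_superset) (use f B in auto)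
  also have "\<dots> = (\<Sum>u\<in>A. f u * g (vsub w u))"
  proof (rule sum.reindex_bij_witness[of _ "\<lambda>u. (u, vsub w u)" fst])
    fix p assume p: "p \<in> {p\<in>A \<times> B. vadd (fst p) (snd p) = w}"
    have "vsub w (fst p) = snd p"
      using p B(3)[of "snd p"] len[of "fst p"] by (intro nth_equalityI) auto
    then show "(fst p, vsub w (fst p)) = p" "f (fst p) * g (vsub w (fst p)) = (case p of (u, v) \<Rightarrow> f u * g v)"
      by (auto simp: case_prod_unfold)
  next
    fix u assume u: "u \<in> A"
    have "vadd u (vsub w u) = w" using u len w by (intro nth_equalityI) auto
    then show "(u, vsub w u) \<in> {p\<in>A \<times> B. vadd (fst p) (snd p) = w}"
      using u by (auto simp: B_def)
  qed auto
  finally show ?thesis .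
qed

lemma monomial_mult_coeff:
  assumes "u \<in> S" "g \<in> carrier (sgring n S)" "length w = n"
  shows "(monomial u c \<otimes>\<^bsub>sgring n S\<^esub> g) (vadd u w) = c * (g w :: 'k::field)"
proof -
  have "vsub (vadd u w) u = w" using assms by (intro nth_equalityI) (auto simp: length_S)
  then show ?thesis
    using assms by (subst mult_coeff[of "{u}"]) (auto simp: monomial_def length_S)
qed

lemma homogeneous_monomial:
  assumes "f \<in> carrier (sgring n S)" "f \<noteq> \<zero>\<^bsub>sgring n S\<^esub>" "homog f d"
  obtains c where "c \<noteq> 0" "d \<in> S" "f = monomial d c"
proof -
  obtain u where u: "f u \<noteq> 0" using assms(2) by (auto simp: sgring_simps)
  then have "u = d" using assms(3) by (auto simp: homog_def)
  have "f = monomial d (f d)"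
  proof
    show "f w = monomial d (f d) w" for w using assms(3) by (cases "f w = 0") (auto simp: homog_def monomial_def)
  qed
  then show ?thesis using that[of "f d"] u assms(1) \<open>u = d\<close> by (auto simp: carrier_iff)
qed

definition split_degrees :: "nat \<Rightarrow> int list set" where
  "split_degrees q = {d\<in>S. \<forall>w. length w = n \<longrightarrow> vadd d (iscale q w) \<in> S \<longrightarrow> w \<in> S}"

lemma finite_residues: "q > 0 \<Longrightarrow> finite (residue q ` split_degrees q)"
  by (rule finite_subset[OF _ finite_lists_length_eq[of "{0..<int q}" n]])
     (auto simp: residue_def split_degrees_def length_S)

end

context full_exponent_monoid
begin

text \<open>Each x j is a scalar multiple of a monomial. Linearity over q-th powers determines
  \<open>\<psi> j\<close> on all monomials of the same residue class and forces their degrees into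
  dx j + qS. Two generators in one class would be related by a factor r^q, contradicting
  duality.\<close>

lemma free_rank_le:
  fixes x :: "nat \<Rightarrow> int list \<Rightarrow> 'k::field"
  assumes p: "prime CHAR('k)" and surj: "surj (\<lambda>x::'k. x ^ CHAR('k))" and q: "q = CHAR('k) ^ e"
  defines "R \<equiv> sgring n S"
  assumes x: "\<And>j. j < a \<Longrightarrow> x j \<in> carrier R \<and> x j \<noteq> \<zero>\<^bsub>R\<^esub> \<and> homog (x j) (dx j)"
    and \<psi>: "\<And>j y. j < a \<Longrightarrow> y \<in> carrier R \<Longrightarrow> \<psi> j y \<in> carrier R"
    and lin: "\<And>j r y. j < a \<Longrightarrow> r \<in> carrier R \<Longrightarrow> y \<in> carrier R \<Longrightarrow> \<psi> j ((r [^]\<^bsub>R\<^esub> q) \<otimes>\<^bsub>R\<^esub> y) = r \<otimes>\<^bsub>R\<^esub> \<psi> j y"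
    and dual: "\<And>i j. j < a \<Longrightarrow> i < a \<Longrightarrow> \<psi> j (x i) = (if i = j then \<one>\<^bsub>R\<^esub> else \<zero>\<^bsub>R\<^esub>)"
  shows "a \<le> card (residue q ` split_degrees q)"
proof -
  interpret R: cring R unfolding R_def by (rule cring_sgring)
  have q0: "q > 0" using p q by (simp add: prime_gt_0_nat)
  have "\<forall>j. \<exists>c. j < a \<longrightarrow> c \<noteq> 0 \<and> dx j \<in> S \<and> x j = monomial (dx j) c"
    using homogeneous_monomial x unfolding R_def by metis
  then obtain c where c: "\<And>j. j < a \<Longrightarrow> c j \<noteq> 0 \<and> dx j \<in> S \<and> x j = monomial (dx j) (c j)"
    by metis
  have mono: "monomial u b \<in> carrier R" if "u \<in> S" for u b using that by (simp add: R_def)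
  have mult: "monomial u b \<otimes>\<^bsub>R\<^esub> monomial v b' = monomial (vadd u v) (b * b')" if "u \<in> S" "v \<in> S" for u v b b'
    using that by (simp add: R_def monomial_mult)
  have pow: "monomial u b [^]\<^bsub>R\<^esub> q = monomial (iscale q u) (b ^ q)" if "u \<in> S" for u b
    using that by (simp add: R_def monomial_power)
  have good: "dx j \<in> split_degrees q" if j: "j < a" for j
  proof -
    have "w \<in> S" if w: "length w = n" "vadd (dx j) (iscale q w) \<in> S" for w
    proof -
      let ?y = "monomial (vadd (dx j) (iscale q w)) (c j)"
      obtain s where s: "s \<in> S" "vadd s w \<in> S" using generates w by blast
      have y: "?y \<in> carrier R" using w mono by blast
      \<comment> \<open>w itself may lie outside S; multiplying by the q-th power of \<chi>^s clears
        it and expresses the monomial through x j, whose image is 1. Comparing coefficients at s + w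
        then shows that \<open>\<psi> j\<close> of the monomial has coefficient 1 at w.\<close>
      have "vadd (iscale q s) (vadd (dx j) (iscale q w)) = vadd (iscale q (vadd s w)) (dx j)"
        using s w c[OF j] by (intro nth_equalityI) (auto simp: length_S algebra_simps)
      then have "(monomial s 1 [^]\<^bsub>R\<^esub> q) \<otimes>\<^bsub>R\<^esub> ?y = (monomial (vadd s w) 1 [^]\<^bsub>R\<^esub> q) \<otimes>\<^bsub>R\<^esub> x j"
        using s w conjunct1[OF conjunct2[OF c[OF j]]] conjunct2[OF conjunct2[OF c[OF j]]]
        by (simp add: pow mult iscale_S)
      then have "monomial s 1 \<otimes>\<^bsub>R\<^esub> \<psi> j ?y = monomial (vadd s w) 1 \<otimes>\<^bsub>R\<^esub> \<psi> j (x j)"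
        using lin[OF j, of "monomial s 1" ?y] lin[OF j, of "monomial (vadd s w) 1" "x j"] s y x[OF j] mono
        by metis
      also have "\<dots> = monomial (vadd s w) 1" using dual[OF j j] s mono by simp
      finally have "(monomial s 1 \<otimes>\<^bsub>R\<^esub> \<psi> j ?y) (vadd s w) = 1" by (simp add: monomial_def)
      moreover have "(monomial s 1 \<otimes>\<^bsub>R\<^esub> \<psi> j ?y) (vadd s w) = \<psi> j ?y w"
        using monomial_mult_coeff[of s "\<psi> j ?y" w 1] s w \<psi>[OF j y] by (simp add: R_def)
      ultimately show "w \<in> S" using \<psi>[OF j y] by (auto simp: R_def carrier_iff)
    qed
    then show ?thesis using c[OF j] by (simp add: split_degrees_def)
  qed
  have inj: "inj_on (\<lambda>j. residue q (dx j)) {..<a}"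
  proof (rule inj_onI, rule ccontr)
    fix i j assume ij: "i \<in> {..<a}" "j \<in> {..<a}" "i \<noteq> j" and eq: "residue q (dx i) = residue q (dx j)"
    then have i: "i < a" and j: "j < a" by auto
    have len: "length (dx i) = n" "length (dx j) = n" using c i j length_S by auto
    obtain w where w: "length w = n" "vadd (dx i) (iscale q w) = dx j"
      using eq len q0 residue_eq_iff[of "dx i" "dx j" q] by auto
    then have "w \<in> S" using good[OF i] c[OF j] by (auto simp: split_degrees_def)
    \<comment> \<open>Perfectness: x j differs from r^q x i, with r a monomial, only by a scalar,
      which is absorbed into r by taking a q-th root.\<close>
    have "surj (\<lambda>x::'k. x ^ q)" using frobenius_bij[OF p surj] q by (simp add: bij_def)
    then obtain \<nu> where \<nu>: "\<nu> ^ q = c j / c i" by (metis surjD)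
    have "vadd (iscale q w) (dx i) = dx j"
      using w(2) by (simp only: vadd_commute)
    then have "(monomial w \<nu> [^]\<^bsub>R\<^esub> q) \<otimes>\<^bsub>R\<^esub> x i = x j"
      using \<open>w \<in> S\<close> c[OF i] c[OF j] by (simp add: pow mult iscale_S \<nu>)
    moreover have "\<psi> j ((monomial w \<nu> [^]\<^bsub>R\<^esub> q) \<otimes>\<^bsub>R\<^esub> x i) = monomial w \<nu> \<otimes>\<^bsub>R\<^esub> \<psi> j (x i)"
      using x[OF i] by (intro lin j mono \<open>w \<in> S\<close>) auto
    ultimately have "\<psi> j (x j) = monomial w \<nu> \<otimes>\<^bsub>R\<^esub> \<psi> j (x i)" by (simp only:)
    then have "\<one>\<^bsub>R\<^esub> = \<zero>\<^bsub>R\<^esub>"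
      using dual[OF j j] dual[OF j i] ij(3) mono[OF \<open>w \<in> S\<close>] by simp
    then have "monomial (replicate n 0) (1::'k) (replicate n 0) = 0"
      by (simp add: R_def sgring_simps)
    then show False by (simp add: monomial_def)
  qed
  have "card ((\<lambda>j. residue q (dx j)) ` {..<a}) \<le> card (residue q ` split_degrees q)"
    using good by (intro card_mono finite_residues q0) auto
  then show ?thesis using card_image[OF inj] by simp
qed

text \<open>For the lower bound one degree \<open>d j\<close> is chosen in each class, and
  \<open>\<psi> j\<close> restricts y to the degrees in d j + qM, divides by \<chi>^(d j) and takes
  q-th roots. The upper bound is \<open>free_rank_le\<close>, so the supremum is a maximum.\<close>

theorem free_rank_sgring:
  assumes p: "prime CHAR('k::field)" and surj: "surj (\<lambda>x::'k. x ^ CHAR('k))" and q: "q = CHAR('k) ^ e"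
  shows "free_rank (sgring n S :: (int list \<Rightarrow> 'k) ring) q = card (residue q ` split_degrees q)"
proof -
  define R where "R = (sgring n S :: (int list \<Rightarrow> 'k) ring)"
  interpret R: cring R unfolding R_def by (rule cring_sgring)
  have q0: "q > 0" using p q by (simp add: prime_gt_0_nat)
  define K where "K = card (residue q ` split_degrees q)"
  obtain h where h: "bij_betw h {0..<K} (residue q ` split_degrees q)"
    using ex_bij_betw_nat_finite[OF finite_residues[OF q0]] unfolding K_def by blast
  have "\<forall>j. \<exists>d. j < K \<longrightarrow> d \<in> split_degrees q \<and> residue q d = h j"
  proof (intro allI)
    fix j
    have "h j \<in> residue q ` split_degrees q" if "j < K"
      using bij_betwE[OF h] that by simp
    then show "\<exists>d. j < K \<longrightarrow> d \<in> split_degrees q \<and> residue q d = h j" by fastforce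
  qed
  then obtain d where d: "\<And>j. j < K \<Longrightarrow> d j \<in> split_degrees q \<and> residue q (d j) = h j"
    by metis
  have dS: "j < K \<Longrightarrow> d j \<in> S" for j using d[of j] by (simp add: split_degrees_def)
  have d_len: "j < K \<Longrightarrow> length (d j) = n" for j using dS length_S by auto
  have d_inj: "i = j" if "i < K" "j < K" "length w = n" "vadd (d j) (iscale q w) = d i" for i j w
  proof -
    have "residue q (d j) = residue q (d i)"
      using residue_eq_iff[of "d j" "d i" q] that(3,4) d_len[OF that(1)] d_len[OF that(2)] q0 by auto
    then have "h i = h j" using d that by simp
    then show ?thesis using bij_betw_imp_inj_on[OF h] that(1,2) by (simp add: inj_on_eq_iff)
  qed
  \<comment> \<open>The inverse of the q-th power map; additivity and the rule for q-th power
    factors are inherited from the Frobenius, a bijective ring homomorphism.\<close>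
  define rt where "rt = inv_into UNIV (\<lambda>x::'k. x ^ q)"
  have bij: "bij (\<lambda>x::'k. x ^ q)" unfolding q by (rule frobenius_bij[OF p surj])
  have rt: "rt (x ^ q) = x" for x using inv_f_f[OF bij_is_inj[OF bij], of x] by (simp add: rt_def)
  have rt': "rt x ^ q = x" for x using surj_f_inv_f[OF bij_is_surj[OF bij], of x] by (simp add: rt_def)
  have rt_add: "rt (x + y) = rt x + rt y" for x y
    using freshmans_dream'[OF p q, of "rt x" "rt y"] rt rt' by metis
  have rt_mult: "rt (x ^ q * y) = x * rt y" for x y
    by (metis rt rt' power_mult_distrib)
  have rt0: "rt 0 = 0" using rt[of 0] q0 by (simp add: zero_power)
  have rt1: "rt 1 = 1" using rt[of 1] by simp
  have rt_sum: "rt (sum f A) = (\<Sum>a\<in>A. rt (f a))" for f and A :: "int list set"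
    by (induction A rule: infinite_finite_induct) (auto simp: rt0 rt_add)
  \<comment> \<open>The guard on the length matters: \<open>vadd\<close> truncates to the shorter
    list, so an overlong w would otherwise pick up coefficients of y.\<close>
  define \<psi> where "\<psi> j y w = (if length w = n then rt (y (vadd (d j) (iscale q w))) else 0)"
    for j and y :: "int list \<Rightarrow> 'k" and w
  define x where "x j = monomial (d j) (1::'k)" for j
  have \<psi>_closed: "\<psi> j y \<in> carrier R" if "j < K" "y \<in> carrier R" for j y
  proof -
    let ?t = "\<lambda>w. vadd (d j) (iscale q w)"
    have sub: "{w. \<psi> j y w \<noteq> 0} \<subseteq> {w. length w = n \<and> y (?t w) \<noteq> 0}"
      by (auto simp: \<psi>_def rt0)
    have "inj_on ?t {w. length w = n \<and> y (?t w) \<noteq> 0}"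
    proof (intro inj_onI nth_equalityI)
      fix v w i assume *: "v \<in> {w. length w = n \<and> y (?t w) \<noteq> 0}" "w \<in> {w. length w = n \<and> y (?t w) \<noteq> 0}"
        "?t v = ?t w" "i < length v"
      have "?t v ! i = ?t w ! i" using *(3) by (rule arg_cong)
      moreover have "length v = n" "length w = n" "i < n" using * by auto
      ultimately show "v ! i = w ! i" using d_len[OF that(1)] q0 by simp
    qed auto
    moreover have "?t ` {w. length w = n \<and> y (?t w) \<noteq> 0} \<subseteq> {u. y u \<noteq> 0}" by auto
    moreover have "finite {u. y u \<noteq> 0}" using that by (simp add: R_def carrier_iff)
    ultimately have "finite {w. length w = n \<and> y (?t w) \<noteq> 0}"
      by (meson finite_imageD finite_subset)
    \<comment> \<open>This is the point of \<open>split_degrees\<close>: without it the image of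
      \<open>\<psi> j\<close> would only lie in k[M].\<close>
    moreover have "w \<in> S" if "\<psi> j y w \<noteq> 0" for w
    proof -
      have w: "length w = n" "y (?t w) \<noteq> 0" using sub that by auto
      then have "?t w \<in> S" using \<open>y \<in> carrier R\<close> by (simp add: R_def carrier_iff)
      then show ?thesis using d[OF \<open>j < K\<close>] w by (auto simp: split_degrees_def)
    qed
    ultimately show ?thesis using sub finite_subset by (auto simp: R_def carrier_iff)
  qed
  have \<psi>_add: "\<psi> j (y \<oplus>\<^bsub>R\<^esub> z) = \<psi> j y \<oplus>\<^bsub>R\<^esub> \<psi> j z" for j y z
    by (auto simp: \<psi>_def R_def sgring_simps rt_add)
  have \<psi>_lin: "\<psi> j ((r [^]\<^bsub>R\<^esub> q) \<otimes>\<^bsub>R\<^esub> y) = r \<otimes>\<^bsub>R\<^esub> \<psi> j y"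
    if j: "j < K" and r: "r \<in> carrier R" and y: "y \<in> carrier R" for j r y
  proof
    fix w
    show "\<psi> j ((r [^]\<^bsub>R\<^esub> q) \<otimes>\<^bsub>R\<^esub> y) w = (r \<otimes>\<^bsub>R\<^esub> \<psi> j y) w"
    proof (cases "length w = n")
      case False
      have "r \<otimes>\<^bsub>R\<^esub> \<psi> j y \<in> carrier R" using r \<psi>_closed[OF j y] by simp
      then have "(r \<otimes>\<^bsub>R\<^esub> \<psi> j y) w = 0" using False length_S by (auto simp: R_def carrier_iff)
      then show ?thesis using False by (simp add: \<psi>_def)
    next
      case w: True
      let ?A = "{s. r s \<noteq> 0}"
      let ?t = "\<lambda>w. vadd (d j) (iscale q w)"
      have A: "finite ?A" "?A \<subseteq> S" using r by (auto simp: R_def carrier_iff)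
      have len: "s \<in> ?A \<Longrightarrow> length s = n" for s using A length_S by auto
      have inj: "iscale q s = iscale q t \<longleftrightarrow> s = t" for s t
        using q0 by (auto simp: iscale_def inj_map_eq_map inj_on_def)
      have frob: "(r [^]\<^bsub>R\<^esub> q) u = (\<Sum>s | r s \<noteq> 0 \<and> iscale q s = u. r s ^ q)" for u
        using frobenius_power[OF _ p q, of r] r by (simp add: R_def)
      have frob': "(r [^]\<^bsub>R\<^esub> q) (iscale q s) = r s ^ q" if "s \<in> ?A" for s
      proof -
        have "{t. r t \<noteq> 0 \<and> iscale q t = iscale q s} = {s}" using that by (auto simp: inj)
        then show ?thesis by (simp add: frob)
      qed
      have supp: "{u. (r [^]\<^bsub>R\<^esub> q) u \<noteq> 0} \<subseteq> iscale q ` ?A"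
      proof
        fix u assume "u \<in> {u. (r [^]\<^bsub>R\<^esub> q) u \<noteq> 0}"
        then have "(\<Sum>s | r s \<noteq> 0 \<and> iscale q s = u. r s ^ q) \<noteq> 0" by (simp add: frob)
        then obtain s where "s \<in> {s. r s \<noteq> 0 \<and> iscale q s = u}"
          by (rule sum.not_neutral_contains_not_neutral)
        then show "u \<in> iscale q ` ?A" by auto
      qed
      have tw: "length (?t w) = n" using w d_len[OF j] by simp
      have t_sub: "vsub (?t w) (iscale q s) = ?t (vsub w s)" if "s \<in> ?A" for s
        using w d_len[OF j] len[OF that] by (intro nth_equalityI) (auto simp: algebra_simps)
      \<comment> \<open>All exponents of r^q are multiples q s, so the coefficient of r^q y at d j +
        q w involves y only at d j + q (w - s), that is, within the same residue class.\<close>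
      have "((r [^]\<^bsub>R\<^esub> q) \<otimes>\<^bsub>R\<^esub> y) (?t w)
          = (\<Sum>u\<in>iscale q ` ?A. (r [^]\<^bsub>R\<^esub> q) u * y (vsub (?t w) u))"
        unfolding R_def using A supp y tw
        by (intro mult_coeff) (auto simp: R_def intro!: iscale_S)
      also have "\<dots> = (\<Sum>s\<in>?A. r s ^ q * y (?t (vsub w s)))"
        by (subst sum.reindex) (auto simp: inj_on_def inj frob' t_sub)
      finally have "\<psi> j ((r [^]\<^bsub>R\<^esub> q) \<otimes>\<^bsub>R\<^esub> y) w = (\<Sum>s\<in>?A. r s * rt (y (?t (vsub w s))))"
        using w by (simp add: \<psi>_def rt_sum rt_mult)
      also have "\<dots> = (\<Sum>s\<in>?A. r s * \<psi> j y (vsub w s))"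
        using w len by (intro sum.cong) (auto simp: \<psi>_def)
      also have "\<dots> = (r \<otimes>\<^bsub>R\<^esub> \<psi> j y) w"
        unfolding R_def using A w \<psi>_closed[OF j y] by (intro mult_coeff[symmetric]) (auto simp: R_def)
      finally show ?thesis .
    qed
  qed
  have \<psi>_dual: "\<psi> j (x i) = (if i = j then \<one>\<^bsub>R\<^esub> else \<zero>\<^bsub>R\<^esub>)" if i: "i < K" and j: "j < K" for i j
  proof
    fix w
    show "\<psi> j (x i) w = (if i = j then \<one>\<^bsub>R\<^esub> else \<zero>\<^bsub>R\<^esub>) w"
    proof (cases "length w = n")
      case w: True
      have "w = replicate n 0" if "vadd (d j) (iscale q w) = d j"
      proof (rule nth_equalityI)
        fix k assume "k < length w"
        then show "w ! k = replicate n 0 ! k"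
          using arg_cong[OF that, of "\<lambda>u. u ! k"] w d_len[OF j] q0 by simp
      qed (use w in simp)
      moreover have "vadd (d j) (iscale q (replicate n 0)) = d j"
        using d_len[OF j] by (intro nth_equalityI) auto
      ultimately have zero_iff: "vadd (d j) (iscale q w) = d j \<longleftrightarrow> w = replicate n 0" by blast
      have eq: "\<psi> j (x i) w = (if vadd (d j) (iscale q w) = d i then 1 else 0)"
        using w by (simp add: \<psi>_def x_def monomial_def rt0 rt1)
      show ?thesis
      proof (cases "i = j")
        case True
        then show ?thesis
          unfolding eq by (simp add: zero_iff R_def sgring_simps monomial_def)
      next
        case False
        then have "vadd (d j) (iscale q w) \<noteq> d i" using d_inj[OF i j w] by blast
        with False show ?thesis unfolding eq by (simp add: R_def sgring_simps)
      qed
    qed (auto simp: \<psi>_def R_def sgring_simps monomial_def)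
  qed
  show ?thesis
    unfolding free_rank_def K_def[symmetric]
  proof (rule cSup_eq_maximum, goal_cases)
    case 1
    have "homog (x j) (d j)" for j by (auto simp: x_def homog_def monomial_def)
    moreover have "x j \<in> carrier R" if "j < K" for j using dS[OF that] by (simp add: x_def R_def)
    moreover have "x j \<noteq> \<zero>\<^bsub>R\<^esub>" for j
      by (auto simp: x_def R_def sgring_simps monomial_def fun_eq_iff)
    moreover have "vadd (iscale q w) (d j) = u"
      if "j < K" "y \<in> carrier R" "homog y u" "\<psi> j y w \<noteq> 0" for j y u w
    proof -
      have w: "length w = n" and "rt (y (vadd (d j) (iscale q w))) \<noteq> 0"
        using that(4) by (auto simp: \<psi>_def split: if_splits)
      then have "y (vadd (d j) (iscale q w)) \<noteq> 0" using rt0 by metis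
      then have "vadd (d j) (iscale q w) = u" using that(3) by (simp add: homog_def)
      then show ?thesis by (simp only: vadd_commute)
    qed
    ultimately show ?case
      unfolding R_def[symmetric] mem_Collect_eq
      by (intro exI[of _ x] exI[of _ \<psi>] exI[of _ d] allI impI conjI)
         (use \<psi>_closed \<psi>_add \<psi>_lin \<psi>_dual in auto)
  next
    case (2 a)
    then obtain x :: "nat \<Rightarrow> int list \<Rightarrow> 'k" and \<psi> dx where *: "\<forall>j<a.
      x j \<in> carrier R \<and> x j \<noteq> \<zero>\<^bsub>R\<^esub> \<and> homog (x j) (dx j) \<and>
      \<psi> j \<in> carrier R \<rightarrow> carrier R \<and>
      (\<forall>y\<in>carrier R. \<forall>z\<in>carrier R. \<psi> j (y \<oplus>\<^bsub>R\<^esub> z) = \<psi> j y \<oplus>\<^bsub>R\<^esub> \<psi> j z) \<and>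
      (\<forall>r\<in>carrier R. \<forall>y\<in>carrier R. \<psi> j ((r [^]\<^bsub>R\<^esub> q) \<otimes>\<^bsub>R\<^esub> y) = r \<otimes>\<^bsub>R\<^esub> \<psi> j y) \<and>
      (\<forall>y\<in>carrier R. \<forall>d. homog y d \<longrightarrow>
          (\<forall>w. \<psi> j y w \<noteq> 0 \<longrightarrow> vadd (iscale q w) (dx j) = d)) \<and>
      (\<forall>i<a. \<psi> j (x i) = (if i = j then \<one>\<^bsub>R\<^esub> else \<zero>\<^bsub>R\<^esub>))"
      unfolding R_def[symmetric] by blast
    show ?case
      by (rule free_rank_le[OF p surj q, of a x dx \<psi>, folded R_def K_def])
         (use * in \<open>auto simp: Pi_iff\<close>)
  qed
qed

end

section \<open>Lattice points and volume\<close>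

definition idot :: "nat \<Rightarrow> int list \<Rightarrow> int list \<Rightarrow> int" where
  "idot m u v = (\<Sum>j<m. u ! j * v ! j)"

text \<open>Fubini in a coordinate k with nonzero coefficient: every line in that direction meets
  the hyperplane in at most one point, \<open>y0\<close> below.\<close>

lemma hyperplane_null_set:
  fixes c :: "nat \<Rightarrow> real"
  assumes k: "k < m" "c k \<noteq> 0"
  shows "{w \<in> space (Pi\<^sub>M {..<m} (\<lambda>_. lborel)). (\<Sum>j<m. w j * c j) = t} \<in> null_sets (Pi\<^sub>M {..<m} (\<lambda>_. lborel))"
proof -
  interpret product_sigma_finite "\<lambda>_::nat. lborel :: real measure" by standard
  let ?I = "{..<m} - {k}" and ?M = "\<lambda>I. Pi\<^sub>M I (\<lambda>_::nat. lborel :: real measure)"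
  let ?A = "{w \<in> space (?M {..<m}). (\<Sum>j<m. w j * c j) = t}"
  have ins: "insert k ?I = {..<m}" using k by auto
  have A[measurable]: "?A \<in> sets (?M {..<m})" by measurable
  have "emeasure (?M {..<m}) ?A = (\<integral>\<^sup>+ w. indicator ?A w \<partial>?M (insert k ?I))"
    unfolding ins by (rule nn_integral_indicator[OF A, symmetric])
  also have "\<dots> = (\<integral>\<^sup>+ x. (\<integral>\<^sup>+ y. indicator ?A (x(k := y)) \<partial>lborel) \<partial>?M ?I)"
  proof (rule product_nn_integral_insert)
    show "(indicator ?A :: _ \<Rightarrow> ennreal) \<in> borel_measurable (?M (insert k ?I))"
      unfolding ins by measurable
  qed auto
  also have "\<dots> = (\<integral>\<^sup>+ x. 0 \<partial>?M ?I)"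
  proof (rule nn_integral_cong)
    fix x :: "nat \<Rightarrow> real"
    define y0 where "y0 = (t - (\<Sum>j\<in>?I. x j * c j)) / c k"
    have "(\<integral>\<^sup>+ y. indicator ?A (x(k := y)) \<partial>lborel) \<le> (\<integral>\<^sup>+ y. indicator {y0} y \<partial>lborel)"
    proof (rule nn_integral_mono)
      fix y :: real
      have "(\<Sum>j<m. (x(k := y)) j * c j) = y * c k + (\<Sum>j\<in>?I. (x(k := y)) j * c j)"
        using k by (simp add: sum.remove)
      also have "(\<Sum>j\<in>?I. (x(k := y)) j * c j) = (\<Sum>j\<in>?I. x j * c j)"
        by (intro sum.cong) auto
      finally have "y = y0" if "x(k := y) \<in> ?A"
        using that k by (auto simp: y0_def field_simps)
      then show "indicator ?A (x(k := y)) \<le> (indicator {y0} y :: ennreal)"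
        by (auto simp: indicator_def)
    qed
    then show "(\<integral>\<^sup>+ y. indicator ?A (x(k := y)) \<partial>lborel) = 0" by simp
  qed
  finally show ?thesis by (intro null_setsI A) simp
qed

text \<open>Rounding to the lattice scaled by 1/(q + 1); the successor keeps the denominator
  positive. It serves the volume computation and the rational approximation of supporting
  functionals.\<close>

lemma floor_scaled_tendsto:
  fixes x :: real
  shows "(\<lambda>q. real_of_int \<lfloor>real (Suc q) * x\<rfloor> / real (Suc q)) \<longlonglongrightarrow> x"
proof (rule tendsto_sandwich)
  show "(\<lambda>q. x - inverse (real (Suc q))) \<longlonglongrightarrow> x"
    using tendsto_diff[OF tendsto_const LIMSEQ_inverse_real_of_nat] by simp
  have "x - inverse (real (Suc q)) \<le> real_of_int \<lfloor>real (Suc q) * x\<rfloor> / real (Suc q)" for q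
  proof -
    have "real (Suc q) * x - 1 \<le> real_of_int \<lfloor>real (Suc q) * x\<rfloor>" by linarith
    then have "(x - inverse (real (Suc q))) * real (Suc q) \<le> real_of_int \<lfloor>real (Suc q) * x\<rfloor>"
      by (simp add: left_diff_distrib mult.commute[of x] del: of_nat_Suc)
    then show ?thesis by (subst pos_le_divide_eq) (simp_all del: of_nat_Suc)
  qed
  then show "\<forall>\<^sub>F q in sequentially. x - inverse (real (Suc q)) \<le> real_of_int \<lfloor>real (Suc q) * x\<rfloor> / real (Suc q)"
    by simp
  have "real_of_int \<lfloor>real (Suc q) * x\<rfloor> / real (Suc q) \<le> x" for q
  proof -
    have "real_of_int \<lfloor>real (Suc q) * x\<rfloor> \<le> real (Suc q) * x" by linarith
    then show ?thesis by (subst pos_divide_le_eq) (simp_all add: mult.commute del: of_nat_Suc)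
  qed
  then show "\<forall>\<^sub>F q in sequentially. real_of_int \<lfloor>real (Suc q) * x\<rfloor> / real (Suc q) \<le> x"
    by simp
qed simp

definition polytope_points :: "nat \<Rightarrow> int list list \<Rightarrow> nat \<Rightarrow> int list set" where
  "polytope_points m cs q = {e. length e = m \<and> (\<forall>c\<in>set cs. 0 \<le> idot m e c \<and> idot m e c < int q)}"

definition spanning :: "nat \<Rightarrow> int list list \<Rightarrow> bool" where
  "spanning m cs \<longleftrightarrow> (\<forall>j<m. \<exists>t. \<forall>k<m. (\<Sum>i<length cs. t i * real_of_int (cs ! i ! k)) = (if k = j then 1 else 0))"

text \<open>A unit vector written as a combination of \<open>cs\<close> expresses the matching
  coordinate of w through the pairings of w with \<open>cs\<close>, and K dominates the
  coefficients. D = 1 bounds the polytope, D = q its dilation, and D = 0 shows that only 0 is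
  orthogonal to all of \<open>cs\<close>.\<close>

lemma spanning_bounded:
  assumes "spanning m cs"
  shows "\<exists>K\<ge>0. \<forall>w D. D \<ge> 0 \<longrightarrow> (\<forall>c\<in>set cs. \<bar>\<Sum>k<m. w k * real_of_int (c ! k)\<bar> \<le> D) \<longrightarrow> (\<forall>j<m. \<bar>w j\<bar> \<le> K * D)"
proof -
  obtain t where t: "\<And>j k. j < m \<Longrightarrow> k < m \<Longrightarrow>
      (\<Sum>i<length cs. t j i * real_of_int (cs ! i ! k)) = (if k = j then 1 else (0::real))"
    using assms unfolding spanning_def by metis
  define K where "K = (\<Sum>j<m. \<Sum>i<length cs. \<bar>t j i\<bar>)"
  show ?thesis
  proof (intro exI[of _ K] conjI allI impI)
    show "K \<ge> 0" by (auto simp: K_def intro!: sum_nonneg)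
    fix w :: "nat \<Rightarrow> real" and j and D :: real
    assume j: "j < m" and D: "D \<ge> 0" and bound: "\<forall>c\<in>set cs. \<bar>\<Sum>k<m. w k * real_of_int (c ! k)\<bar> \<le> D"
    have "w j = (\<Sum>k<m. if k = j then w k else 0)" using j by simp
    also have "\<dots> = (\<Sum>k<m. w k * (\<Sum>i<length cs. t j i * real_of_int (cs ! i ! k)))"
      using t[OF j] by (intro sum.cong) auto
    also have "\<dots> = (\<Sum>i<length cs. t j i * (\<Sum>k<m. w k * real_of_int (cs ! i ! k)))"
      unfolding sum_distrib_left by (subst sum.swap) (simp add: mult_ac)
    also have "\<bar>\<dots>\<bar> \<le> (\<Sum>i<length cs. \<bar>t j i\<bar> * D)"
      by (intro order_trans[OF sum_abs] sum_mono) (auto simp: abs_mult intro!: mult_left_mono bound[rule_format])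
    also have "\<dots> \<le> K * D"
      unfolding K_def sum_distrib_right[symmetric] using D j
      by (intro mult_right_mono member_le_sum) (auto intro: sum_nonneg)
    finally show "\<bar>w j\<bar> \<le> K * D" .
  qed
qed

lemma finite_polytope_points:
  assumes "spanning m cs"
  shows "finite (polytope_points m cs q)"
proof -
  obtain K where K: "\<And>w j D. D \<ge> 0 \<Longrightarrow> \<forall>c\<in>set cs. \<bar>\<Sum>k<m. w k * real_of_int (c ! k)\<bar> \<le> D \<Longrightarrow> j < m \<Longrightarrow> \<bar>w j\<bar> \<le> K * D"
    using spanning_bounded[OF assms] by blast
  have "set e \<subseteq> {- \<lceil>K * q\<rceil>..\<lceil>K * q\<rceil>}" if "e \<in> polytope_points m cs q" for e
  proof
    fix x assume "x \<in> set e"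
    moreover have "length e = m" using that by (simp add: polytope_points_def)
    ultimately obtain j where j: "j < m" "x = e ! j" by (auto simp: in_set_conv_nth)
    have "\<bar>\<Sum>k<m. real_of_int (e ! k) * real_of_int (c ! k)\<bar> \<le> real q" if "c \<in> set cs" for c
    proof -
      have "0 \<le> idot m e c" "idot m e c < int q"
        using \<open>e \<in> _\<close> that by (auto simp: polytope_points_def)
      then have "\<bar>real_of_int (idot m e c)\<bar> \<le> real q" by linarith
      then show ?thesis by (simp add: idot_def)
    qed
    then have "\<bar>real_of_int x\<bar> \<le> K * q" using K[of "real q" "\<lambda>k. real_of_int (e ! k)" j] j by simp
    then show "x \<in> {- \<lceil>K * q\<rceil>..\<lceil>K * q\<rceil>}" by (auto simp: abs_le_iff) linarith+
  qed
  then have "polytope_points m cs q \<subseteq> {e. set e \<subseteq> {- \<lceil>K * q\<rceil>..\<lceil>K * q\<rceil>} \<and> length e = m}"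
    by (auto simp: polytope_points_def)
  then show ?thesis by (rule finite_subset) (rule finite_lists_length_eq, simp)
qed

text \<open>The lattice points of the dilated polytope index the cubes of side \<open>1/q\<close> whose
  lower corner lies in the polytope; off the bounding hyperplanes the indicator function of
  their union converges pointwise to that of the polytope.\<close>

theorem polytope_points_asymptotics:
  assumes span: "spanning m cs" and nz: "\<And>c. c \<in> set cs \<Longrightarrow> \<exists>k<m. c ! k \<noteq> 0"
  shows "(\<lambda>q. real (card (polytope_points m cs q)) / real q ^ m) \<longlonglongrightarrow> P_vol m cs"
proof -
  interpret product_sigma_finite "\<lambda>_::nat. lborel :: real measure" by standard
  let ?M = "Pi\<^sub>M {..<m} (\<lambda>_::nat. lborel :: real measure)"
  let ?dot = "\<lambda>w (c :: int list). \<Sum>k<m. w k * real_of_int (c ! k)"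
  define C where "C = {w \<in> {..<m} \<rightarrow>\<^sub>E (UNIV :: real set). \<forall>c\<in>set cs. 0 \<le> ?dot w c \<and> ?dot w c < 1}"
  have space: "space ?M = {..<m} \<rightarrow>\<^sub>E UNIV" by (simp add: space_PiM)
  have C_sets[measurable]: "C \<in> sets ?M"
  proof -
    have "{w \<in> space ?M. \<forall>c\<in>set cs. 0 \<le> ?dot w c \<and> ?dot w c < 1} \<in> sets ?M"
      by measurable
    then show ?thesis by (simp add: C_def space)
  qed
  define E where "E q = polytope_points m cs (Suc q)" for q
  \<comment> \<open>The lower corner of the cube of side 1/(q + 1) containing w. Thus w lies in the
    union of cubes \<open>Cq q\<close> exactly when \<open>fl q w\<close> satisfies the inequalities
    of the polytope.\<close>
  define fl where "fl q w j = real_of_int \<lfloor>real (Suc q) * w j\<rfloor> / real (Suc q)" for q and w :: "nat \<Rightarrow> real" and j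
  define cube where "cube q e = (\<Pi>\<^sub>E j\<in>{..<m}. {real_of_int (e ! j) / real (Suc q)..<(real_of_int (e ! j) + 1) / real (Suc q)})"
    for q and e :: "int list"
  define Cq where "Cq q = (\<Union>e\<in>E q. cube q e)" for q
  have finE: "finite (E q)" for q unfolding E_def by (rule finite_polytope_points[OF span])
  have cube_sets[measurable]: "cube q e \<in> sets ?M" for q e
    unfolding cube_def by (intro sets_PiM_I_finite) auto
  then have Cq_sets[measurable]: "Cq q \<in> sets ?M" for q
    unfolding Cq_def using finE by (intro sets.finite_UN) auto
  have cube_iff: "w \<in> cube q e \<longleftrightarrow> w \<in> space ?M \<and> (\<forall>j<m. \<lfloor>real (Suc q) * w j\<rfloor> = e ! j)" for w q e
  proof -
    have "(w j \<in> {real_of_int (e ! j) / real (Suc q)..<(real_of_int (e ! j) + 1) / real (Suc q)}) \<longleftrightarrow> \<lfloor>real (Suc q) * w j\<rfloor> = e ! j" for j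
      by (simp add: floor_eq_iff pos_divide_le_eq pos_less_divide_eq mult.commute del: of_nat_Suc)
    then show ?thesis by (auto simp: cube_def space PiE_iff)
  qed
  have dot_fl: "?dot (fl q w) c = real_of_int (\<Sum>k<m. \<lfloor>real (Suc q) * w k\<rfloor> * c ! k) / real (Suc q)" for q w c
    by (simp add: fl_def sum_divide_distrib)
  have fl_iff: "(0 \<le> ?dot (fl q w) c \<and> ?dot (fl q w) c < 1) \<longleftrightarrow>
      0 \<le> (\<Sum>k<m. \<lfloor>real (Suc q) * w k\<rfloor> * c ! k) \<and> (\<Sum>k<m. \<lfloor>real (Suc q) * w k\<rfloor> * c ! k) < int (Suc q)" for q w c
  proof -
    have *: "0 \<le> real_of_int z / real (Suc q) \<longleftrightarrow> 0 \<le> z" "real_of_int z / real (Suc q) < 1 \<longleftrightarrow> z < int (Suc q)" for z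
      by (simp_all add: zero_le_divide_iff pos_divide_less_eq del: of_nat_Suc) linarith
    show ?thesis unfolding dot_fl * ..
  qed
  have Cq_iff: "w \<in> Cq q \<longleftrightarrow> (\<forall>c\<in>set cs. 0 \<le> ?dot (fl q w) c \<and> ?dot (fl q w) c < 1)" if "w \<in> space ?M" for w q
  proof
    assume "w \<in> Cq q"
    then obtain e where e: "e \<in> E q" "\<forall>j<m. \<lfloor>real (Suc q) * w j\<rfloor> = e ! j"
      by (auto simp: Cq_def cube_iff)
    then have "(\<Sum>k<m. \<lfloor>real (Suc q) * w k\<rfloor> * c ! k) = idot m e c" for c
      unfolding idot_def by (intro sum.cong) (simp_all del: of_nat_Suc)
    then show "\<forall>c\<in>set cs. 0 \<le> ?dot (fl q w) c \<and> ?dot (fl q w) c < 1"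
      using e(1) unfolding fl_iff by (simp add: E_def polytope_points_def del: of_nat_Suc)
  next
    assume *: "\<forall>c\<in>set cs. 0 \<le> ?dot (fl q w) c \<and> ?dot (fl q w) c < 1"
    let ?e = "map (\<lambda>j. \<lfloor>real (Suc q) * w j\<rfloor>) [0..<m]"
    have "(\<Sum>k<m. \<lfloor>real (Suc q) * w k\<rfloor> * c ! k) = idot m ?e c" for c
      unfolding idot_def by (intro sum.cong) (simp_all del: of_nat_Suc)
    then have "?e \<in> E q"
      using * unfolding fl_iff by (simp add: E_def polytope_points_def del: of_nat_Suc)
    moreover have "w \<in> cube q ?e" using that by (simp add: cube_iff del: of_nat_Suc)
    ultimately show "w \<in> Cq q" by (auto simp: Cq_def)
  qed
  have em_cube: "emeasure ?M (cube q e) = ennreal ((1 / real (Suc q)) ^ m)" for q e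
  proof -
    have "emeasure ?M (cube q e) = (\<Prod>j<m. emeasure lborel {real_of_int (e ! j) / real (Suc q)..<(real_of_int (e ! j) + 1) / real (Suc q)})"
      unfolding cube_def by (rule emeasure_PiM) auto
    also have "\<dots> = (\<Prod>j<m. ennreal (1 / real (Suc q)))"
      by (intro prod.cong refl) (simp add: divide_right_mono add_divide_distrib del: of_nat_Suc)
    finally show ?thesis by (simp add: ennreal_power del: of_nat_Suc)
  qed
  have meas_Cq: "measure ?M (Cq q) = real (card (E q)) / real (Suc q) ^ m" for q
  proof -
    have "disjoint_family_on (cube q) (E q)"
      unfolding disjoint_family_on_def
    proof (intro ballI impI)
      fix e e' assume ee: "e \<in> E q" "e' \<in> E q" "e \<noteq> e'"
      then have "length e = m" "length e' = m" by (auto simp: E_def polytope_points_def)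
      with ee(3) obtain j where "j < m" "e ! j \<noteq> e' ! j" by (metis nth_equalityI)
      then show "cube q e \<inter> cube q e' = {}" by (fastforce simp: cube_iff)
    qed
    then have "measure ?M (Cq q) = (\<Sum>e\<in>E q. measure ?M (cube q e))"
      unfolding Cq_def by (intro measure_finite_Union finE) (auto simp: em_cube)
    also have "\<dots> = (\<Sum>e\<in>E q. (1 / real (Suc q)) ^ m)"
      by (simp add: measure_def em_cube del: of_nat_Suc)
    finally show ?thesis by (simp add: power_divide del: of_nat_Suc)
  qed
  obtain K where K: "K \<ge> 0" "\<And>w j D. D \<ge> 0 \<Longrightarrow> \<forall>c\<in>set cs. \<bar>\<Sum>k<m. w k * real_of_int (c ! k)\<bar> \<le> D \<Longrightarrow> j < m \<Longrightarrow> \<bar>w j\<bar> \<le> K * D"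
    using spanning_bounded[OF span] by blast
  \<comment> \<open>A box independent of q that dominates all the indicators: corners have
    coordinates at most K in absolute value, and a point is within 1 of its corner.\<close>
  define B where "B = (\<Pi>\<^sub>E j\<in>{..<m}. {- K - 1..K + 1})"
  have B_sets[measurable]: "B \<in> sets ?M" unfolding B_def by (intro sets_PiM_I_finite) auto
  have "emeasure ?M B = (\<Prod>j<m. emeasure lborel {- K - 1..K + 1})"
    unfolding B_def by (rule emeasure_PiM) auto
  also have "\<dots> = (\<Prod>j<m. ennreal ((K + 1) - (- K - 1)))"
    using K(1) by (intro prod.cong emeasure_lborel_Icc) auto
  also have "\<dots> < \<infinity>"
    using K(1) by (simp add: ennreal_power del: diff_minus_eq_add add_diff_cancel_left' ennreal_plus)
  finally have B_fin: "emeasure ?M B < \<infinity>" .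
  have Cq_B: "Cq q \<subseteq> B" for q
  proof
    fix w assume w: "w \<in> Cq q"
    then have sp: "w \<in> space ?M" by (auto simp: Cq_def cube_iff)
    have "\<bar>fl q w j\<bar> \<le> K" if "j < m" for j
      using K(2)[of 1 "fl q w" j] w that unfolding Cq_iff[OF sp] by force
    moreover have "\<bar>fl q w j - w j\<bar> \<le> 1" for j
    proof -
      have "fl q w j - w j = (real_of_int \<lfloor>real (Suc q) * w j\<rfloor> - real (Suc q) * w j) / real (Suc q)"
        by (simp add: fl_def diff_divide_distrib del: of_nat_Suc)
      moreover have "\<bar>real_of_int \<lfloor>real (Suc q) * w j\<rfloor> - real (Suc q) * w j\<bar> \<le> 1" by linarith
      ultimately show ?thesis by (simp add: abs_divide)
    qed
    ultimately have "\<bar>w j\<bar> \<le> K + 1" if "j < m" for j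
      using that by (smt (verit))
    then show "w \<in> B" using sp by (auto simp: B_def space PiE_iff abs_le_iff) (smt (verit))+
  qed
  \<comment> \<open>At a point on a bounding hyperplane the rounded points may fall on either side
    for ever; these hyperplanes are null sets because each c is nonzero.\<close>
  have AE: "AE w in ?M. \<forall>c\<in>set cs. ?dot w c \<noteq> 0 \<and> ?dot w c \<noteq> 1"
  proof (rule AE_finite_allI)
    fix c assume "c \<in> set cs"
    then obtain k where k: "k < m" "c ! k \<noteq> 0" using nz by blast
    have "AE w in ?M. ?dot w c \<noteq> t" for t
      using hyperplane_null_set[of k m "\<lambda>k. real_of_int (c ! k)" t] k
      by (auto simp: AE_iff_null_sets[symmetric] intro!: AE_I'[of "{w \<in> space ?M. ?dot w c = t}"])
    then show "AE w in ?M. ?dot w c \<noteq> 0 \<and> ?dot w c \<noteq> 1" by auto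
  qed simp
  have "(\<lambda>q. integral\<^sup>L ?M (indicator (Cq q) :: _ \<Rightarrow> real)) \<longlonglongrightarrow> integral\<^sup>L ?M (indicator C)"
  proof (rule integral_dominated_convergence[where w = "indicator B"])
    show "integrable ?M (indicator B :: _ \<Rightarrow> real)"
      using B_fin by (intro integrable_real_indicator) auto
    show "AE w in ?M. norm (indicator (Cq q) w :: real) \<le> indicator B w" for q
      using Cq_B[of q] by (intro AE_I2) (auto simp: indicator_def)
    show "AE w in ?M. (\<lambda>q. indicator (Cq q) w :: real) \<longlonglongrightarrow> indicator C w"
      using AE AE_space
    proof eventually_elim
      case (elim w)
      have "\<forall>\<^sub>F q in sequentially. (0 \<le> ?dot (fl q w) c \<and> ?dot (fl q w) c < 1) \<longleftrightarrow> (0 \<le> ?dot w c \<and> ?dot w c < 1)"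
        if c: "c \<in> set cs" for c
      proof -
        \<comment> \<open>Off the hyperplanes all relations are strict, hence they hold for the
          rounded points as soon as these are close enough to w.\<close>
        have lim: "(\<lambda>q. ?dot (fl q w) c) \<longlonglongrightarrow> ?dot w c"
          unfolding fl_def by (intro tendsto_sum tendsto_mult tendsto_const floor_scaled_tendsto)
        have *: "?dot w c \<noteq> 0" "?dot w c \<noteq> 1" using elim c by auto
        consider "?dot w c < 0" | "0 < ?dot w c" "?dot w c < 1" | "?dot w c > 1" using * by linarith
        then show ?thesis
        proof cases
          case 1
          from order_tendstoD(2)[OF lim 1] show ?thesis by eventually_elim (use 1 in auto)
        next
          case 2
          from order_tendstoD(1)[OF lim 2(1)] order_tendstoD(2)[OF lim 2(2)]
          show ?thesis by eventually_elim (use 2 in auto)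
        next
          case 3
          from order_tendstoD(1)[OF lim 3] show ?thesis by eventually_elim (use 3 in auto)
        qed
      qed
      then have "\<forall>\<^sub>F q in sequentially. \<forall>c\<in>set cs.
          (0 \<le> ?dot (fl q w) c \<and> ?dot (fl q w) c < 1) \<longleftrightarrow> (0 \<le> ?dot w c \<and> ?dot w c < 1)"
        by (intro eventually_ball_finite) auto
      then have "\<forall>\<^sub>F q in sequentially. (indicator (Cq q) w :: real) = indicator C w"
      proof eventually_elim
        case (elim q)
        then have "w \<in> Cq q \<longleftrightarrow> w \<in> C"
          using \<open>w \<in> space ?M\<close> unfolding Cq_iff[OF \<open>w \<in> space ?M\<close>] by (auto simp: C_def space)
        then show ?case by (simp add: indicator_def)
      qed
      then show ?case by (rule tendsto_eventually)
    qed
  qed auto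
  then have "(\<lambda>q. measure ?M (Cq q)) \<longlonglongrightarrow> measure ?M C"
    using sets.Int_space_eq2[OF C_sets] sets.Int_space_eq2[OF Cq_sets] by simp
  then have "(\<lambda>q. real (card (polytope_points m cs (Suc q))) / real (Suc q) ^ m) \<longlonglongrightarrow> P_vol m cs"
    unfolding meas_Cq E_def by (simp add: P_vol_def C_def del: of_nat_Suc)
  \<comment> \<open>The limit was taken along q + 1; shifting the index back does not affect
    it.\<close>
  then show ?thesis
    by (rule LIMSEQ_imp_Suc)
qed

section \<open>Counting residue classes\<close>

lemma idot_vadd: "length u = m \<Longrightarrow> length v = m \<Longrightarrow> idot m (vadd u v) w = idot m u w + idot m v w"
  by (simp add: idot_def distrib_right sum.distrib)

lemma idot_iscale: "length u = m \<Longrightarrow> idot m (iscale q u) w = int q * idot m u w"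
  by (simp add: idot_def sum_distrib_left mult.assoc)

lemma residue_residue [simp]: "residue q (residue q u) = residue q u"
  by (simp add: residue_def)

lemma length_residue [simp]: "length (residue q u) = length u"
  by (simp add: residue_def)

definition residue_lists :: "nat \<Rightarrow> nat \<Rightarrow> int list set" where
  "residue_lists q n = {r. set r \<subseteq> {0..<int q} \<and> length r = n}"

lemma card_residue_lists: "finite (residue_lists q n)" "card (residue_lists q n) = q ^ n"
  unfolding residue_lists_def by (simp_all add: finite_lists_length_eq card_lists_length_eq)

lemma residue_in_lists: "q > 0 \<Longrightarrow> length u = n \<Longrightarrow> residue q u \<in> residue_lists q n"
  by (auto simp: residue_def residue_lists_def)

lemma residue_id: "r \<in> residue_lists q n \<Longrightarrow> residue q r = r"
  unfolding residue_def residue_lists_def by (intro map_idI) auto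

text \<open>Two congruent points differ by q w, and their pairings with each c lie in an interval of
  length q that excludes its upper end, so w pairs to 0 with every c. As \<open>cs\<close> spans, w
  = 0.\<close>

lemma residue_inj_on_polytope_points:
  assumes span: "spanning m cs" and q: "q > 0"
  shows "inj_on (residue q) (polytope_points m cs q)"
proof (rule inj_onI)
  fix e e' assume e: "e \<in> polytope_points m cs q" and e': "e' \<in> polytope_points m cs q"
    and eq: "residue q e = residue q e'"
  have len: "length e = m" "length e' = m" using e e' by (auto simp: polytope_points_def)
  obtain w where w: "length w = m" "vadd e (iscale q w) = e'"
    using residue_eq_iff[of e e' q] eq len q by auto
  have "idot m w c = 0" if "c \<in> set cs" for c
  proof -
    have "idot m e' c = idot m e c + int q * idot m w c"
      using w len by (simp add: idot_vadd idot_iscale flip: w(2))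
    moreover have "0 \<le> idot m e c" "idot m e c < int q" "0 \<le> idot m e' c" "idot m e' c < int q"
      using e e' that by (auto simp: polytope_points_def)
    ultimately have "int q * idot m w c < int q * 1" "int q * (-1) < int q * idot m w c" by linarith+
    then show ?thesis using q by (simp only: mult_less_cancel_left) simp
  qed
  then have zero: "\<forall>c\<in>set cs. \<bar>\<Sum>k<m. real_of_int (w ! k) * real_of_int (c ! k)\<bar> \<le> 0"
    by (simp add: idot_def flip: of_int_mult of_int_sum)
  obtain K where K: "\<And>w D. D \<ge> 0 \<Longrightarrow> \<forall>c\<in>set cs. \<bar>\<Sum>k<m. w k * real_of_int (c ! k)\<bar> \<le> D \<Longrightarrow> \<forall>j<m. \<bar>w j\<bar> \<le> K * D"
    using spanning_bounded[OF span] by blast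
  have "\<forall>j<m. \<bar>real_of_int (w ! j)\<bar> \<le> K * 0" by (rule K[OF order_refl zero])
  then have "\<forall>j<m. w ! j = 0" by simp
  then show "e = e'" unfolding w(2)[symmetric] using w(1) len by (intro nth_equalityI) auto
qed

text \<open>Modulo q, L becomes a surjective homomorphism (Z/q)^n \<rightarrow> (Z/q)^m, whose
  fibres all have the same size. The factor q^(n - m) is written as a product on both sides, so no
  subtraction of naturals occurs.\<close>

lemma card_residues_lift:
  fixes L :: "int list \<Rightarrow> int list"
  assumes q: "q > 0"
    and L_len: "\<And>u. length u = n \<Longrightarrow> length (L u) = m"
    and L_add: "\<And>u v. length u = n \<Longrightarrow> length v = n \<Longrightarrow> L (vadd u v) = vadd (L u) (L v)"
    and L_scale: "\<And>u. length u = n \<Longrightarrow> L (iscale q u) = iscale q (L u)"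
    and L_surj: "\<And>e. length e = m \<Longrightarrow> \<exists>d. length d = n \<and> L d = e"
    and E: "\<And>e. e \<in> E \<Longrightarrow> length e = m"
  shows "card (residue q ` {d. length d = n \<and> L d \<in> E}) * q ^ m = card (residue q ` E) * q ^ n"
proof -
  define \<beta> where "\<beta> r = residue q (L r)" for r
  define F where "F t = {r \<in> residue_lists q n. \<beta> r = t}" for t
  let ?Rn = "residue_lists q n" and ?Rm = "residue_lists q m"
  have Rn_len: "r \<in> ?Rn \<Longrightarrow> length r = n" and Rm_len: "r \<in> ?Rm \<Longrightarrow> length r = m" for r
    by (auto simp: residue_lists_def)
  have shift: "residue q (vadd u (iscale q w)) = residue q u" if "length u = length w" for u w
    using that residue_eq_iff[of u "vadd u (iscale q w)" q] q by auto
  have cong: "residue q (L u) = residue q (L v)"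
    if uv: "length u = n" "length v = n" "residue q u = residue q v" for u v
  proof -
    obtain w where w: "length w = n" "vadd u (iscale q w) = v"
      using uv residue_eq_iff[of u v q] q by auto
    have "L v = vadd (L u) (iscale q (L w))"
      unfolding w(2)[symmetric] using uv(1) w(1) by (simp add: L_add L_scale)
    then show ?thesis using shift uv w L_len by simp
  qed
  have \<beta>_in: "\<beta> r \<in> ?Rm" if "r \<in> ?Rn" for r
    unfolding \<beta>_def by (rule residue_in_lists[OF q L_len[OF Rn_len[OF that]]])
  \<comment> \<open>Translation by a lift of t' - t injects the fibre over t into the fibre over t';
    exchanging t and t' gives equality.\<close>
  have F_le: "card (F t) \<le> card (F t')" if t: "t \<in> ?Rm" "t' \<in> ?Rm" for t t'
  proof -
    obtain s where s: "length s = n" "L s = vsub t' t"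
      using L_surj[of "vsub t' t"] Rm_len t by auto
    show ?thesis
    proof (rule card_inj_on_le[of "\<lambda>r. residue q (vadd r s)"])
      show "inj_on (\<lambda>r. residue q (vadd r s)) (F t)"
      proof (rule inj_onI)
        fix r r' assume r: "r \<in> F t" "r' \<in> F t" and eq: "residue q (vadd r s) = residue q (vadd r' s)"
        have len: "length r = n" "length r' = n" using r Rn_len by (auto simp: F_def)
        obtain w where w: "length w = n" "vadd (vadd r s) (iscale q w) = vadd r' s"
          using eq residue_eq_iff[of "vadd r s" "vadd r' s" q] q len s by auto
        have "vadd r (iscale q w) = r'"
        proof (rule nth_equalityI)
          fix i assume i: "i < length (vadd r (iscale q w))"
          have "vadd (vadd r s) (iscale q w) ! i = vadd r' s ! i" by (simp only: w(2))
          then show "vadd r (iscale q w) ! i = r' ! i" using i len s w(1) by simp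
        qed (use len w in simp)
        then have "residue q r = residue q r'"
          using len w(1) q residue_eq_iff[of r r' q] by auto
        moreover have "residue q r = r" "residue q r' = r'"
          using r by (auto simp: F_def intro!: residue_id)
        ultimately show "r = r'" by simp
      qed
      show "(\<lambda>r. residue q (vadd r s)) ` F t \<subseteq> F t'"
      proof (rule image_subsetI)
        fix r assume r: "r \<in> F t"
        then have len: "length r = n" and \<beta>: "residue q (L r) = t"
          unfolding F_def \<beta>_def by (simp_all add: Rn_len)
        have Lr: "length (L r) = m" using L_len len by simp
        have "\<beta> (residue q (vadd r s)) = residue q (L (vadd r s))"
          unfolding \<beta>_def using len s by (intro cong) auto
        also have "\<dots> = residue q (vadd (L r) (vsub t' t))" using len s by (simp add: L_add)
        also have "\<dots> = residue q t'"
        proof (rule nth_equalityI)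
          fix i assume "i < length (residue q (vadd (L r) (vsub t' t)))"
          then have i: "i < m" using Lr Rm_len t by simp
          have "L r ! i mod int q = t ! i"
            using arg_cong[OF \<beta>, of "\<lambda>x. x ! i"] Lr i by (simp add: residue_def)
          moreover have "(L r ! i + (t' ! i - t ! i)) mod int q = (L r ! i mod int q + (t' ! i - t ! i)) mod int q"
            by (simp add: mod_add_left_eq)
          ultimately have "(L r ! i + (t' ! i - t ! i)) mod int q = t' ! i mod int q" by simp
          then show "residue q (vadd (L r) (vsub t' t)) ! i = residue q t' ! i"
            using i Lr Rm_len t by (simp add: residue_def)
        qed (use Lr Rm_len t in simp)
        also have "\<dots> = t'" using t residue_id by simp
        finally show "residue q (vadd r s) \<in> F t'"
          using residue_in_lists[OF q, of "vadd r s" n] len s by (simp add: F_def)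
      qed
      show "finite (F t')" using card_residue_lists(1) by (simp add: F_def)
    qed
  qed
  let ?t0 = "residue q (replicate m 0)"
  have t0: "?t0 \<in> ?Rm" using q by (intro residue_in_lists) auto
  have F_card: "card (F t) = card (F ?t0)" if "t \<in> ?Rm" for t
    using F_le[OF that t0] F_le[OF t0 that] by simp
  have fibres: "card {r \<in> ?Rn. \<beta> r \<in> T} = card T * card (F ?t0)" if "T \<subseteq> ?Rm" for T
  proof -
    have "finite T" using that card_residue_lists(1) finite_subset by blast
    moreover have "{r \<in> ?Rn. \<beta> r \<in> T} = (\<Union>t\<in>T. F t)" by (auto simp: F_def)
    moreover have "card (\<Union>t\<in>T. F t) = (\<Sum>t\<in>T. card (F t))"
      using \<open>finite T\<close> card_residue_lists(1) by (intro card_UN_disjoint) (auto simp: F_def)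
    ultimately show ?thesis using F_card that by (simp add: subset_iff)
  qed
  have "{r \<in> ?Rn. \<beta> r \<in> ?Rm} = ?Rn" using \<beta>_in by auto
  then have total: "q ^ n = q ^ m * card (F ?t0)"
    using fibres[of ?Rm] card_residue_lists(2) by simp
  have "residue q ` {d. length d = n \<and> L d \<in> E} = {r \<in> ?Rn. \<beta> r \<in> residue q ` E}"
  proof (intro equalityI subsetI)
    fix r assume "r \<in> residue q ` {d. length d = n \<and> L d \<in> E}"
    then obtain d where d: "length d = n" "L d \<in> E" "r = residue q d" by blast
    have "r \<in> ?Rn" unfolding d(3) by (rule residue_in_lists[OF q d(1)])
    moreover have "\<beta> r = residue q (L d)" unfolding \<beta>_def d(3) using d(1) by (intro cong) auto
    ultimately show "r \<in> {r \<in> ?Rn. \<beta> r \<in> residue q ` E}" using d(2) by simp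
  next
    fix r assume "r \<in> {r \<in> ?Rn. \<beta> r \<in> residue q ` E}"
    then obtain e where r: "r \<in> ?Rn" "\<beta> r = residue q e" and e: "e \<in> E" by blast
    have len: "length r = n" "length (L r) = m" "length e = m"
      by (rule Rn_len[OF r(1)], rule L_len[OF Rn_len[OF r(1)]], rule E[OF e])
    obtain w where w: "length w = m" "vadd (L r) (iscale q w) = e"
      using r(2) len residue_eq_iff[of "L r" e q] q by (auto simp: \<beta>_def)
    \<comment> \<open>Only L r \<equiv> e modulo q is known. Lifting the quotient w through L
      changes r by a multiple of q and makes the image equal to e.\<close>
    obtain w' where w': "length w' = n" "L w' = w" using L_surj w by blast
    have "L (vadd r (iscale q w')) = e" using len w w' by (simp add: L_add L_scale)
    moreover have "residue q (vadd r (iscale q w')) = r" using shift len w' residue_id r by simp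
    ultimately show "r \<in> residue q ` {d. length d = n \<and> L d \<in> E}"
      using len w' e by (intro image_eqI[of _ _ "vadd r (iscale q w')"]) auto
  qed
  moreover have "residue q ` E \<subseteq> ?Rm" using E q residue_in_lists by blast
  ultimately show ?thesis using fibres[of "residue q ` E"] total by simp
qed

section \<open>Integral functionals and saturated sublattices\<close>

lemma Gcd_linear_combination:
  fixes z :: "nat \<Rightarrow> int"
  shows "\<exists>d. (\<Sum>k<n. d k * z k) = Gcd (z ` {..<n})"
proof (induction n)
  case (Suc n)
  then obtain d where d: "(\<Sum>k<n. d k * z k) = Gcd (z ` {..<n})" by blast
  obtain u v where uv: "u * z n + v * Gcd (z ` {..<n}) = gcd (z n) (Gcd (z ` {..<n}))"
    using bezout_int by blast
  have "(\<Sum>k<Suc n. ((\<lambda>k. v * d k)(n := u)) k * z k) = (\<Sum>k<n. v * d k * z k) + u * z n"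
    by simp
  also have "(\<Sum>k<n. v * d k * z k) = v * Gcd (z ` {..<n})"
    unfolding d[symmetric] by (simp add: sum_distrib_left mult.assoc)
  finally have "(\<Sum>k<Suc n. ((\<lambda>k. v * d k)(n := u)) k * z k) = Gcd (z ` {..<Suc n})"
    using uv by (simp add: lessThan_Suc add.commute)
  then show ?case by (rule exI[of _ "(\<lambda>k. v * d k)(n := u)"])
qed simp

text \<open>Bezout's identity. Coprimality is phrased as the absence of a common divisor g > 1,
  which is the form that both primitivity and saturation refute directly.\<close>

lemma unimodular_functional:
  fixes z :: "nat \<Rightarrow> int"
  assumes "\<exists>k<n. z k \<noteq> 0" and "\<And>g. g > 1 \<Longrightarrow> \<exists>k<n. \<not> g dvd z k"
  shows "\<exists>d. (\<Sum>k<n. d k * z k) = 1"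
proof -
  let ?g = "Gcd (z ` {..<n})"
  have dvd: "?g dvd z k" if "k < n" for k using that by (intro Gcd_dvd) auto
  have "?g \<noteq> 0" using assms(1) dvd by (metis dvd_0_left)
  moreover have "\<not> ?g > 1" using assms(2) dvd by blast
  moreover have "?g \<ge> 0" by simp
  ultimately have "?g = 1" by linarith
  then show ?thesis using Gcd_linear_combination[where n = n and z = z] by metis
qed

text \<open>A basis of a saturated sublattice extends to a basis of the whole lattice; only the
  dual form is needed. The functionals are found one at a time: modulo the previous ones, the next
  basis vector becomes a vector \<open>z\<close> with coprime coordinates.\<close>

lemma saturated_basis_dual:
  fixes b :: "nat \<Rightarrow> nat \<Rightarrow> int"
  assumes indep: "\<And>c. (\<forall>k<n. (\<Sum>j<m. c j * b j k) = 0) \<Longrightarrow> \<forall>j<m. c j = 0"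
    and sat: "\<And>g x c. g > 1 \<Longrightarrow> (\<forall>k<n. g * x k = (\<Sum>j<m. c j * b j k)) \<Longrightarrow> \<exists>c'. \<forall>k<n. x k = (\<Sum>j<m. c' j * b j k)"
  shows "\<exists>d. \<forall>j<m. (\<Sum>k<n. d k * b j k) = t j"
proof -
  have "i \<le> m \<Longrightarrow> \<exists>d. \<forall>j<i. (\<Sum>k<n. d k * b j k) = t j" for i t
  proof (induction i arbitrary: t)
    case (Suc i)
    have "\<forall>l. \<exists>d. \<forall>j<i. (\<Sum>k<n. d k * b j k) = (if j = l then 1 else 0)"
      using Suc by simp
    then obtain \<delta> where \<delta>: "\<And>l j. j < i \<Longrightarrow> (\<Sum>k<n. \<delta> l k * b j k) = (if j = l then 1 else 0)"
      by metis
    \<comment> \<open>Coefficients of z = b_i - \<Sum> (\<delta>_l\<cdot>b_i) b_l over l < i, the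
      part of b_i that is annihilated by all the functionals \<open>\<delta> l\<close> with l <
      i.\<close>
    define \<zeta> where "\<zeta> l = (if l = i then 1 else if l < i then - (\<Sum>k<n. \<delta> l k * b i k) else 0)" for l
    define z where "z k = (\<Sum>j<m. \<zeta> j * b j k)" for k
    have im: "i < m" using Suc by simp
    have "\<exists>d. (\<Sum>k<n. d k * z k) = 1"
    proof (rule unimodular_functional)
      show "\<exists>k<n. z k \<noteq> 0"
      proof (rule ccontr)
        assume "\<not> (\<exists>k<n. z k \<noteq> 0)"
        then have "\<forall>j<m. \<zeta> j = 0" by (intro indep) (auto simp: z_def)
        then show False using im by (auto simp: \<zeta>_def)
      qed
      fix g :: int assume g: "g > 1"
      \<comment> \<open>If g divided z, saturation would put z/g into the lattice, and independence
        would make the coefficient 1 of b_i in z a multiple of g.\<close>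
      show "\<exists>k<n. \<not> g dvd z k"
      proof (rule ccontr)
        assume *: "\<not> (\<exists>k<n. \<not> g dvd z k)"
        then have "\<forall>k<n. g * (z k div g) = (\<Sum>j<m. \<zeta> j * b j k)" by (auto simp: z_def)
        then obtain c' where c': "\<forall>k<n. z k div g = (\<Sum>j<m. c' j * b j k)" using sat[OF g, of "\<lambda>k. z k div g" \<zeta>] by blast
        have "(\<Sum>j<m. (\<zeta> j - g * c' j) * b j k) = 0" if "k < n" for k
        proof -
          have "(\<Sum>j<m. (\<zeta> j - g * c' j) * b j k) = z k - g * (\<Sum>j<m. c' j * b j k)"
            by (simp add: z_def left_diff_distrib sum_subtractf sum_distrib_left mult.assoc)
          also have "\<dots> = z k - g * (z k div g)" using c' that by simp
          finally show ?thesis using * that by simp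
        qed
        then have "\<zeta> i - g * c' i = 0" using indep[of "\<lambda>j. \<zeta> j - g * c' j"] im by simp
        then have "1 = g * c' i" by (simp add: \<zeta>_def)
        then have "g dvd 1" by (rule dvdI)
        then have "g \<le> 1" by (rule zdvd_imp_le) simp
        then show False using g by simp
      qed
    qed
    then obtain d0 where d0: "(\<Sum>k<n. d0 k * z k) = 1" by blast
    define D where "D x j = (\<Sum>k<n. x k * b j k)" for x :: "nat \<Rightarrow> int" and j
    \<comment> \<open>Removing the values of \<open>d0\<close> on the earlier vectors makes
      \<open>d'\<close> vanish on them; its value on b_i becomes that of \<open>d0\<close> on z,
      which is 1. Adding a multiple of \<open>d'\<close> to any functional then adjusts its value on
      b_i alone.\<close>
    define d' where "d' k = d0 k - (\<Sum>l<i. D d0 l * \<delta> l k)" for k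
    have Dd': "D d' j = D d0 j - (\<Sum>l<i. D d0 l * D (\<delta> l) j)" for j
    proof -
      have "D d' j = D d0 j - (\<Sum>k<n. \<Sum>l<i. D d0 l * \<delta> l k * b j k)"
        by (simp add: D_def[of d'] D_def[of d0 j] d'_def left_diff_distrib sum_subtractf sum_distrib_right)
      also have "(\<Sum>k<n. \<Sum>l<i. D d0 l * \<delta> l k * b j k) = (\<Sum>l<i. D d0 l * D (\<delta> l) j)"
        by (subst sum.swap) (simp add: D_def[of "\<delta> _"] sum_distrib_left mult.assoc)
      finally show ?thesis .
    qed
    have d'_low: "D d' j = 0" if "j < i" for j
    proof -
      have "(\<Sum>l<i. D d0 l * D (\<delta> l) j) = (\<Sum>l<i. if l = j then D d0 l else 0)"
        using \<delta>[OF that] by (intro sum.cong) (auto simp: D_def)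
      then show ?thesis using that by (simp add: Dd')
    qed
    have d'_i: "D d' i = 1"
    proof -
      have "1 = (\<Sum>j<m. \<zeta> j * D d0 j)"
        unfolding d0[symmetric] z_def sum_distrib_left D_def
        by (subst sum.swap) (simp add: mult_ac)
      also have "\<dots> = (\<Sum>j\<in>insert i {..<i}. \<zeta> j * D d0 j)"
        using im by (intro sum.mono_neutral_right) (auto simp: \<zeta>_def)
      also have "\<dots> = D d0 i + (\<Sum>l<i. - D (\<delta> l) i * D d0 l)"
        by (simp add: \<zeta>_def D_def)
      also have "\<dots> = D d' i" by (simp add: Dd' sum_negf mult.commute)
      finally show ?thesis by simp
    qed
    obtain d1 where d1: "\<forall>j<i. D d1 j = t j" using Suc.IH[of t] Suc.prems unfolding D_def by auto
    define d where "d k = d1 k + (t i - D d1 i) * d' k" for k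
    have "D d j = D d1 j + (t i - D d1 i) * D d' j" for j
    proof -
      have "D d j = (\<Sum>k<n. d1 k * b j k + (t i - D d1 i) * (d' k * b j k))"
        unfolding D_def[of d] d_def by (intro sum.cong refl) (simp add: distrib_right mult.assoc)
      then show ?thesis unfolding D_def[of d1 j] D_def[of d'] by (simp add: sum.distrib sum_distrib_left)
    qed
    then have "\<forall>j<Suc i. D d j = t j" using d1 d'_low d'_i by (auto simp: less_Suc_eq)
    then show ?case unfolding D_def by blast
  qed simp
  then show ?thesis by blast
qed

section \<open>Duals of ray generators\<close>

lemma rdot_nth: "length x = m \<Longrightarrow> length y = m \<Longrightarrow> rdot x y = (\<Sum>j<m. x ! j * y ! j)"
  by (simp add: rdot_def sum_list_sum_nth atLeast0LessThan)

lemma rdot_rcomb: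
  assumes "length x = m"
  shows "rdot x (rcomb m c vs) = (\<Sum>i<length vs. c i * (\<Sum>j<m. x ! j * real_of_int (vs ! i ! j)))"
proof -
  have "rdot x (rcomb m c vs) = (\<Sum>j<m. \<Sum>i<length vs. x ! j * (c i * real_of_int (vs ! i ! j)))"
    using assms by (subst rdot_nth[of _ m]) (auto simp: rcomb_def sum_distrib_left)
  also have "\<dots> = (\<Sum>i<length vs. c i * (\<Sum>j<m. x ! j * real_of_int (vs ! i ! j)))"
    by (subst sum.swap) (simp add: sum_distrib_left mult_ac)
  finally show ?thesis .
qed

lemma rvec_in_cone:
  assumes "i < length vs" "length (vs ! i) = m"
  shows "rvec (vs ! i) \<in> cone_of m vs"
proof -
  have "rvec (vs ! i) = rcomb m (\<lambda>l. if l = i then 1 else 0) vs"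
    using assms by (intro nth_equalityI) (auto simp: rvec_def rcomb_def if_distrib[of "\<lambda>x. x * _"] cong: if_cong)
  then show ?thesis unfolding cone_of_def by force
qed

lemma dual_semigroup_iff:
  assumes len: "\<forall>v\<in>set vs. length v = m"
  shows "u \<in> dual_semigroup m vs \<longleftrightarrow> length u = m \<and> (\<forall>v\<in>set vs. 0 \<le> idot m u v)"
proof -
  have gen: "rdot (rvec u) (rvec v) = real_of_int (idot m u v)" if "length u = m" "v \<in> set vs" for v
    using that len by (subst rdot_nth[of _ m]) (auto simp: rvec_def idot_def)
  have cone: "rdot (rvec u) (rcomb m c vs) = (\<Sum>i<length vs. c i * real_of_int (idot m u (vs ! i)))"
    if "length u = m" for c
    using that by (subst rdot_rcomb) (auto simp: rvec_def idot_def)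
  show ?thesis
  proof (intro iffI conjI ballI)
    assume u: "u \<in> dual_semigroup m vs"
    then show l: "length u = m" by (simp add: dual_semigroup_def)
    fix v assume v: "v \<in> set vs"
    then obtain i where "i < length vs" "v = vs ! i" by (auto simp: in_set_conv_nth)
    then have "rvec v \<in> cone_of m vs" using rvec_in_cone len v by auto
    then have "0 \<le> rdot (rvec u) (rvec v)" using u by (simp add: dual_semigroup_def)
    then show "0 \<le> idot m u v" using gen[OF l v] by simp
  next
    assume *: "length u = m \<and> (\<forall>v\<in>set vs. 0 \<le> idot m u v)"
    have "0 \<le> rdot (rvec u) (rcomb m c vs)" if "\<forall>i. 0 \<le> c i" for c
      using * that by (auto simp: cone intro!: sum_nonneg mult_nonneg_nonneg)
    then show "u \<in> dual_semigroup m vs" using * by (auto simp: dual_semigroup_def cone_of_def)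
  qed
qed

text \<open>All that is used of the \<open>v\<^sub>i\<close> being primitive ray generators; unlike that property, this one
  passes to coordinates on \<open>N'\<close> at once.\<close>

definition facet_duals :: "nat \<Rightarrow> int list list \<Rightarrow> bool" where
  "facet_duals m vs \<longleftrightarrow> (\<forall>v\<in>set vs. length v = m \<and>
     (\<exists>u. length u = m \<and> idot m u v = 0 \<and> (\<forall>v'\<in>set vs. v' \<noteq> v \<longrightarrow> 0 < idot m u v')) \<and>
     (\<exists>w. length w = m \<and> idot m w v = -1))"

text \<open>A functional u that vanishes on v and is positive on the other generators is added N
  times, with N larger than every |w\<cdot>v'|; the value on v stays as it was.\<close>

lemma facet_duals_shift:
  assumes "facet_duals m vs" "v \<in> set vs" and w: "length w = m"
  obtains w' where "length w' = m" "idot m w' v = idot m w v" "\<And>v'. v' \<in> set vs \<Longrightarrow> v' \<noteq> v \<Longrightarrow> 0 < idot m w' v'"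
proof -
  obtain u where u: "length u = m" "idot m u v = 0" "\<And>v'. v' \<in> set vs \<Longrightarrow> v' \<noteq> v \<Longrightarrow> 0 < idot m u v'"
    using assms unfolding facet_duals_def by blast
  define N where "N = Suc (\<Sum>v'\<in>set vs. nat \<bar>idot m w v'\<bar>)"
  show ?thesis
  proof (rule that[of "vadd w (iscale N u)"])
    fix v' assume v': "v' \<in> set vs" "v' \<noteq> v"
    have "nat \<bar>idot m w v'\<bar> < N" unfolding N_def less_Suc_eq_le using v'(1) by (intro member_le_sum) auto
    then have "\<bar>idot m w v'\<bar> < int N" by linarith
    also have "int N * 1 \<le> int N * idot m u v'" using u(3)[OF v'] by (intro mult_left_mono) auto
    finally show "0 < idot m (vadd w (iscale N u)) v'"
      using u(1) w by (simp add: idot_vadd idot_iscale)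
  qed (use u w in \<open>auto simp: idot_vadd idot_iscale\<close>)
qed

text \<open>The witness outside S that violates the inequality of v only; it detects the bound
  d\<cdot>v < q for split degrees.\<close>

lemma facet_duals_separating:
  assumes "facet_duals m vs" "v \<in> set vs"
  obtains w where "length w = m" "idot m w v = -1" "\<And>v'. v' \<in> set vs \<Longrightarrow> v' \<noteq> v \<Longrightarrow> 0 < idot m w v'"
proof -
  obtain w where "length w = m" "idot m w v = -1" using assms unfolding facet_duals_def by blast
  then show ?thesis using facet_duals_shift[OF assms] that by metis
qed

text \<open>A lattice point in the interior of the dual cone: the shift is applied to the negative
  of a functional with value -1, so the value on v itself is positive too.\<close>

lemma facet_duals_interior:
  assumes "facet_duals m vs"
  obtains a where "length a = m" "\<And>v. v \<in> set vs \<Longrightarrow> 0 < idot m a v"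
proof (cases "set vs = {}")
  case True
  then show ?thesis using that[of "replicate m 0"] by simp
next
  case False
  then obtain v where v: "v \<in> set vs" by (meson ex_in_conv)
  then obtain w where w: "length w = m" "idot m w v = -1" using assms unfolding facet_duals_def by blast
  have "idot m (map uminus w) v = 1" using w by (simp add: idot_def sum_negf)
  then obtain a where "length a = m" "idot m a v = 1" "\<And>v'. v' \<in> set vs \<Longrightarrow> v' \<noteq> v \<Longrightarrow> 0 < idot m a v'"
    using facet_duals_shift[OF assms v, of "map uminus w"] w(1) by (metis length_map)
  then show ?thesis using that by (metis zero_less_one)
qed

text \<open>A sufficiently large multiple N a of an interior lattice point absorbs any u, since each
  a\<cdot>v is an integer and hence at least 1.\<close>

lemma full_exponent_monoid_dual_semigroup:
  assumes fd: "facet_duals m vs"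
  shows "full_exponent_monoid m (dual_semigroup m vs)"
proof -
  have len: "\<forall>v\<in>set vs. length v = m" using fd by (simp add: facet_duals_def)
  note iff = dual_semigroup_iff[OF len]
  show ?thesis
  proof
    fix u :: "int list" assume u: "length u = m"
    obtain a where a: "length a = m" "\<And>v. v \<in> set vs \<Longrightarrow> 0 < idot m a v"
      using facet_duals_interior[OF fd] by metis
    define N where "N = (\<Sum>v\<in>set vs. nat \<bar>idot m u v\<bar>)"
    have "0 \<le> int N * idot m a v + idot m u v" if "v \<in> set vs" for v
    proof -
      have "nat \<bar>idot m u v\<bar> \<le> N" unfolding N_def using that by (intro member_le_sum) auto
      then have "\<bar>idot m u v\<bar> \<le> int N" by linarith
      also have "int N * 1 \<le> int N * idot m a v" using a(2)[OF that] by (intro mult_left_mono) auto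
      finally show ?thesis by simp
    qed
    then have "vadd (iscale N a) u \<in> dual_semigroup m vs"
      using a u by (simp add: iff idot_vadd idot_iscale)
    moreover have "iscale N a \<in> dual_semigroup m vs"
      using a by (simp add: iff idot_iscale less_imp_le)
    ultimately show "\<exists>s\<in>dual_semigroup m vs. vadd s u \<in> dual_semigroup m vs" by blast
  qed (auto simp: iff idot_vadd idot_def[of m "replicate m 0"])
qed

text \<open>If d\<cdot>v \<ge> q, the separating w gives d + q w in S with w outside S. Conversely
  d\<cdot>v < q and d\<cdot>v + q (w\<cdot>v) \<ge> 0 force w\<cdot>v > -1, hence w\<cdot>v \<ge> 0
  by integrality.\<close>

lemma split_degrees_dual_semigroup:
  assumes fd: "facet_duals m vs" and q: "q > 0"
  shows "exponent_monoid.split_degrees m (dual_semigroup m vs) q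
       = {d. length d = m \<and> (\<forall>v\<in>set vs. 0 \<le> idot m d v \<and> idot m d v < int q)}"
proof -
  have len: "\<forall>v\<in>set vs. length v = m" using fd by (simp add: facet_duals_def)
  note iff = dual_semigroup_iff[OF len]
  interpret full_exponent_monoid m "dual_semigroup m vs"
    by (rule full_exponent_monoid_dual_semigroup[OF fd])
  show ?thesis
  proof (intro equalityI subsetI)
    fix d assume d: "d \<in> split_degrees q"
    then have dS: "length d = m" "\<And>v. v \<in> set vs \<Longrightarrow> 0 \<le> idot m d v" by (auto simp: split_degrees_def iff)
    have "idot m d v < int q" if v: "v \<in> set vs" for v
    proof (rule ccontr)
      assume *: "\<not> idot m d v < int q"
      obtain w where w: "length w = m" "idot m w v = -1" "\<And>v'. v' \<in> set vs \<Longrightarrow> v' \<noteq> v \<Longrightarrow> 0 < idot m w v'"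
        using facet_duals_separating[OF fd v] by blast
      have "0 \<le> idot m d v' + int q * idot m w v'" if v': "v' \<in> set vs" for v'
      proof (cases "v' = v")
        case False
        then have "0 \<le> idot m w v'" using w(3)[OF v'] by simp
        then show ?thesis using dS(2)[OF v'] by simp
      qed (use * w in simp)
      then have "vadd d (iscale q w) \<in> dual_semigroup m vs"
        using w(1) dS(1) by (simp add: iff idot_vadd idot_iscale)
      then have "w \<in> dual_semigroup m vs" using d w by (simp add: split_degrees_def)
      then show False using w(2) v by (fastforce simp: iff)
    qed
    then show "d \<in> {d. length d = m \<and> (\<forall>v\<in>set vs. 0 \<le> idot m d v \<and> idot m d v < int q)}"
      using dS by simp
  next
    fix d assume d: "d \<in> {d. length d = m \<and> (\<forall>v\<in>set vs. 0 \<le> idot m d v \<and> idot m d v < int q)}"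
    have "w \<in> dual_semigroup m vs" if w: "length w = m" "vadd d (iscale q w) \<in> dual_semigroup m vs" for w
    proof -
      have "0 \<le> idot m w v" if v: "v \<in> set vs" for v
      proof -
        have "0 \<le> idot m d v + int q * idot m w v"
          using w v d by (simp add: iff idot_vadd idot_iscale)
        moreover have "idot m d v < int q" using d v by simp
        ultimately have "int q * (-1) < int q * idot m w v" by simp
        then show ?thesis using q by (simp only: mult_less_cancel_left) simp
      qed
      then show ?thesis using w(1) by (simp add: iff)
    qed
    then show "d \<in> split_degrees q" using d by (simp add: split_degrees_def iff)
  qed
qed

text \<open>L stands for the restriction M \<rightarrow> M' and \<open>cs\<close> for the generators
  in coordinates of N'. A single statement covers both situations: the full-dimensional one is L =
  \<open>id\<close> with \<open>cs\<close> = \<open>vs\<close>.\<close>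

theorem has_F_signature_dual_semigroup:
  fixes L :: "int list \<Rightarrow> int list"
  assumes p: "prime p" "CHAR('k::field) = p" "surj (\<lambda>x::'k. x ^ p)"
    and fd: "facet_duals n vs" "facet_duals m cs" and span: "spanning m cs"
    and L_len: "\<And>u. length u = n \<Longrightarrow> length (L u) = m"
    and L_add: "\<And>u v. length u = n \<Longrightarrow> length v = n \<Longrightarrow> L (vadd u v) = vadd (L u) (L v)"
    and L_scale: "\<And>q u. length u = n \<Longrightarrow> L (iscale q u) = iscale q (L u)"
    and L_surj: "\<And>e. length e = m \<Longrightarrow> \<exists>d. length d = n \<and> L d = e"
    and len: "length cs = length vs"
    and L_dot: "\<And>d i. length d = n \<Longrightarrow> i < length vs \<Longrightarrow> idot n d (vs ! i) = idot m (L d) (cs ! i)"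
  shows "has_F_signature (sgring n (dual_semigroup n vs) :: (int list \<Rightarrow> 'k) ring) p (P_vol m cs)"
proof -
  interpret full_exponent_monoid n "dual_semigroup n vs"
    by (rule full_exponent_monoid_dual_semigroup[OF fd(1)])
  let ?R = "sgring n (dual_semigroup n vs) :: (int list \<Rightarrow> 'k) ring"
  have p0: "p > 0" "p > 1" using prime_gt_0_nat[OF p(1)] prime_gt_1_nat[OF p(1)] by simp_all
  have points: "{d. length d = n \<and> (\<forall>v\<in>set vs. 0 \<le> idot n d v \<and> idot n d v < int q)}
      = {d. length d = n \<and> L d \<in> polytope_points m cs q}" for q
  proof -
    have "(\<forall>v\<in>set vs. 0 \<le> idot n d v \<and> idot n d v < int q) \<longleftrightarrow> L d \<in> polytope_points m cs q"
      if d: "length d = n" for d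
      using L_len[OF d] L_dot[OF d] len by (simp add: polytope_points_def all_set_conv_all_nth)
    then show ?thesis by blast
  qed
  have rank: "real (free_rank ?R (p ^ e)) / real p ^ (e * krull_dim ?R)
      = real (card (polytope_points m cs (p ^ e))) / real (p ^ e) ^ m" for e
  proof -
    let ?q = "p ^ e"
    have q: "?q > 0" using p0 by simp
    have "free_rank ?R ?q = card (residue ?q ` split_degrees ?q)"
      by (rule free_rank_sgring[of ?q e]) (use p in auto)
    also have "\<dots> = card (residue ?q ` {d. length d = n \<and> L d \<in> polytope_points m cs ?q})"
      by (simp only: split_degrees_dual_semigroup[OF fd(1) q] points)
    also have "\<dots> * ?q ^ m = card (residue ?q ` polytope_points m cs ?q) * ?q ^ n"
    proof (rule card_residues_lift[OF q L_len L_add L_scale L_surj])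
      show "length e = m" if "e \<in> polytope_points m cs ?q" for e
        using that by (simp add: polytope_points_def)
    qed
    also have "card (residue ?q ` polytope_points m cs ?q) = card (polytope_points m cs ?q)"
      by (rule card_image[OF residue_inj_on_polytope_points[OF span q]])
    finally have "real (free_rank ?R ?q) * real ?q ^ m = real (card (polytope_points m cs ?q)) * real ?q ^ n"
      by (metis of_nat_mult of_nat_power)
    moreover have "real p ^ (e * krull_dim ?R) = real ?q ^ n"
      by (simp add: krull_dim_sgring power_mult)
    moreover have "real ?q ^ n \<noteq> 0" "real ?q ^ m \<noteq> 0" using q by auto
    ultimately show ?thesis by (simp only: frac_eq_eq not_False_eq_True)
  qed
  have "\<exists>k<m. c ! k \<noteq> 0" if "c \<in> set cs" for c
  proof (rule ccontr)
    assume "\<not> ?thesis"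
    then have "idot m w c = 0" for w by (simp add: idot_def)
    then show False using fd(2) that unfolding facet_duals_def by fastforce
  qed
  then have lim: "(\<lambda>q. real (card (polytope_points m cs q)) / real q ^ m) \<longlonglongrightarrow> P_vol m cs"
    by (rule polytope_points_asymptotics[OF span])
  \<comment> \<open>The asymptotics hold along all dilation factors; the F-signature needs only the
    subsequence of powers of p.\<close>
  have "strict_mono (\<lambda>e. p ^ e)" using p0(2) by (intro strict_monoI power_strict_increasing)
  then have "filterlim (\<lambda>e. p ^ e) sequentially sequentially" by (rule filterlim_subseq)
  from filterlim_compose[OF lim this] show ?thesis unfolding has_F_signature_def rank .
qed

section \<open>From primitive ray generators to integral functionals\<close>

lemma nonzero_entry:
  assumes "length v = m" "v \<noteq> replicate m 0"
  shows "\<exists>k<m. v ! k \<noteq> 0"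
proof (rule ccontr)
  assume "\<not> ?thesis"
  then have "v = replicate m 0" using assms(1) by (intro nth_equalityI) auto
  with assms(2) show False by blast
qed

text \<open>A common divisor g > 1 of the entries would make v/g a shorter lattice vector on the
  same ray; otherwise Bezout gives value 1, and the sign is flipped.\<close>

lemma primitive_functional:
  assumes v: "primitive m v"
  shows "\<exists>w. length w = m \<and> idot m w v = -1"
proof -
  have len: "length v = m" and nz: "v \<noteq> replicate m 0" using v by (auto simp: primitive_def)
  have "\<exists>d. (\<Sum>k<m. d k * v ! k) = 1"
  proof (rule unimodular_functional)
    show "\<exists>k<m. v ! k \<noteq> 0" by (rule nonzero_entry[OF len nz])
    fix g :: int assume g: "g > 1"
    show "\<exists>k<m. \<not> g dvd v ! k"
    proof (rule ccontr)
      assume *: "\<not> (\<exists>k<m. \<not> g dvd v ! k)"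
      define u where "u = map (\<lambda>x. x div g) v"
      have "rvec u = map ((*) (1 / real_of_int g)) (rvec v)"
      proof (rule nth_equalityI)
        fix i assume "i < length (rvec u)"
        then have i: "i < m" using len by (simp add: u_def rvec_def)
        then have "v ! i = g * (v ! i div g)" using * by simp
        then have "real_of_int (v ! i) = real_of_int g * real_of_int (v ! i div g)" by (metis of_int_mult)
        then show "rvec u ! i = map ((*) (1 / real_of_int g)) (rvec v) ! i"
          using i len g by (simp add: u_def rvec_def)
      qed (simp add: u_def rvec_def)
      moreover have "0 < 1 / real_of_int g" "1 / real_of_int g < 1" "length u = m"
        using g len by (auto simp: u_def)
      ultimately show False using v unfolding primitive_def by blast
    qed
  qed
  then obtain d where d: "(\<Sum>k<m. d k * v ! k) = 1" by blast
  have "idot m (map (\<lambda>k. - d k) [0..<m]) v = - (\<Sum>k<m. d k * v ! k)"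
    by (simp add: idot_def sum_negf)
  then show ?thesis using d by (intro exI[of _ "map (\<lambda>k. - d k) [0..<m]"]) simp
qed

text \<open>A scaling factor below 1 contradicts primitivity of v, one above 1 that of v'.
  Consequently the functional supporting one ray is strictly positive on every other
  generator.\<close>

lemma primitive_eq_of_half_line:
  assumes v: "primitive m v" and v': "primitive m v'" and "rvec v' \<in> half_line (rvec v)"
  shows "v' = v"
proof -
  obtain t where t: "t \<ge> 0" "rvec v' = map ((*) t) (rvec v)" using assms(3) by (auto simp: half_line_def)
  have len: "length v = m" "length v' = m" using v v' by (auto simp: primitive_def)
  have t_nth: "real_of_int (v' ! i) = t * real_of_int (v ! i)" if "i < m" for i
    using arg_cong[OF t(2), of "\<lambda>x. x ! i"] that len by (simp add: rvec_def)
  have "t \<noteq> 0"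
  proof
    assume "t = 0"
    then have "v' = replicate m 0" using t_nth len by (intro nth_equalityI) auto
    then show False using v' by (simp add: primitive_def)
  qed
  moreover have "\<not> t < 1" using v t \<open>t \<noteq> 0\<close> len unfolding primitive_def by (metis less_eq_real_def)
  moreover have "\<not> t > 1"
  proof
    assume "t > 1"
    have "rvec v = map ((*) (1 / t)) (rvec v')"
      using t_nth len \<open>t > 1\<close> by (intro nth_equalityI) (auto simp: rvec_def)
    moreover have "0 < 1 / t" "1 / t < 1" using \<open>t > 1\<close> by auto
    ultimately show False using v' len unfolding primitive_def by blast
  qed
  ultimately have "t = 1" by simp
  then show ?thesis using t_nth len by (intro nth_equalityI) auto
qed

text \<open>The functional supporting a ray may be irrational: approximate it by \<open>a/N\<close> with \<open>a\<close>
  integral, then correct one coordinate so that \<open>v\<close> is annihilated again.\<close>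

lemma ray_facet_functional:
  assumes vs: "primitive_ray_generators m vs" and v: "v \<in> set vs"
  shows "\<exists>u. length u = m \<and> idot m u v = 0 \<and> (\<forall>v'\<in>set vs. v' \<noteq> v \<longrightarrow> 0 < idot m u v')"
proof -
  have prim: "\<And>v. v \<in> set vs \<Longrightarrow> primitive m v" using vs by (simp add: primitive_ray_generators_def)
  then have len: "\<And>v. v \<in> set vs \<Longrightarrow> length v = m" by (simp add: primitive_def)
  have "is_face m (half_line (rvec v)) (cone_of m vs)"
    using vs v by (simp add: primitive_ray_generators_def is_ray_def)
  then obtain u where u: "length u = m" "\<And>x. x \<in> cone_of m vs \<Longrightarrow> 0 \<le> rdot u x"
    "half_line (rvec v) = {x \<in> cone_of m vs. rdot u x = 0}"
    unfolding is_face_def by blast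
  define D where "D x v = (\<Sum>j<m. x j * real_of_int (v ! j))" for x :: "nat \<Rightarrow> real" and v :: "int list"
  have D: "rdot u (rvec v') = D ((!) u) v'" if "v' \<in> set vs" for v'
    using u(1) len[OF that] by (subst rdot_nth[of _ m]) (auto simp: D_def rvec_def)
  have "rvec v \<in> half_line (rvec v)" unfolding half_line_def by (auto intro!: exI[of _ 1] simp: map_idI)
  then have Dv: "D ((!) u) v = 0" using u(3) D[OF v] by auto
  have Dv': "D ((!) u) v' > 0" if "v' \<in> set vs" "v' \<noteq> v" for v'
  proof -
    obtain i where "i < length vs" "v' = vs ! i" using \<open>v' \<in> set vs\<close> by (auto simp: in_set_conv_nth)
    then have "rvec v' \<in> cone_of m vs" using rvec_in_cone len that by auto
    moreover have "rvec v' \<notin> half_line (rvec v)" using primitive_eq_of_half_line prim v that by blast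
    ultimately show ?thesis using u(2)[of "rvec v'"] u(3) D[OF that(1)] by force
  qed
  have "v \<noteq> replicate m 0" using prim[OF v] by (simp add: primitive_def)
  then obtain k where k: "k < m" "v ! k \<noteq> 0"
    using nonzero_entry[OF len[OF v]] by blast
  define a where "a N j = \<lfloor>real (Suc N) * u ! j\<rfloor>" for N j
  define A where "A N = map (a N) [0..<m]" for N
  \<comment> \<open>Subtracting (A\<cdot>v)/v_k from coordinate k would annihilate v; multiplying
    through by v_k^2 keeps the entries integral and does not disturb signs, whatever the sign of
    v_k.\<close>
  define U where "U N = map (\<lambda>j. (v ! k)^2 * a N j - (if j = k then v ! k * idot m (A N) v else 0)) [0..<m]" for N
  have U: "idot m (U N) v' = (v ! k)^2 * idot m (A N) v' - v ! k * v' ! k * idot m (A N) v" for N v'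
  proof -
    have "idot m (U N) v' = (\<Sum>j<m. (v ! k)^2 * (a N j * v' ! j)) - (\<Sum>j<m. if j = k then v ! k * idot m (A N) v * v' ! j else 0)"
      unfolding sum_subtractf[symmetric]
      by (subst idot_def) (auto simp: U_def left_diff_distrib intro!: sum.cong)
    also have "(\<Sum>j<m. (v ! k)^2 * (a N j * v' ! j)) = (v ! k)^2 * idot m (A N) v'"
      by (simp add: idot_def A_def sum_distrib_left)
    finally show ?thesis using k by (simp add: mult_ac)
  qed
  have lim: "(\<lambda>N. real_of_int (idot m (A N) v') / real (Suc N)) \<longlonglongrightarrow> D ((!) u) v'" for v'
  proof -
    have "real_of_int (idot m (A N) v') / real (Suc N)
        = (\<Sum>j<m. real_of_int \<lfloor>real (Suc N) * u ! j\<rfloor> / real (Suc N) * real_of_int (v' ! j))" for N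
      by (simp add: idot_def A_def a_def sum_divide_distrib del: of_nat_Suc)
    then show ?thesis
      unfolding D_def by (simp only:) (intro tendsto_sum tendsto_mult tendsto_const floor_scaled_tendsto)
  qed
  have "\<forall>\<^sub>F N in sequentially. 0 < idot m (U N) v'" if v': "v' \<in> set vs - {v}" for v'
  proof -
    \<comment> \<open>After division by N + 1 the correction tends to a multiple of u\<cdot>v = 0,
      so the value on v' tends to v_k^2 (u\<cdot>v') > 0 and is eventually positive.\<close>
    have "(\<lambda>N. (real_of_int (v ! k))^2 * (real_of_int (idot m (A N) v') / real (Suc N))
          - real_of_int (v ! k * v' ! k) * (real_of_int (idot m (A N) v) / real (Suc N)))
        \<longlonglongrightarrow> (real_of_int (v ! k))^2 * D ((!) u) v' - real_of_int (v ! k * v' ! k) * D ((!) u) v"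
      by (intro tendsto_diff tendsto_mult tendsto_const lim)
    moreover have "0 < (real_of_int (v ! k))^2 * D ((!) u) v' - real_of_int (v ! k * v' ! k) * D ((!) u) v"
      using Dv Dv'[of v'] v' k by simp
    ultimately have "\<forall>\<^sub>F N in sequentially. 0 < (real_of_int (v ! k))^2 * (real_of_int (idot m (A N) v') / real (Suc N))
          - real_of_int (v ! k * v' ! k) * (real_of_int (idot m (A N) v) / real (Suc N))"
      by (rule order_tendstoD(1))
    then show ?thesis
    proof eventually_elim
      case (elim N)
      also have "(real_of_int (v ! k))^2 * (real_of_int (idot m (A N) v') / real (Suc N))
          - real_of_int (v ! k * v' ! k) * (real_of_int (idot m (A N) v) / real (Suc N))
          = real_of_int (idot m (U N) v') / real (Suc N)"
        by (simp add: U diff_divide_distrib del: of_nat_Suc)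
      finally show ?case by (simp add: zero_less_divide_iff)
    qed
  qed
  then have "\<forall>\<^sub>F N in sequentially. \<forall>v'\<in>set vs - {v}. 0 < idot m (U N) v'"
    by (intro eventually_ball_finite) auto
  then obtain N where N: "\<forall>v'\<in>set vs - {v}. 0 < idot m (U N) v'"
    by (auto simp: eventually_sequentially)
  moreover have "idot m (U N) v = 0" by (simp add: U power2_eq_square)
  ultimately show ?thesis by (intro exI[of _ "U N"]) (auto simp: U_def)
qed

lemma primitive_ray_generators_facet_duals:
  assumes "primitive_ray_generators m vs"
  shows "facet_duals m vs"
  unfolding facet_duals_def
proof (intro ballI conjI)
  fix v assume v: "v \<in> set vs"
  then have prim: "primitive m v" using assms by (simp add: primitive_ray_generators_def)
  then show "length v = m" by (simp add: primitive_def)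
  show "\<exists>w. length w = m \<and> idot m w v = -1" by (rule primitive_functional[OF prim])
  show "\<exists>u. length u = m \<and> idot m u v = 0 \<and> (\<forall>v'\<in>set vs. v' \<noteq> v \<longrightarrow> 0 < idot m u v')"
    by (rule ray_facet_functional[OF assms v])
qed


text \<open>The property speaks of pairings only, so L carries the functionals over. Distinctness of
  \<open>vs\<close> ensures that different entries of \<open>cs\<close> come from different
  generators, on which u is positive.\<close>

lemma facet_duals_lift:
  assumes fd: "facet_duals n vs" and dist: "distinct vs"
    and cs: "length cs = length vs" "\<forall>c\<in>set cs. length c = m"
    and L_len: "\<And>u. length u = n \<Longrightarrow> length (L u) = m"
    and L_dot: "\<And>d i. length d = n \<Longrightarrow> i < length vs \<Longrightarrow> idot n d (vs ! i) = idot m (L d) (cs ! i)"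
  shows "facet_duals m cs"
  unfolding facet_duals_def
proof (intro ballI conjI)
  fix c assume c: "c \<in> set cs"
  then show "length c = m" using cs by simp
  obtain i where i: "i < length vs" "c = cs ! i" using c cs by (auto simp: in_set_conv_nth)
  then have v: "vs ! i \<in> set vs" by simp
  obtain u where u: "length u = n" "idot n u (vs ! i) = 0" "\<forall>v'\<in>set vs. v' \<noteq> vs ! i \<longrightarrow> 0 < idot n u v'"
    using fd v unfolding facet_duals_def by blast
  obtain w where w: "length w = n" "idot n w (vs ! i) = -1"
    using fd v unfolding facet_duals_def by blast
  show "\<exists>w. length w = m \<and> idot m w c = -1"
    using w L_len[OF w(1)] L_dot[OF w(1) i(1)] i by (intro exI[of _ "L w"]) simp
  have "0 < idot m (L u) c'" if c': "c' \<in> set cs" "c' \<noteq> c" for c'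
  proof -
    obtain l where l: "l < length vs" "c' = cs ! l" using c' cs by (auto simp: in_set_conv_nth)
    then have "vs ! l \<noteq> vs ! i" using c' i dist by (metis nth_eq_iff_index_eq)
    then have "0 < idot n u (vs ! l)" using u(3) l by simp
    then show ?thesis using L_dot[OF u(1) l(1)] l by simp
  qed
  then show "\<exists>u. length u = m \<and> idot m u c = 0 \<and> (\<forall>v'\<in>set cs. v' \<noteq> c \<longrightarrow> 0 < idot m u v')"
    using u L_len[OF u(1)] L_dot[OF u(1) i(1)] i by (intro exI[of _ "L u"]) auto
qed

section \<open>The two cases of the theorem\<close>

lemma has_F_signature_full_dimensional:
  assumes p: "prime p" "CHAR('k::field) = p" "surj (\<lambda>x::'k. x ^ p)"
    and "facet_duals n vs" "spanning n vs"
  shows "has_F_signature (sgring n (dual_semigroup n vs) :: (int list \<Rightarrow> 'k) ring) p (P_vol n vs)"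
  by (rule has_F_signature_dual_semigroup[OF p, where L = id]) (use assms in auto)

lemma spanning_of_rspan:
  assumes "rspan n vs = {x. length x = n}"
  shows "spanning n vs"
  unfolding spanning_def
proof (intro allI impI)
  fix j assume j: "j < n"
  have "map (\<lambda>k. if k = j then 1 else 0) [0..<n] \<in> rspan n vs" using assms by simp
  then obtain t where t: "map (\<lambda>k. if k = j then 1 else 0) [0..<n] = rcomb n t vs"
    by (auto simp: rspan_def)
  have "(\<Sum>i<length vs. t i * real_of_int (vs ! i ! k)) = (if k = j then 1 else 0)" if "k < n" for k
    using arg_cong[OF t, of "\<lambda>x. x ! k"] that by (simp add: rcomb_def)
  then show "\<exists>t. \<forall>k<n. (\<Sum>i<length vs. t i * real_of_int (vs ! i ! k)) = (if k = j then 1 else 0)"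
    by blast
qed

text \<open>Perfectness of k is expressed by surjectivity of the Frobenius. In the second half
  \<open>bs\<close> is any lattice basis of N', the lattice points in the span of the cone, and
  \<open>cs\<close> lists the generators in this basis; the dual basis identifies M' with the
  standard lattice, so \<open>P_vol (length bs) cs\<close> is the volume relative to M'.\<close>

theorem theorem3p3:
  fixes p n :: nat and vs :: "int list list"
    and k_type :: "'k::field itself"
  assumes "prime p" and "CHAR('k) = p" and "surj (\<lambda>x::'k. x ^ p)"
    and "primitive_ray_generators n vs"
  shows "(rspan n vs = {x. length x = n} \<longrightarrow>
            has_F_signature (sgring n (dual_semigroup n vs) :: (int list \<Rightarrow> 'k) ring) p (P_vol n vs))
       \<and> (\<forall>bs cs.
            (\<forall>b\<in>set bs. length b = n) \<and>
            (\<forall>x. (length x = n \<and> rvec x \<in> rspan n vs) \<longleftrightarrow> (\<exists>c. x = icomb n c bs)) \<and>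
            (\<forall>c. rcomb n c bs = replicate n 0 \<longrightarrow> (\<forall>j<length bs. c j = 0)) \<and>
            length cs = length vs \<and> (\<forall>c\<in>set cs. length c = length bs) \<and>
            (\<forall>i<length vs. vs!i = icomb n (\<lambda>j. cs!i!j) bs)
          \<longrightarrow> has_F_signature (sgring n (dual_semigroup n vs) :: (int list \<Rightarrow> 'k) ring) p
                 (P_vol (length bs) cs)
            \<and> has_F_signature (sgring (length bs) (dual_semigroup (length bs) cs) :: (int list \<Rightarrow> 'k) ring) p
                 (P_vol (length bs) cs))"
proof (intro conjI impI allI)
  note p = assms(1-3)
  have fd: "facet_duals n vs" by (rule primitive_ray_generators_facet_duals[OF assms(4)])
  show "has_F_signature (sgring n (dual_semigroup n vs) :: (int list \<Rightarrow> 'k) ring) p (P_vol n vs)"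
    if "rspan n vs = {x. length x = n}"
    by (rule has_F_signature_full_dimensional[OF p fd spanning_of_rspan[OF that]])
  fix bs cs assume "(\<forall>b\<in>set bs. length b = n) \<and>
    (\<forall>x. (length x = n \<and> rvec x \<in> rspan n vs) \<longleftrightarrow> (\<exists>c. x = icomb n c bs)) \<and>
    (\<forall>c. rcomb n c bs = replicate n 0 \<longrightarrow> (\<forall>j<length bs. c j = 0)) \<and>
    length cs = length vs \<and> (\<forall>c\<in>set cs. length c = length bs) \<and>
    (\<forall>i<length vs. vs!i = icomb n (\<lambda>j. cs!i!j) bs)"
  then have bs_len: "\<And>b. b \<in> set bs \<Longrightarrow> length b = n"
    and bs_lattice: "\<And>x. length x = n \<and> rvec x \<in> rspan n vs \<longleftrightarrow> (\<exists>c. x = icomb n c bs)"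
    and bs_indep: "\<And>c j. rcomb n c bs = replicate n 0 \<Longrightarrow> j < length bs \<Longrightarrow> c j = 0"
    and cs_len: "length cs = length vs" "\<forall>c\<in>set cs. length c = length bs"
    and vs_cs: "\<And>i. i < length vs \<Longrightarrow> vs ! i = icomb n (\<lambda>j. cs ! i ! j) bs"
    by blast+
  let ?m = "length bs"
  \<comment> \<open>The restriction of functionals from N to N', written in the basis dual to
    \<open>bs\<close>.\<close>
  define L where "L d = map (idot n d) bs" for d
  have L_len: "length (L u) = ?m" for u by (simp add: L_def)
  have L_add: "L (vadd u v) = vadd (L u) (L v)" if "length u = n" "length v = n" for u v
    using that by (intro nth_equalityI) (auto simp: L_def idot_vadd)
  have L_scale: "L (iscale q u) = iscale q (L u)" if "length u = n" for q u
    using that by (intro nth_equalityI) (auto simp: L_def idot_iscale)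
  have L_dot: "idot n d (vs ! i) = idot ?m (L d) (cs ! i)" if "i < length vs" for d i
  proof -
    have "idot n d (vs ! i) = (\<Sum>k<n. \<Sum>j<?m. d ! k * (cs ! i ! j * bs ! j ! k))"
      by (simp add: idot_def vs_cs[OF that] icomb_def sum_distrib_left)
    also have "\<dots> = (\<Sum>j<?m. (\<Sum>k<n. d ! k * bs ! j ! k) * cs ! i ! j)"
      by (subst sum.swap) (simp add: sum_distrib_left mult_ac)
    finally show ?thesis by (simp add: idot_def L_def)
  qed
  have L_surj: "\<exists>d. length d = n \<and> L d = e" if e: "length e = ?m" for e
  proof -
    have "\<exists>d. \<forall>j<?m. (\<Sum>k<n. d k * bs ! j ! k) = e ! j"
    proof (rule saturated_basis_dual)
      fix c assume c: "\<forall>k<n. (\<Sum>j<?m. c j * bs ! j ! k) = 0"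
      have "rcomb n (\<lambda>j. real_of_int (c j)) bs = replicate n 0"
        using c by (intro nth_equalityI) (auto simp: rcomb_def simp flip: of_int_mult of_int_sum)
      then show "\<forall>j<?m. c j = 0" using bs_indep[of "\<lambda>j. real_of_int (c j)"] by simp
    next
      \<comment> \<open>Saturation of N': if g x lies in the span of the cone then so does x, and a
        lattice vector in the span is an integral combination of \<open>bs\<close>.\<close>
      fix g :: int and x c assume g: "g > 1" and x: "\<forall>k<n. g * x k = (\<Sum>j<?m. c j * bs ! j ! k)"
      have "rvec (icomb n c bs) \<in> rspan n vs" using bs_lattice by blast
      then obtain t where t: "rvec (icomb n c bs) = rcomb n t vs" by (auto simp: rspan_def)
      have "rvec (map x [0..<n]) = rcomb n (\<lambda>i. t i / real_of_int g) vs"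
      proof (rule nth_equalityI)
        fix k assume "k < length (rvec (map x [0..<n]))"
        then have k: "k < n" by (simp add: rvec_def)
        have "real_of_int (g * x k) = (\<Sum>i<length vs. t i * real_of_int (vs ! i ! k))"
          using arg_cong[OF t, of "\<lambda>y. y ! k"] k x by (simp add: rvec_def icomb_def rcomb_def del: of_int_mult)
        then have "real_of_int (x k) = (\<Sum>i<length vs. t i * real_of_int (vs ! i ! k)) / real_of_int g"
          using g by (simp add: field_simps)
        then show "rvec (map x [0..<n]) ! k = rcomb n (\<lambda>i. t i / real_of_int g) vs ! k"
          using k by (simp add: rvec_def rcomb_def sum_divide_distrib)
      qed (simp add: rvec_def rcomb_def)
      then have "rvec (map x [0..<n]) \<in> rspan n vs" by (auto simp: rspan_def)
      then obtain c' where c': "map x [0..<n] = icomb n c' bs" using bs_lattice[of "map x [0..<n]"] by auto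
      have "x k = (\<Sum>j<?m. c' j * bs ! j ! k)" if "k < n" for k
        using arg_cong[OF c', of "\<lambda>y. y ! k"] that by (simp add: icomb_def)
      then show "\<exists>c'. \<forall>k<n. x k = (\<Sum>j<?m. c' j * bs ! j ! k)" by blast
    qed
    then obtain d where d: "\<forall>j<?m. (\<Sum>k<n. d k * bs ! j ! k) = e ! j" by blast
    have "L (map d [0..<n]) = e"
      using d e by (intro nth_equalityI) (auto simp: L_def idot_def)
    then show ?thesis by (intro exI[of _ "map d [0..<n]"]) simp
  qed
  have span: "spanning ?m cs"
    unfolding spanning_def
  proof (intro allI impI)
    fix j assume j: "j < ?m"
    have "bs ! j = icomb n (\<lambda>l. if l = j then 1 else 0) bs"
      using j bs_len[OF nth_mem[OF j]]
      by (intro nth_equalityI) (auto simp: icomb_def if_distrib[of "\<lambda>x. x * _"] cong: if_cong)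
    then have "rvec (bs ! j) \<in> rspan n vs" using bs_lattice by blast
    then obtain t where t: "rvec (bs ! j) = rcomb n t vs" by (auto simp: rspan_def)
    \<comment> \<open>The basis vector bs_j is a real combination of the generators. Expanding these
      in \<open>bs\<close> gives it the coefficients s, and independence forces s to be the j-th
      unit vector, now expressed through \<open>cs\<close>.\<close>
    define s where "s l = (\<Sum>i<length vs. t i * real_of_int (cs ! i ! l))" for l
    have "rcomb n (\<lambda>l. s l - (if l = j then 1 else 0)) bs = replicate n 0"
    proof (rule nth_equalityI)
      fix k assume "k < length (rcomb n (\<lambda>l. s l - (if l = j then 1 else 0)) bs)"
      then have k: "k < n" by (simp add: rcomb_def)
      have "real_of_int (bs ! j ! k) = (\<Sum>i<length vs. t i * real_of_int (vs ! i ! k))"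
        using arg_cong[OF t, of "\<lambda>y. y ! k"] k bs_len[OF nth_mem[OF j]] by (simp add: rvec_def rcomb_def)
      also have "\<dots> = (\<Sum>i<length vs. \<Sum>l<?m. t i * real_of_int (cs ! i ! l) * real_of_int (bs ! l ! k))"
        using k by (intro sum.cong refl) (simp add: vs_cs icomb_def sum_distrib_left mult.assoc)
      also have "\<dots> = (\<Sum>l<?m. s l * real_of_int (bs ! l ! k))"
        by (subst sum.swap) (simp add: s_def sum_distrib_right)
      finally have "real_of_int (bs ! j ! k) = (\<Sum>l<?m. s l * real_of_int (bs ! l ! k))" .
      moreover have "(\<Sum>l<?m. (if l = j then 1 else 0) * real_of_int (bs ! l ! k)) = real_of_int (bs ! j ! k)"
        using j by (simp add: if_distrib[of "\<lambda>x. x * _"] cong: if_cong)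
      ultimately show "rcomb n (\<lambda>l. s l - (if l = j then 1 else 0)) bs ! k = replicate n 0 ! k"
        using k by (simp add: rcomb_def left_diff_distrib sum_subtractf)
    qed (simp add: rcomb_def)
    from bs_indep[OF this] have "s l = (if l = j then 1 else 0)" if "l < ?m" for l using that by fastforce
    then show "\<exists>t. \<forall>k<?m. (\<Sum>i<length cs. t i * real_of_int (cs ! i ! k)) = (if k = j then 1 else 0)"
      unfolding s_def cs_len(1) by blast
  qed
  have "distinct vs" using assms(4) by (simp add: primitive_ray_generators_def)
  then have fd': "facet_duals ?m cs"
    by (rule facet_duals_lift[OF fd _ cs_len, of L]) (simp_all add: L_len L_dot)
  show "has_F_signature (sgring n (dual_semigroup n vs) :: (int list \<Rightarrow> 'k) ring) p (P_vol ?m cs)"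
    by (rule has_F_signature_dual_semigroup[OF p fd fd' span, of L])
       (simp_all add: L_len L_add L_scale L_surj L_dot cs_len(1))
  show "has_F_signature (sgring ?m (dual_semigroup ?m cs) :: (int list \<Rightarrow> 'k) ring) p (P_vol ?m cs)"
    by (rule has_F_signature_full_dimensional[OF p fd' span])
qed

end
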